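(* Let $\mathcal{R}$ be an integral root system in a Euclidean space $\mathfrak{a}$ with Weyl group $W$, and let $k:\mathcal{R}\to(0,+\infty)$ be a $W$-invariant multiplicity function with $k_\alpha\ge 1/2$ for all $\alpha\in\mathcal{R}$. Let $\mathcal{L}$ be the associated Heckman--Opdam Laplacian on $\mathfrak{a}$. Then the set of bounded $W$-invariant harmonic functions $h:\mathfrak{a}\to\mathbb{R}$ for $\mathcal{L}$ is exactly the set of constant functions on $\mathfrak{a}$.
   Context: $\mathfrak{a}$ is a Euclidean vector space of dimension $n$ with inner product $\langle\cdot,\cdot\rangle$ and norm $|\cdot|$. $\mathcal{R}\subset\mathfrak{a}$ is an integral root system in the sense of Bourbaki: a finite set of nonzero vectors spanning $\mathfrak{a}$, stable under the reflections $r_\alpha$ below, with $\langle\alpha^\vee,\beta\rangle\in\mathbb{Z}$ for all $\alpha,\beta\in\mathcal{R}$, where $\alpha^\vee=2\alpha/|\alpha|^2$. A subset of positive roots $\mathcal{R}^+$ is fixed. For $\alpha\in\mathcal{R}$, $r_\alpha(x)=x-\langle\alpha^\vee,x\rangle\alpha$ is the orthogonal reflection associated with $\alpha$, and $W$ is the finite group generated by the $r_\alpha$'s. A multiplicity function is a function $k:\alpha\mapsto k_\alpha$ on $\mathcal{R}$ that is invariant under $W$. The Heckman--Opdam Laplacian $\mathcal{L}$ is the operator defined for $C^2$ functions $f$ on $\mathfrak{a}$ by $$\mathcal{L}f(x)=\Delta f(x)+\sum_{\alpha\in\mathcal{R}^+}k_\alpha\coth\frac{\langle\alpha,x\rangle}{2}\,\partial_\alpha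 f(x)-\sum_{\alpha\in\mathcal{R}^+}k_\alpha\frac{|\alpha|^2}{4\sinh^2\frac{\langle\alpha,x\rangle}{2}}\{f(x)-f(r_\alpha x)\},$$ where $\Delta$ is the Euclidean Laplacian and $\partial_\alpha$ is the derivative in the direction $\alpha$ (the formula is read for $x$ on no hyperplane $\{\langle\alpha,\cdot\rangle=0\}$ and extended by continuity elsewhere). It is known that $\frac12\mathcal{L}$ is the generator of a Feller semigroup $(P_t,t\ge 0)$ on $\mathfrak{a}$ (precisely, the generator on $C_0(\mathfrak{a})$ is the closure of $\frac12\mathcal{L}$ defined on $C_c^\infty(\mathfrak{a})$); $P_t$ is extended to bounded or nonnegative measurable functions through its transition kernel. A bounded or nonnegative function $h:\mathfrak{a}\to\mathbb{R}$ is called harmonic (for $\mathcal{L}$) if it is measurable and satisfies $P_th=h$ for all $t>0$. It is $W$-invariant if $h(wx)=h(x)$ for all $w\in W$, $x\in\mathfrak{a}$. *)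

theory Defs
  imports "HOL-Probability.Probability"
begin

section \<open>Root systems\<close>

definition coroot :: "'a::euclidean_space \<Rightarrow> 'a" where
  "coroot \<alpha> = (2 / (norm \<alpha>)\<^sup>2) *\<^sub>R \<alpha>"

definition root_reflection :: "'a::euclidean_space \<Rightarrow> 'a \<Rightarrow> 'a" where
  "root_reflection \<alpha> x = x - (coroot \<alpha> \<bullet> x) *\<^sub>R \<alpha>"

text \<open>Non-reduced systems (both \<open>\<alpha>\<close> and \<open>2\<alpha>\<close> are roots) are allowed, as in Bourbaki.\<close>

definition integral_root_system :: "'a::euclidean_space set \<Rightarrow> bool" where
  "integral_root_system R \<longleftrightarrow>
     finite R \<and> 0 \<notin> R \<and> span R = UNIV \<and>
     (\<forall>\<alpha>\<in>R. \<forall>\<beta>\<in>R. root_reflection \<alpha> \<beta> \<in> R) \<and>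
     (\<forall>\<alpha>\<in>R. \<forall>\<beta>\<in>R. coroot \<alpha> \<bullet> \<beta> \<in> \<int>)"

definition regular_points :: "'a::euclidean_space set \<Rightarrow> 'a set" where
  "regular_points R = {x. \<forall>\<alpha>\<in>R. \<alpha> \<bullet> x \<noteq> 0}"

definition positive_roots :: "'a::euclidean_space set \<Rightarrow> 'a set \<Rightarrow> bool" where
  "positive_roots R Rp \<longleftrightarrow> (\<exists>v\<in>regular_points R. Rp = {\<alpha>\<in>R. 0 < \<alpha> \<bullet> v})"

inductive_set weyl_group :: "'a::euclidean_space set \<Rightarrow> ('a \<Rightarrow> 'a) set" for R where
  one: "id \<in> weyl_group R"
| reflection: "\<alpha> \<in> R \<Longrightarrow> root_reflection \<alpha> \<in> weyl_group R"
| inverse: "w \<in> weyl_group R \<Longrightarrow> inv w \<in> weyl_group R"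
| mult: "v \<in> weyl_group R \<Longrightarrow> w \<in> weyl_group R \<Longrightarrow> v \<circ> w \<in> weyl_group R"

text \<open>A function on \<open>R\<close> is a total function of which only the values on \<open>R\<close> matter.\<close>

definition multiplicity_function :: "'a::euclidean_space set \<Rightarrow> ('a \<Rightarrow> real) \<Rightarrow> bool" where
  "multiplicity_function R k \<longleftrightarrow> (\<forall>w\<in>weyl_group R. \<forall>\<alpha>\<in>R. k (w \<alpha>) = k \<alpha>)"

definition weyl_invariant :: "'a::euclidean_space set \<Rightarrow> ('a \<Rightarrow> real) \<Rightarrow> bool" where
  "weyl_invariant R h \<longleftrightarrow> (\<forall>w\<in>weyl_group R. \<forall>x. h (w x) = h x)"

section \<open>The Heckman--Opdam Laplacian\<close>

definition dir_deriv :: "'a::euclidean_space \<Rightarrow> ('a \<Rightarrow> real) \<Rightarrow> 'a \<Rightarrow> real" where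
  "dir_deriv v f x = frechet_derivative f (at x) v"

definition laplacian :: "('a::euclidean_space \<Rightarrow> real) \<Rightarrow> 'a \<Rightarrow> real" where
  "laplacian f x = (\<Sum>b\<in>Basis. dir_deriv b (dir_deriv b f) x)"

definition coth :: "real \<Rightarrow> real" where
  "coth s = cosh s / sinh s"

definition HO_formula ::
    "'a::euclidean_space set \<Rightarrow> ('a \<Rightarrow> real) \<Rightarrow> ('a \<Rightarrow> real) \<Rightarrow> 'a \<Rightarrow> real" where
  "HO_formula Rp k f x =
     laplacian f x
     + (\<Sum>\<alpha>\<in>Rp. k \<alpha> * coth ((\<alpha> \<bullet> x) / 2) * dir_deriv \<alpha> f x)
     - (\<Sum>\<alpha>\<in>Rp. k \<alpha> * ((norm \<alpha>)\<^sup>2 / (4 * (sinh ((\<alpha> \<bullet> x) / 2))\<^sup>2))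
            * (f x - f (root_reflection \<alpha> x)))"

text \<open>
  On the root hyperplanes, where the individual terms of the formula are singular, the value is
  the limit along regular points; it exists whenever \<open>f\<close> is of class \<open>C\<^sup>2\<close>.
\<close>

definition HO_laplacian ::
    "'a::euclidean_space set \<Rightarrow> 'a set \<Rightarrow> ('a \<Rightarrow> real) \<Rightarrow> ('a \<Rightarrow> real) \<Rightarrow> 'a \<Rightarrow> real" where
  "HO_laplacian R Rp k f x =
     (if x \<in> regular_points R then HO_formula Rp k f x
      else Lim (at x within regular_points R) (HO_formula Rp k f))"

section \<open>Feller semigroups, generators and transition kernels\<close>

definition C0 :: "('a::euclidean_space \<Rightarrow> real) set" where
  "C0 = {f. continuous_on UNIV f \<and> (f \<longlongrightarrow> 0) at_infinity}"

primrec Ck :: "nat \<Rightarrow> ('a::euclidean_space \<Rightarrow> real) \<Rightarrow> bool" where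
  "Ck 0 f \<longleftrightarrow> continuous_on UNIV f"
| "Ck (Suc m) f \<longleftrightarrow> (\<forall>x. f differentiable (at x)) \<and> (\<forall>v. Ck m (dir_deriv v f))"

definition Cc_infinity :: "('a::euclidean_space \<Rightarrow> real) set" where
  "Cc_infinity = {f. (\<forall>m. Ck m f) \<and> compact (closure {x. f x \<noteq> 0})}"

text \<open>
  A strongly continuous semigroup of positive linear contractions of \<open>C0\<close> with the sup norm;
  \<open>T t\<close> is only relevant on \<open>C0\<close> and for \<open>t \<ge> 0\<close>. Conservativeness is not part of the
  definition.
\<close>

definition feller_semigroup ::
    "(real \<Rightarrow> ('a::euclidean_space \<Rightarrow> real) \<Rightarrow> ('a \<Rightarrow> real)) \<Rightarrow> bool" where
  "feller_semigroup T \<longleftrightarrow>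
     (\<forall>t\<ge>0. \<forall>f\<in>C0. T t f \<in> C0) \<and>
     (\<forall>t\<ge>0. \<forall>f\<in>C0. \<forall>g\<in>C0. \<forall>a b.
        T t (\<lambda>x. a * f x + b * g x) = (\<lambda>x. a * T t f x + b * T t g x)) \<and>
     (\<forall>t\<ge>0. \<forall>f\<in>C0. (\<forall>x. 0 \<le> f x) \<longrightarrow> (\<forall>x. 0 \<le> T t f x)) \<and>
     (\<forall>t\<ge>0. \<forall>f\<in>C0. \<forall>c. (\<forall>x. \<bar>f x\<bar> \<le> c) \<longrightarrow> (\<forall>x. \<bar>T t f x\<bar> \<le> c)) \<and>
     (\<forall>f\<in>C0. T 0 f = f) \<and>
     (\<forall>s\<ge>0. \<forall>t\<ge>0. \<forall>f\<in>C0. T (s + t) f = T s (T t f)) \<and>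
     (\<forall>f\<in>C0. uniform_limit UNIV (\<lambda>t. T t f) f (at_right 0))"

text \<open>Unbounded operators on \<open>C0\<close> are given by their graphs.\<close>

definition generator ::
    "(real \<Rightarrow> ('a::euclidean_space \<Rightarrow> real) \<Rightarrow> ('a \<Rightarrow> real)) \<Rightarrow> (('a \<Rightarrow> real) \<times> ('a \<Rightarrow> real)) set" where
  "generator T = {(f, g). f \<in> C0 \<and> g \<in> C0 \<and>
     uniform_limit UNIV (\<lambda>t x. (T t f x - f x) / t) g (at_right 0)}"

definition graph_closure ::
    "(('a::euclidean_space \<Rightarrow> real) \<times> ('a \<Rightarrow> real)) set \<Rightarrow> (('a \<Rightarrow> real) \<times> ('a \<Rightarrow> real)) set" where
  "graph_closure A = {(f, g). f \<in> C0 \<and> g \<in> C0 \<and>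
     (\<exists>\<phi> \<psi>. (\<forall>m::nat. (\<phi> m, \<psi> m) \<in> A) \<and>
        uniform_limit UNIV \<phi> f sequentially \<and> uniform_limit UNIV \<psi> g sequentially)}"

definition half_HO_graph ::
    "'a::euclidean_space set \<Rightarrow> 'a set \<Rightarrow> ('a \<Rightarrow> real) \<Rightarrow> (('a \<Rightarrow> real) \<times> ('a \<Rightarrow> real)) set" where
  "half_HO_graph R Rp k = {(f, \<lambda>x. HO_laplacian R Rp k f x / 2) | f. f \<in> Cc_infinity}"

definition transition_kernel ::
    "(real \<Rightarrow> ('a::euclidean_space \<Rightarrow> real) \<Rightarrow> ('a \<Rightarrow> real)) \<Rightarrow> (real \<Rightarrow> 'a \<Rightarrow> 'a measure) \<Rightarrow> bool" where
  "transition_kernel T P \<longleftrightarrow>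
     (\<forall>t\<ge>0. P t \<in> borel \<rightarrow>\<^sub>M subprob_algebra borel) \<and>
     (\<forall>t\<ge>0. \<forall>f\<in>C0. \<forall>x. T t f x = (\<integral>y. f y \<partial>(P t x)))"

definition bounded_harmonic ::
    "(real \<Rightarrow> 'a::euclidean_space \<Rightarrow> 'a measure) \<Rightarrow> ('a \<Rightarrow> real) \<Rightarrow> bool" where
  "bounded_harmonic P h \<longleftrightarrow>
     h \<in> borel_measurable borel \<and> bounded (range h) \<and>
     (\<forall>t>0. \<forall>x. (\<integral>y. h y \<partial>(P t x)) = h x)"

end

theory Submission
  imports Defs "HOL-Computational_Algebra.Polynomial"
begin

text \<open>
  Modulo the Weyl group the process generated by half the Heckman--Opdam Laplacian is a Brownian
  motion with a drift \<open>\<Sum> k\<^sub>\<alpha> coth(\<langle>\<alpha>,x\<rangle>/2) \<alpha>/2\<close>, which on each Weyl chamber is the gradient of a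
  concave function. Let two copies be driven by Brownian motions that mirror each other in the
  hyperplane halfway between them. Concavity means that the drifts only bring the copies
  together, so their distance stays below that of two mirrored Brownian motions, which meet almost
  surely. A bounded invariant harmonic function therefore takes equal values at any two points.

  The argument is carried out without stochastic processes. Coupling becomes a maximum principle in
  doubled variables: for an invariant smooth \<open>S\<close> with compact support one looks at a maximum of
  \<open>S x - S y - \<omega> |x - y|\<close>, where \<open>\<omega>\<close> solves the one-dimensional equation of the distance process
  (\<open>reflection_coupling_estimate\<close>). If the maximum lies on walls, where the drift is singular, the
  evenness of \<open>S\<close> across a wall turns the singular drift into a second derivative, and the second
  order conditions at the maximum control it (\<open>drift_contribution\<close>). Summing an arbitrary test
  function over Weyl orbits makes it invariant and removes the reflection terms
  (\<open>sum_HO_formula_orbit\<close>).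

  The generator is the closure of the operator on test functions, and the time integral
  \<open>u = \<integral>\<^sub>0\<^sup>N T\<^sub>s f ds\<close> lies in its domain with image \<open>T\<^sub>N f - f\<close> (\<open>time_integral_generator\<close>). Hence
  the maximum principle bounds the oscillation of the orbit sum of \<open>u/N\<close> between two fixed points
  by a quantity that depends only on \<open>sup |f|\<close> and tends to zero as \<open>N\<close> grows
  (\<open>orbit_time_integral_estimate\<close>). Such a bound is one on the total variation of a difference of
  two measures, so it extends from continuous functions to a bounded measurable \<open>h\<close>; and if \<open>h\<close> is
  invariant and harmonic, the orbit sum of its time average is a multiple of \<open>h\<close> itself
  (\<open>harmonic_difference_bound\<close>).

  That constants are harmonic means that no mass is lost (\<open>conservative\<close>): the drift grows at most
  linearly, so the Laplacian of a smooth radial cutoff at scale \<open>n\<close> is \<open>O(1/n)\<close>.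
\<close>

section \<open>Root systems and their Weyl groups\<close>

lemma linear_root_reflection: "linear (root_reflection \<alpha>)"
  unfolding root_reflection_def by (rule linearI) (simp_all add: algebra_simps)

lemma root_reflection_eq:
  "root_reflection \<alpha> x = x - (2 * (\<alpha> \<bullet> x) / (norm \<alpha>)\<^sup>2) *\<^sub>R \<alpha>"
  by (simp add: root_reflection_def coroot_def)

lemma orthogonal_transformation_root_reflection: "orthogonal_transformation (root_reflection \<alpha>)"
  unfolding orthogonal_transformation_def
proof (intro conjI allI linear_root_reflection)
  fix v w
  show "root_reflection \<alpha> v \<bullet> root_reflection \<alpha> w = v \<bullet> w"
    by (cases "\<alpha> = 0")
      (simp_all add: root_reflection_eq inner_diff_left inner_diff_right inner_commute
        power2_norm_eq_inner field_simps)
qed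

lemma root_reflection_involution: "root_reflection \<alpha> (root_reflection \<alpha> x) = x"
  by (cases "\<alpha> = 0")
    (simp_all add: root_reflection_eq inner_diff_right power2_norm_eq_inner algebra_simps)

lemma root_reflection_self: "\<alpha> \<noteq> 0 \<Longrightarrow> root_reflection \<alpha> \<alpha> = - \<alpha>"
  by (simp add: root_reflection_eq power2_norm_eq_inner scaleR_2)

lemma inner_root_reflection_self: "\<alpha> \<noteq> 0 \<Longrightarrow> \<alpha> \<bullet> root_reflection \<alpha> x = - (\<alpha> \<bullet> x)"
  by (simp add: root_reflection_eq inner_diff_right power2_norm_eq_inner)

lemma norm_root_reflection: "norm (root_reflection \<alpha> x) = norm x"
  using orthogonal_transformation_root_reflection orthogonal_transformation_norm by blast

lemma norm_diff_root_reflection: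
  assumes "\<alpha> \<noteq> 0"
  shows "(norm (x - root_reflection \<alpha> y))\<^sup>2
    = (norm (x - y))\<^sup>2 + 4 * (\<alpha> \<bullet> x) * (\<alpha> \<bullet> y) / (norm \<alpha>)\<^sup>2"
proof -
  let ?c = "2 * (\<alpha> \<bullet> y) / (\<alpha> \<bullet> \<alpha>)"
  have "\<alpha> \<bullet> \<alpha> \<noteq> 0"
    using assms by simp
  have expand: "(norm (d + c *\<^sub>R \<alpha>))\<^sup>2 = (norm d)\<^sup>2 + 2 * c * (\<alpha> \<bullet> d) + c * c * (\<alpha> \<bullet> \<alpha>)" for c d
    by (simp add: power2_norm_eq_inner inner_add_left inner_add_right inner_commute)
  have "x - root_reflection \<alpha> y = (x - y) + ?c *\<^sub>R \<alpha>"
    by (simp add: root_reflection_eq power2_norm_eq_inner)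
  then have "(norm (x - root_reflection \<alpha> y))\<^sup>2
      = (norm (x - y))\<^sup>2 + 2 * ?c * (\<alpha> \<bullet> x - \<alpha> \<bullet> y) + ?c * ?c * (\<alpha> \<bullet> \<alpha>)"
    by (simp only: expand inner_diff_right)
  also have "\<dots> = (norm (x - y))\<^sup>2 + 4 * (\<alpha> \<bullet> x) * (\<alpha> \<bullet> y) / (\<alpha> \<bullet> \<alpha>)"
    using \<open>\<alpha> \<bullet> \<alpha> \<noteq> 0\<close> by (simp add: field_simps)
  finally show ?thesis by (simp add: power2_norm_eq_inner)
qed

lemma orthogonal_transformation_weyl_group:
  "w \<in> weyl_group R \<Longrightarrow> orthogonal_transformation w"
proof (induction rule: weyl_group.induct)
  case one
  then show ?case by (simp add: id_def)
next
  case (reflection \<alpha>)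
  show ?case by (rule orthogonal_transformation_root_reflection)
next
  case (inverse w)
  then show ?case by (simp add: orthogonal_transformation_inv)
next
  case (mult v w)
  then show ?case by (metis orthogonal_transformation_compose)
qed

lemma bij_weyl_group: "w \<in> weyl_group R \<Longrightarrow> bij w"
  by (simp add: orthogonal_transformation_bij orthogonal_transformation_weyl_group)

lemma inner_weyl_group: "w \<in> weyl_group R \<Longrightarrow> w x \<bullet> w y = x \<bullet> y"
  using orthogonal_transformation_weyl_group orthogonal_transformation_def by blast

lemma linear_weyl_group: "w \<in> weyl_group R \<Longrightarrow> linear w"
  using orthogonal_transformation_weyl_group orthogonal_transformation_def by blast

lemma weyl_group_image_roots:
  assumes "integral_root_system R" and "w \<in> weyl_group R"
  shows "w ` R = R"
  using assms(2)
proof (induction rule: weyl_group.induct)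
  case (reflection \<alpha>)
  then have "root_reflection \<alpha> ` R \<subseteq> R"
    using assms(1) by (auto simp: integral_root_system_def)
  moreover have "\<beta> \<in> root_reflection \<alpha> ` R" if "\<beta> \<in> R" for \<beta>
    using \<open>root_reflection \<alpha> ` R \<subseteq> R\<close> that root_reflection_involution[of \<alpha> \<beta>]
    by (metis image_eqI image_subset_iff)
  ultimately show ?case by blast
next
  case (inverse w)
  then have "inv w ` (w ` R) = R"
    by (metis bij_weyl_group bij_def image_inv_f_f)
  with inverse show ?case by simp
next
  case (mult v w)
  then show ?case by (metis image_comp)
qed simp

text \<open>The roots span, so an element of the group is determined by the permutation of the
  roots that it induces.\<close>

lemma finite_weyl_group:
  assumes "integral_root_system R"
  shows "finite (weyl_group R)"
proof (rule finite_imageD)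
  have "finite R" "span R = UNIV"
    using assms by (auto simp: integral_root_system_def)
  have "(\<lambda>w. restrict w R) ` weyl_group R \<subseteq> R \<rightarrow>\<^sub>E R"
    using weyl_group_image_roots[OF assms] by (force intro!: restrict_PiE_iff[THEN iffD2])
  moreover have "finite (R \<rightarrow>\<^sub>E R)"
    using \<open>finite R\<close> by (simp add: finite_PiE)
  ultimately show "finite ((\<lambda>w. restrict w R) ` weyl_group R)"
    using finite_subset by blast
  show "inj_on (\<lambda>w. restrict w R) (weyl_group R)"
  proof (rule inj_onI)
    fix v w assume vw: "v \<in> weyl_group R" "w \<in> weyl_group R" "restrict v R = restrict w R"
    have "v x = w x" if "x \<in> R" for x
      using vw(3) that by (metis restrict_apply')
    then show "v = w"
      using linear_eq_on_span[OF linear_weyl_group[OF vw(1)] linear_weyl_group[OF vw(2)]]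
        \<open>span R = UNIV\<close> by blast
  qed
qed

lemma bij_betw_weyl_group_reflection_left:
  assumes "\<alpha> \<in> R"
  shows "bij_betw (\<lambda>w. root_reflection \<alpha> \<circ> w) (weyl_group R) (weyl_group R)"
  using assms
  by (intro bij_betwI[where g = "\<lambda>w. root_reflection \<alpha> \<circ> w"])
    (auto simp: fun_eq_iff root_reflection_involution intro: weyl_group.intros)

lemma bij_betw_weyl_group_reflection_right:
  assumes "\<alpha> \<in> R"
  shows "bij_betw (\<lambda>w. w \<circ> root_reflection \<alpha>) (weyl_group R) (weyl_group R)"
  using assms
  by (intro bij_betwI[where g = "\<lambda>w. w \<circ> root_reflection \<alpha>"])
    (auto simp: fun_eq_iff root_reflection_involution intro: weyl_group.intros)

lemma uminus_root:
  assumes "integral_root_system R" and "\<alpha> \<in> R"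
  shows "- \<alpha> \<in> R"
  using assms root_reflection_self[of \<alpha>] unfolding integral_root_system_def by metis

lemma multiplicity_uminus:
  assumes "integral_root_system R" and "multiplicity_function R k" and "\<alpha> \<in> R"
  shows "k (- \<alpha>) = k \<alpha>"
proof -
  have "\<alpha> \<noteq> 0"
    using assms by (auto simp: integral_root_system_def)
  then show ?thesis
    using assms weyl_group.reflection[of \<alpha> R] root_reflection_self[of \<alpha>]
    unfolding multiplicity_function_def by metis
qed

lemma positive_roots_subset: "positive_roots R Rp \<Longrightarrow> Rp \<subseteq> R"
  by (auto simp: positive_roots_def)

lemma sum_roots_eq_twice_sum_positive_roots:
  fixes g :: "'a::euclidean_space \<Rightarrow> real"
  assumes "integral_root_system R" and "positive_roots R Rp"
    and even: "\<And>\<alpha>. \<alpha> \<in> R \<Longrightarrow> g (- \<alpha>) = g \<alpha>"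
  shows "(\<Sum>\<alpha>\<in>R. g \<alpha>) = 2 * (\<Sum>\<alpha>\<in>Rp. g \<alpha>)"
proof -
  obtain v where v: "v \<in> regular_points R" "Rp = {\<alpha>\<in>R. 0 < \<alpha> \<bullet> v}"
    using assms(2) by (auto simp: positive_roots_def)
  have "finite R"
    using assms(1) by (auto simp: integral_root_system_def)
  have neg: "uminus ` Rp = {\<alpha>\<in>R. \<alpha> \<bullet> v < 0}"
  proof (intro set_eqI iffI)
    fix \<beta> assume "\<beta> \<in> {\<alpha>\<in>R. \<alpha> \<bullet> v < 0}"
    then have "- \<beta> \<in> Rp"
      using uminus_root[OF assms(1)] v by auto
    then show "\<beta> \<in> uminus ` Rp"
      by (metis image_eqI minus_minus)
  qed (use uminus_root[OF assms(1)] v in auto)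
  have "R = Rp \<union> uminus ` Rp" "Rp \<inter> uminus ` Rp = {}"
    using v unfolding neg by (auto simp: regular_points_def not_less order.order_iff_strict)
  then have "(\<Sum>\<alpha>\<in>R. g \<alpha>) = (\<Sum>\<alpha>\<in>Rp. g \<alpha>) + (\<Sum>\<alpha>\<in>uminus ` Rp. g \<alpha>)"
    using \<open>finite R\<close> by (metis finite_Un sum.union_disjoint)
  also have "(\<Sum>\<alpha>\<in>uminus ` Rp. g \<alpha>) = (\<Sum>\<alpha>\<in>Rp. g \<alpha>)"
    using even v by (subst sum.reindex) auto
  finally show ?thesis by simp
qed

lemma regular_points_weyl_group:
  assumes "integral_root_system R" and "w \<in> weyl_group R" and "x \<in> regular_points R"
  shows "w x \<in> regular_points R"
  unfolding regular_points_def
proof (intro CollectI ballI)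
  fix \<alpha> assume "\<alpha> \<in> R"
  then obtain \<beta> where "\<beta> \<in> R" "\<alpha> = w \<beta>"
    using weyl_group_image_roots[OF assms(1,2)] by (metis imageE)
  then show "\<alpha> \<bullet> w x \<noteq> 0"
    using assms(3) inner_weyl_group[OF assms(2)] by (auto simp: regular_points_def)
qed

lemma eventually_regular_along_ray:
  assumes "finite R" and "z \<in> regular_points R"
  shows "\<forall>\<^sub>F s in at_right 0. x + s *\<^sub>R z \<in> regular_points R"
proof -
  have "\<forall>\<^sub>F s in at_right 0. \<alpha> \<bullet> (x + s *\<^sub>R z) \<noteq> 0" if "\<alpha> \<in> R" for \<alpha>
  proof (cases "\<alpha> \<bullet> x = 0")
    case True
    have "\<forall>\<^sub>F s in at_right (0::real). 0 < s"
      by (simp add: eventually_at_right_less)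
    then show ?thesis
      by eventually_elim (use True that assms(2) in \<open>auto simp: inner_add_right regular_points_def\<close>)
  next
    case False
    have "((\<lambda>s. \<alpha> \<bullet> (x + s *\<^sub>R z)) \<longlongrightarrow> \<alpha> \<bullet> (x + 0 *\<^sub>R z)) (at_right 0)"
      by (intro tendsto_intros)
    then show ?thesis
      using False by (intro tendsto_imp_eventually_ne) auto
  qed
  then have "\<forall>\<^sub>F s in at_right 0. \<forall>\<alpha>\<in>R. \<alpha> \<bullet> (x + s *\<^sub>R z) \<noteq> 0"
    using assms(1) by (simp add: eventually_ball_finite_distrib)
  then show ?thesis by (simp add: regular_points_def)
qed

section \<open>Directional derivatives\<close>

lemma dir_deriv_eq: "(f has_derivative f') (at x) \<Longrightarrow> dir_deriv v f x = f' v"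
  unfolding dir_deriv_def using frechet_derivative_at by metis

lemma has_derivative_dir_deriv:
  "f differentiable (at x) \<Longrightarrow> (f has_derivative (\<lambda>v. dir_deriv v f x)) (at x)"
  unfolding dir_deriv_def using frechet_derivative_works by metis

lemma linear_dir_deriv: "f differentiable (at x) \<Longrightarrow> linear (\<lambda>v. dir_deriv v f x)"
  using has_derivative_dir_deriv has_derivative_linear by blast

lemma has_real_derivative_along_line:
  assumes "f differentiable (at (x + s *\<^sub>R v))"
  shows "((\<lambda>s. f (x + s *\<^sub>R v)) has_real_derivative dir_deriv v f (x + s *\<^sub>R v)) (at s)"
proof -
  have "((\<lambda>s. f (x + s *\<^sub>R v)) has_derivative (\<lambda>h. dir_deriv (h *\<^sub>R v) f (x + s *\<^sub>R v))) (at s)"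
    by (rule has_derivative_compose[of "\<lambda>s. x + s *\<^sub>R v" "\<lambda>h. h *\<^sub>R v" s UNIV f,
          OF _ has_derivative_dir_deriv[OF assms]])
      (auto intro!: derivative_eq_intros)
  moreover have "(\<lambda>h. dir_deriv (h *\<^sub>R v) f (x + s *\<^sub>R v))
      = (\<lambda>h. h * dir_deriv v f (x + s *\<^sub>R v))"
    using linear_cmul[OF linear_dir_deriv[OF assms]] by (auto simp: fun_eq_iff)
  ultimately show ?thesis
    by (simp add: has_field_derivative_def mult_commute_abs)
qed

lemma differentiable_comp_linear:
  fixes w :: "'a::euclidean_space \<Rightarrow> 'a"
  assumes "linear w" and "f differentiable (at (w x))"
  shows "(\<lambda>x. f (w x)) differentiable (at x)"
  using differentiable_chain_at[OF linear_imp_differentiable[OF assms(1)] assms(2)]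
  by (simp add: o_def)

lemma dir_deriv_comp_linear:
  fixes w :: "'a::euclidean_space \<Rightarrow> 'a"
  assumes "linear w" and "f differentiable (at (w x))"
  shows "dir_deriv v (\<lambda>x. f (w x)) x = dir_deriv (w v) f (w x)"
proof (rule dir_deriv_eq)
  show "((\<lambda>x. f (w x)) has_derivative (\<lambda>v. dir_deriv (w v) f (w x))) (at x)"
    by (rule has_derivative_compose[of w w x UNIV f, OF _ has_derivative_dir_deriv[OF assms(2)]])
      (simp add: assms(1) linear_imp_has_derivative)
qed

lemma dir_deriv_sum:
  assumes "\<And>i. i \<in> I \<Longrightarrow> f i differentiable (at x)"
  shows "dir_deriv v (\<lambda>x. \<Sum>i\<in>I. f i x) x = (\<Sum>i\<in>I. dir_deriv v (f i) x)"
  by (rule dir_deriv_eq) (intro has_derivative_sum has_derivative_dir_deriv assms)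

lemma dir_deriv_linear:
  assumes "\<And>x. f differentiable (at x)"
  shows "dir_deriv (a *\<^sub>R u + b *\<^sub>R v) f = (\<lambda>x. a * dir_deriv u f x + b * dir_deriv v f x)"
  by (simp add: fun_eq_iff linear_add[OF linear_dir_deriv[OF assms]]
      linear_cmul[OF linear_dir_deriv[OF assms]])

definition C2 :: "('a::euclidean_space \<Rightarrow> real) \<Rightarrow> bool" where
  "C2 f \<longleftrightarrow> (\<forall>x. f differentiable (at x)) \<and> (\<forall>v x. dir_deriv v f differentiable (at x)) \<and>
     (\<forall>u v. continuous_on UNIV (dir_deriv u (dir_deriv v f)))"

lemma C2D:
  assumes "C2 f"
  shows "f differentiable (at x)" "dir_deriv v f differentiable (at x)"
    "continuous_on UNIV (dir_deriv u (dir_deriv v f))"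
  using assms by (auto simp: C2_def)

lemma second_dir_deriv_linear_right:
  assumes "C2 f"
  shows "linear (\<lambda>v. dir_deriv u (dir_deriv v f) x)"
proof -
  have "dir_deriv u (dir_deriv (a *\<^sub>R v + b *\<^sub>R w) f) x
      = a * dir_deriv u (dir_deriv v f) x + b * dir_deriv u (dir_deriv w f) x" for a b v w
    unfolding dir_deriv_linear[OF C2D(1)[OF assms]]
    by (rule dir_deriv_eq)
      (intro has_derivative_add has_derivative_mult_right has_derivative_dir_deriv C2D[OF assms])
  from this[of 1 _ 1] this[of _ _ 0] show ?thesis
    by (intro linearI) (simp_all)
qed

text \<open>Invariance of the trace is needed twice: for the equivariance of the Laplacian under the Weyl
  group, and to mirror the frame at one of two coupled points.\<close>

lemma sum_Basis_orthogonal_transformation: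
  fixes B :: "'a::euclidean_space \<Rightarrow> 'a \<Rightarrow> real" and Q :: "'a \<Rightarrow> 'a"
  assumes Q: "orthogonal_transformation Q"
    and lin1: "\<And>v. linear (\<lambda>u. B u v)" and lin2: "\<And>u. linear (\<lambda>v. B u v)"
  shows "(\<Sum>b\<in>Basis. B (Q b) (Q b)) = (\<Sum>b\<in>Basis. B b b)"
proof -
  have expand: "B u v = (\<Sum>c\<in>Basis. \<Sum>d\<in>Basis. (u \<bullet> c) * (v \<bullet> d) * B c d)" for u v
  proof -
    have "B u v = B (\<Sum>c\<in>Basis. (u \<bullet> c) *\<^sub>R c) (\<Sum>d\<in>Basis. (v \<bullet> d) *\<^sub>R d)"
      by (simp add: euclidean_representation)
    also have "\<dots> = (\<Sum>c\<in>Basis. (u \<bullet> c) * B c (\<Sum>d\<in>Basis. (v \<bullet> d) *\<^sub>R d))"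
      by (simp only: linear_sum[OF lin1] linear_cmul[OF lin1] real_scaleR_def)
    also have "\<dots> = (\<Sum>c\<in>Basis. (u \<bullet> c) * (\<Sum>d\<in>Basis. (v \<bullet> d) * B c d))"
      by (simp only: linear_sum[OF lin2] linear_cmul[OF lin2] real_scaleR_def)
    finally show ?thesis by (simp only: sum_distrib_left mult.assoc)
  qed
  have adj: "Q b \<bullet> c = b \<bullet> inv Q c" for b c
  proof -
    have "Q b \<bullet> Q (inv Q c) = b \<bullet> inv Q c"
      using Q by (simp add: orthogonal_transformation_def)
    then show ?thesis
      using orthogonal_transformation_surj[OF Q] by (simp add: surj_f_inv_f)
  qed
  have "(\<Sum>b\<in>Basis. (Q b \<bullet> c) * (Q b \<bullet> d)) = (if c = d then 1 else 0)"
    if "c \<in> Basis" "d \<in> Basis" for c d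
  proof -
    have "(\<Sum>b\<in>Basis. (Q b \<bullet> c) * (Q b \<bullet> d)) = inv Q c \<bullet> inv Q d"
      unfolding adj euclidean_inner[of "inv Q c" "inv Q d"] by (simp only: inner_commute)
    also have "\<dots> = c \<bullet> d"
      using orthogonal_transformation_inv[OF Q] by (simp add: orthogonal_transformation_def)
    finally show ?thesis using that by (simp add: inner_Basis)
  qed
  then have "(\<Sum>c\<in>Basis. \<Sum>d\<in>Basis. (\<Sum>b\<in>Basis. (Q b \<bullet> c) * (Q b \<bullet> d)) * B c d)
      = (\<Sum>c\<in>Basis. \<Sum>d\<in>Basis. if c = d then B c d else 0)"
    by (intro sum.cong refl) simp
  then have key: "(\<Sum>c\<in>Basis. \<Sum>d\<in>Basis. (\<Sum>b\<in>Basis. (Q b \<bullet> c) * (Q b \<bullet> d)) * B c d)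
      = (\<Sum>c\<in>Basis. B c c)"
    by simp
  have "(\<Sum>b\<in>Basis. B (Q b) (Q b))
      = (\<Sum>b\<in>Basis. \<Sum>c\<in>Basis. \<Sum>d\<in>Basis. (Q b \<bullet> c) * (Q b \<bullet> d) * B c d)"
    by (intro sum.cong refl expand)
  also have "\<dots> = (\<Sum>c\<in>Basis. \<Sum>d\<in>Basis. \<Sum>b\<in>Basis. (Q b \<bullet> c) * (Q b \<bullet> d) * B c d)"
    by (rule trans[OF sum.swap], intro sum.cong refl sum.swap)
  finally show ?thesis
    using key by (simp add: sum_distrib_right)
qed

lemma laplacian_orthogonal_frame:
  fixes f :: "'a::euclidean_space \<Rightarrow> real" and Q :: "'a \<Rightarrow> 'a"
  assumes "C2 f" and "orthogonal_transformation Q"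
  shows "(\<Sum>b\<in>Basis. dir_deriv (Q b) (dir_deriv (Q b) f) x) = laplacian f x"
  unfolding laplacian_def
  using sum_Basis_orthogonal_transformation[of Q "\<lambda>u v. dir_deriv u (dir_deriv v f) x"]
    linear_dir_deriv[OF C2D(2)[OF assms(1)]] second_dir_deriv_linear_right[OF assms(1)] assms(2)
  by blast

section \<open>Sums over Weyl orbits\<close>

definition orbit_sum :: "'a::euclidean_space set \<Rightarrow> ('a \<Rightarrow> real) \<Rightarrow> 'a \<Rightarrow> real" where
  "orbit_sum R f x = (\<Sum>w\<in>weyl_group R. f (w x))"

text \<open>The Heckman--Opdam formula without its reflection terms, which vanish on invariant
  functions.\<close>

definition radial_formula ::
    "'a::euclidean_space set \<Rightarrow> ('a \<Rightarrow> real) \<Rightarrow> ('a \<Rightarrow> real) \<Rightarrow> 'a \<Rightarrow> real" where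
  "radial_formula Rp k f x =
     laplacian f x + (\<Sum>\<alpha>\<in>Rp. k \<alpha> * coth ((\<alpha> \<bullet> x) / 2) * dir_deriv \<alpha> f x)"

lemma coth_minus: "coth (- s) = - coth s"
  by (simp add: coth_def)

lemma dir_deriv_minus:
  assumes "f differentiable (at x)"
  shows "dir_deriv (- v) f x = - dir_deriv v f x"
  using linear_neg[OF linear_dir_deriv[OF assms], of v] .

lemma orbit_sum_reflection:
  assumes "\<alpha> \<in> R"
  shows "orbit_sum R f (root_reflection \<alpha> x) = orbit_sum R f x"
  using sum.reindex_bij_betw[OF bij_betw_weyl_group_reflection_right[OF assms],
      of "\<lambda>w. f (w x)"]
  by (simp add: orbit_sum_def)

lemma orbit_sum_derivs:
  assumes "C2 f" and "finite (weyl_group R)"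
  shows "dir_deriv v (orbit_sum R f) x = (\<Sum>w\<in>weyl_group R. dir_deriv (w v) f (w x))"
    and "dir_deriv u (dir_deriv v (orbit_sum R f)) x
      = (\<Sum>w\<in>weyl_group R. dir_deriv (w u) (dir_deriv (w v) f) (w x))"
    and "C2 (orbit_sum R f)"
proof -
  have lin: "linear w" if "w \<in> weyl_group R" for w
    using that by (rule linear_weyl_group)
  have S: "orbit_sum R f = (\<lambda>x. \<Sum>w\<in>weyl_group R. f (w x))"
    by (simp add: orbit_sum_def fun_eq_iff)
  have diff1: "(\<lambda>x. f (w x)) differentiable (at x)" if "w \<in> weyl_group R" for w x
    using differentiable_comp_linear[OF lin[OF that]] C2D[OF assms(1)] by blast
  have diff2: "(\<lambda>x. dir_deriv v f (w x)) differentiable (at x)" if "w \<in> weyl_group R" for v w x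
    using differentiable_comp_linear[OF lin[OF that]] C2D[OF assms(1)] by blast
  have d1: "dir_deriv v (orbit_sum R f) = (\<lambda>x. \<Sum>w\<in>weyl_group R. dir_deriv (w v) f (w x))" for v
    unfolding S
    by (rule ext, subst dir_deriv_sum)
      (auto intro!: sum.cong diff1 dir_deriv_comp_linear lin C2D[OF assms(1)])
  then show "dir_deriv v (orbit_sum R f) x = (\<Sum>w\<in>weyl_group R. dir_deriv (w v) f (w x))"
    by simp
  have d2: "dir_deriv u (dir_deriv v (orbit_sum R f))
      = (\<lambda>x. \<Sum>w\<in>weyl_group R. dir_deriv (w u) (dir_deriv (w v) f) (w x))" for u v
    unfolding d1
    by (rule ext, subst dir_deriv_sum)
      (auto intro!: sum.cong diff2 dir_deriv_comp_linear lin C2D[OF assms(1)])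
  then show "dir_deriv u (dir_deriv v (orbit_sum R f)) x
      = (\<Sum>w\<in>weyl_group R. dir_deriv (w u) (dir_deriv (w v) f) (w x))"
    by simp
  have "orbit_sum R f differentiable (at x)" for x
    unfolding S using assms(2) by (intro differentiable_sum ballI diff1)
  moreover have "dir_deriv v (orbit_sum R f) differentiable (at x)" for v x
    unfolding d1 using assms(2) by (intro differentiable_sum ballI diff2)
  moreover have "continuous_on UNIV (dir_deriv u (dir_deriv v (orbit_sum R f)))" for u v
    unfolding d2
    by (intro continuous_on_sum continuous_on_compose2[OF C2D(3)[OF assms(1)]]
        linear_continuous_on linear_conv_bounded_linear[THEN iffD1] lin) auto
  ultimately show "C2 (orbit_sum R f)"
    by (simp add: C2_def)
qed

lemma laplacian_orbit_sum:
  assumes "C2 f" and "finite (weyl_group R)"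
  shows "laplacian (orbit_sum R f) x = (\<Sum>w\<in>weyl_group R. laplacian f (w x))"
proof -
  have "laplacian (orbit_sum R f) x
      = (\<Sum>w\<in>weyl_group R. \<Sum>b\<in>Basis. dir_deriv (w b) (dir_deriv (w b) f) (w x))"
    unfolding laplacian_def orbit_sum_derivs(2)[OF assms] by (rule sum.swap)
  then show ?thesis
    using laplacian_orthogonal_frame[OF assms(1)] orthogonal_transformation_weyl_group
    by (metis (no_types, lifting) sum.cong)
qed

text \<open>Summation over an orbit removes the reflection terms, since the term of \<open>\<alpha>\<close> at \<open>w x\<close>
  cancels against that at \<open>r\<^sub>\<alpha> w x\<close>. The drift is equivariant; this is visible on the sum over
  all roots, which is twice the sum over the positive ones.\<close>

lemma sum_HO_formula_orbit:
  assumes root: "integral_root_system R" and pos: "positive_roots R Rp"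
    and mult: "multiplicity_function R k" and "C2 f"
  shows "(\<Sum>w\<in>weyl_group R. HO_formula Rp k f (w x)) = radial_formula Rp k (orbit_sum R f) x"
proof -
  let ?W = "weyl_group R"
  define c where "c \<alpha> y = k \<alpha> * ((norm \<alpha>)\<^sup>2 / (4 * (sinh ((\<alpha> \<bullet> y) / 2))\<^sup>2))" for \<alpha> y
  define d where "d \<alpha> y = k \<alpha> * coth ((\<alpha> \<bullet> y) / 2) * dir_deriv \<alpha> f y" for \<alpha> y
  have fin: "finite ?W"
    using root by (rule finite_weyl_group)
  have sub: "Rp \<subseteq> R"
    using pos by (rule positive_roots_subset)
  have nz: "\<alpha> \<noteq> 0" if "\<alpha> \<in> R" for \<alpha>
    using root that by (auto simp: integral_root_system_def)
  have lin: "dir_deriv (- \<alpha>) g y = - dir_deriv \<alpha> g y" if "C2 g" for g \<alpha> and y :: 'a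
    using dir_deriv_minus[OF C2D(1)[OF that]] .
  have cancel: "(\<Sum>w\<in>?W. c \<alpha> (w x) * (f (w x) - f (root_reflection \<alpha> (w x)))) = 0"
    if "\<alpha> \<in> Rp" for \<alpha>
  proof -
    have "\<alpha> \<in> R" using that sub by blast
    then have "c \<alpha> (root_reflection \<alpha> y) = c \<alpha> y" for y
      using nz by (simp add: c_def inner_root_reflection_self)
    then have "(\<Sum>w\<in>?W. c \<alpha> (w x) * f (root_reflection \<alpha> (w x))) = (\<Sum>w\<in>?W. c \<alpha> (w x) * f (w x))"
      using sum.reindex_bij_betw[OF bij_betw_weyl_group_reflection_left[OF \<open>\<alpha> \<in> R\<close>],
          of "\<lambda>w. c \<alpha> (w x) * f (w x)"]
      by (simp add: root_reflection_involution)
    then show ?thesis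
      by (simp add: right_diff_distrib sum_subtractf)
  qed
  have drift: "(\<Sum>w\<in>?W. \<Sum>\<alpha>\<in>Rp. d \<alpha> (w x))
      = (\<Sum>\<alpha>\<in>Rp. k \<alpha> * coth ((\<alpha> \<bullet> x) / 2) * dir_deriv \<alpha> (orbit_sum R f) x)"
  proof -
    have "2 * (\<Sum>w\<in>?W. \<Sum>\<alpha>\<in>Rp. d \<alpha> (w x)) = (\<Sum>w\<in>?W. \<Sum>\<alpha>\<in>R. d \<alpha> (w x))"
      unfolding sum_distrib_left
    proof (rule sum.cong[OF refl])
      fix w
      show "(\<Sum>\<alpha>\<in>Rp. 2 * d \<alpha> (w x)) = (\<Sum>\<alpha>\<in>R. d \<alpha> (w x))"
        by (subst sum_roots_eq_twice_sum_positive_roots[OF root pos])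
          (auto simp: d_def sum_distrib_left multiplicity_uminus[OF root mult] lin[OF \<open>C2 f\<close>]
            coth_minus)
    qed
    also have "\<dots> = (\<Sum>w\<in>?W. \<Sum>\<beta>\<in>R. k \<beta> * coth ((\<beta> \<bullet> x) / 2) * dir_deriv (w \<beta>) f (w x))"
    proof (rule sum.cong[OF refl])
      fix w assume w: "w \<in> ?W"
      have "inj_on w R"
        using bij_weyl_group[OF w] by (meson bij_def inj_on_subset top_greatest)
      have "(\<Sum>\<alpha>\<in>R. d \<alpha> (w x)) = (\<Sum>\<alpha>\<in>w ` R. d \<alpha> (w x))"
        using weyl_group_image_roots[OF root w] by simp
      also have "\<dots> = (\<Sum>\<beta>\<in>R. d (w \<beta>) (w x))"
        by (simp add: sum.reindex[OF \<open>inj_on w R\<close>])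
      also have "\<dots> = (\<Sum>\<beta>\<in>R. k \<beta> * coth ((\<beta> \<bullet> x) / 2) * dir_deriv (w \<beta>) f (w x))"
        using mult w by (simp add: d_def inner_weyl_group[OF w] multiplicity_function_def)
      finally show "(\<Sum>\<alpha>\<in>R. d \<alpha> (w x))
        = (\<Sum>\<beta>\<in>R. k \<beta> * coth ((\<beta> \<bullet> x) / 2) * dir_deriv (w \<beta>) f (w x))" .
    qed
    also have "\<dots> = (\<Sum>\<beta>\<in>R. k \<beta> * coth ((\<beta> \<bullet> x) / 2) * dir_deriv \<beta> (orbit_sum R f) x)"
      by (subst sum.swap) (simp add: orbit_sum_derivs(1)[OF \<open>C2 f\<close> fin] sum_distrib_left)
    also have "\<dots> = 2 * (\<Sum>\<alpha>\<in>Rp. k \<alpha> * coth ((\<alpha> \<bullet> x) / 2) * dir_deriv \<alpha> (orbit_sum R f) x)"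
      by (rule sum_roots_eq_twice_sum_positive_roots[OF root pos])
        (simp add: multiplicity_uminus[OF root mult] lin[OF orbit_sum_derivs(3)[OF \<open>C2 f\<close> fin]]
          coth_minus)
    finally show ?thesis by simp
  qed
  have "(\<Sum>w\<in>?W. HO_formula Rp k f (w x))
      = (\<Sum>w\<in>?W. laplacian f (w x)) + (\<Sum>w\<in>?W. \<Sum>\<alpha>\<in>Rp. d \<alpha> (w x))
        - (\<Sum>w\<in>?W. \<Sum>\<alpha>\<in>Rp. c \<alpha> (w x) * (f (w x) - f (root_reflection \<alpha> (w x))))"
    by (simp add: HO_formula_def c_def d_def sum.distrib sum_subtractf)
  also have "(\<Sum>w\<in>?W. \<Sum>\<alpha>\<in>Rp. c \<alpha> (w x) * (f (w x) - f (root_reflection \<alpha> (w x)))) = 0"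
    by (subst sum.swap) (simp add: cancel)
  finally show ?thesis
    by (simp add: radial_formula_def drift laplacian_orbit_sum[OF \<open>C2 f\<close> fin])
qed

section \<open>Hyperbolic functions\<close>

lemma tendsto_times_coth: "((\<lambda>u. u * coth u) \<longlongrightarrow> 1) (at 0)"
proof -
  have "((\<lambda>u::real. sinh u / u) \<longlongrightarrow> 1) (at 0)"
    using has_field_derivative_sinh[OF DERIV_ident, of 0 UNIV] by (simp add: has_field_derivative_iff)
  moreover have "(cosh \<longlongrightarrow> (1::real)) (at 0)"
    using tendsto_cosh[OF tendsto_ident_at, of 0 UNIV] by simp
  ultimately have "((\<lambda>u::real. cosh u / (sinh u / u)) \<longlongrightarrow> 1 / 1) (at 0)"
    by (intro tendsto_divide) auto
  then show ?thesis
    by (simp add: coth_def mult.commute)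
qed

lemma coth_diff_times_diff_nonpos:
  assumes "0 < a * b"
  shows "(coth a - coth b) * (a - b) \<le> 0"
proof -
  have ab: "0 < sinh a * sinh b"
    using assms by (auto simp: zero_less_mult_iff)
  then have "sinh a \<noteq> 0" "sinh b \<noteq> 0" by auto
  then have "coth a - coth b = - (sinh (a - b) / (sinh a * sinh b))"
    by (simp add: coth_def sinh_diff field_simps)
  moreover have "0 \<le> sinh (a - b) * (a - b)"
    by (auto simp: zero_le_mult_iff)
  then have "0 \<le> sinh (a - b) * (a - b) / (sinh a * sinh b)"
    using ab by simp
  ultimately show ?thesis by simp
qed

lemma tendsto_coth: "(f \<longlongrightarrow> a) F \<Longrightarrow> a \<noteq> 0 \<Longrightarrow> ((\<lambda>s. coth (f s)) \<longlongrightarrow> coth a) F"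
  unfolding coth_def by (intro tendsto_intros) auto

section \<open>Invariant functions near a wall\<close>

text \<open>An invariant function is even across each wall, so that its normal derivative vanishes
  there, the normal is an eigenvector of its Hessian, and the singular drift has a finite limit.\<close>

context
  fixes S :: "'a::euclidean_space \<Rightarrow> real" and \<alpha> :: 'a
  assumes C2: "C2 S" and inv: "\<And>x. S (root_reflection \<alpha> x) = S x" and nz: "\<alpha> \<noteq> 0"
begin

lemma normal_derivative_on_wall:
  assumes "\<alpha> \<bullet> q = 0"
  shows "dir_deriv \<alpha> S q = 0"
proof -
  have q: "root_reflection \<alpha> q = q"
    using assms by (simp add: root_reflection_eq)
  have "dir_deriv \<alpha> (\<lambda>x. S (root_reflection \<alpha> x)) q
      = dir_deriv (root_reflection \<alpha> \<alpha>) S (root_reflection \<alpha> q)"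
    by (rule dir_deriv_comp_linear[OF linear_root_reflection C2D(1)[OF C2]])
  then have "dir_deriv \<alpha> S q = dir_deriv (- \<alpha>) S q"
    by (simp add: inv q root_reflection_self[OF nz])
  then show ?thesis
    using dir_deriv_minus[OF C2D(1)[OF C2]] by simp
qed

lemma derivative_of_normal_derivative_on_wall:
  assumes wall: "\<alpha> \<bullet> p = 0"
  shows "dir_deriv z (dir_deriv \<alpha> S) p
    = (\<alpha> \<bullet> z) / (norm \<alpha>)\<^sup>2 * dir_deriv \<alpha> (dir_deriv \<alpha> S) p"
proof -
  define c where "c = (\<alpha> \<bullet> z) / (norm \<alpha>)\<^sup>2"
  define q where "q = z - c *\<^sub>R \<alpha>"
  have "\<alpha> \<bullet> q = 0"
    using nz by (simp add: q_def c_def inner_diff_right power2_norm_eq_inner)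
  then have "dir_deriv \<alpha> S (p + s *\<^sub>R q) = 0" for s
    by (simp add: normal_derivative_on_wall inner_add_right wall)
  then have "((\<lambda>s::real. 0) has_real_derivative dir_deriv q (dir_deriv \<alpha> S) p) (at 0)"
    using has_real_derivative_along_line[of "dir_deriv \<alpha> S" p 0 q] C2D(2)[OF C2] by simp
  then have "dir_deriv q (dir_deriv \<alpha> S) p = 0"
    using DERIV_unique DERIV_const by metis
  moreover have "z = c *\<^sub>R \<alpha> + q"
    by (simp add: q_def)
  ultimately show ?thesis
    unfolding c_def[symmetric]
    by (simp add: linear_add[OF linear_dir_deriv[OF C2D(2)[OF C2]]]
        linear_cmul[OF linear_dir_deriv[OF C2D(2)[OF C2]]])
qed

lemma tendsto_singular_drift:
  assumes wall: "\<alpha> \<bullet> p = 0" and z: "\<alpha> \<bullet> z \<noteq> 0"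
  shows "((\<lambda>s. coth ((\<alpha> \<bullet> (p + s *\<^sub>R z)) / 2) * dir_deriv \<alpha> S (p + s *\<^sub>R z))
    \<longlongrightarrow> 2 / (norm \<alpha>)\<^sup>2 * dir_deriv \<alpha> (dir_deriv \<alpha> S) p) (at_right 0)"
proof -
  define c where "c = (\<alpha> \<bullet> z) / 2"
  have "c \<noteq> 0" using z by (simp add: c_def)
  have "((\<lambda>s. dir_deriv \<alpha> S (p + s *\<^sub>R z)) has_real_derivative dir_deriv z (dir_deriv \<alpha> S) p) (at 0)"
    using has_real_derivative_along_line[of "dir_deriv \<alpha> S" p 0 z] C2D(2)[OF C2] by simp
  then have "((\<lambda>s. dir_deriv \<alpha> S (p + s *\<^sub>R z) / s) \<longlongrightarrow> dir_deriv z (dir_deriv \<alpha> S) p) (at 0)"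
    by (simp add: has_field_derivative_iff normal_derivative_on_wall[OF wall])
  moreover have "((\<lambda>s. s * c * coth (s * c)) \<longlongrightarrow> 1) (at 0)"
  proof -
    have "filterlim (\<lambda>s. s * c) (at 0) (at 0)"
      using \<open>c \<noteq> 0\<close> by (intro filterlim_atI tendsto_eq_intros eventually_at_filter[THEN iffD2]) auto
    from filterlim_compose[OF tendsto_times_coth this] show ?thesis by simp
  qed
  ultimately have "((\<lambda>s. s * c * coth (s * c) / c * (dir_deriv \<alpha> S (p + s *\<^sub>R z) / s))
      \<longlongrightarrow> 1 / c * dir_deriv z (dir_deriv \<alpha> S) p) (at 0)"
    using \<open>c \<noteq> 0\<close> by (intro tendsto_intros) auto
  moreover have "1 / c * dir_deriv z (dir_deriv \<alpha> S) p
      = 2 / (norm \<alpha>)\<^sup>2 * dir_deriv \<alpha> (dir_deriv \<alpha> S) p"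
    using z by (simp add: c_def derivative_of_normal_derivative_on_wall[OF wall, of z])
  moreover have "\<forall>\<^sub>F s in at 0. s * c * coth (s * c) / c * (dir_deriv \<alpha> S (p + s *\<^sub>R z) / s)
      = coth ((\<alpha> \<bullet> (p + s *\<^sub>R z)) / 2) * dir_deriv \<alpha> S (p + s *\<^sub>R z)"
    using \<open>c \<noteq> 0\<close> by (auto simp: eventually_at_filter inner_add_right wall c_def)
  ultimately show ?thesis
    using Lim_transform_eventually filterlim_mono[OF _ order_refl at_le] by fastforce
qed

end

section \<open>The reflection coupling estimate\<close>

lemma second_derivative_at_local_max:
  fixes f :: "real \<Rightarrow> real"
  assumes "0 < d" and max: "\<And>s. \<bar>s\<bar> < d \<Longrightarrow> f s \<le> f 0"
    and f': "\<And>s. (f has_real_derivative f' s) (at s)"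
    and f'': "(f' has_real_derivative D) (at 0)"
  shows "f' 0 = 0" and "D \<le> 0"
proof -
  show 0: "f' 0 = 0"
    using DERIV_local_max[OF f' \<open>0 < d\<close>] max by simp
  show "D \<le> 0"
  proof (rule ccontr)
    assume "\<not> D \<le> 0"
    then obtain c where c: "c > 0" "\<And>h. h > 0 \<Longrightarrow> h < c \<Longrightarrow> f' 0 < f' h"
      using DERIV_pos_inc_right[OF f''] by auto
    define h where "h = min c d / 2"
    have h: "0 < h" "h < c" "h < d"
      using c(1) \<open>0 < d\<close> by (auto simp: h_def)
    obtain z where "0 < z" "z < h" "f h - f 0 = (h - 0) * f' z"
      using MVT2[OF h(1)] f' by blast
    moreover have "f' z > 0"
      using c(2)[of z] 0 calculation h by simp
    ultimately have "f h > f 0"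
      using h by (simp add: algebra_simps)
    then show False
      using max[of h] h by simp
  qed
qed

text \<open>Where the penalised difference is positive, one of the two points lies in the support of
  \<open>S\<close>, and the coercive penalty keeps the other one at bounded distance.\<close>

lemma penalised_difference_attains_max:
  fixes S :: "'a::euclidean_space \<Rightarrow> real" and om :: "real \<Rightarrow> real"
  assumes contS: "continuous_on UNIV S" and K: "compact K" "\<And>x. x \<notin> K \<Longrightarrow> S x = 0"
    and contom: "continuous_on UNIV om" and "0 < \<epsilon>" and om: "\<And>r. 0 \<le> r \<Longrightarrow> \<epsilon> * r \<le> om r"
    and pos: "om (norm (x1 - y1)) < S x1 - S y1"
  obtains x0 y0 where
    "\<And>x y. S x - S y - om (norm (x - y)) \<le> S x0 - S y0 - om (norm (x0 - y0))"
    "om (norm (x0 - y0)) < S x0 - S y0"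
proof -
  define \<Phi> where "\<Phi> z = S (fst z) - S (snd z) - om (norm (fst z - snd z))" for z :: "'a \<times> 'a"
  define F where "F = {z. \<Phi> (x1, y1) \<le> \<Phi> z}"
  have cont: "continuous_on A \<Phi>" for A
    unfolding \<Phi>_def
    by (intro continuous_intros continuous_on_compose2[OF contS] continuous_on_compose2[OF contom])
      auto
  have pos': "0 < \<Phi> (x1, y1)"
    using pos by (simp add: \<Phi>_def)
  have "bounded (S ` K)"
    using compact_continuous_image[OF continuous_on_subset[OF contS] K(1)] compact_imp_bounded
    by blast
  then obtain B where B: "\<And>x. x \<in> K \<Longrightarrow> \<bar>S x\<bar> \<le> B" "0 \<le> B"
    using bounded_pos by (metis image_eqI less_imp_le real_norm_def)
  then have B': "\<bar>S x\<bar> \<le> B" for x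
    using K(2)[of x] by (cases "x \<in> K") auto
  obtain b where b: "\<And>x. x \<in> K \<Longrightarrow> norm x \<le> b"
    using compact_imp_bounded[OF K(1)] bounded_iff by blast
  define \<rho> where "\<rho> = b + 2 * B / \<epsilon>"
  have "F \<subseteq> cball 0 \<rho> \<times> cball 0 \<rho>"
  proof
    fix z assume "z \<in> F"
    obtain x y where z: "z = (x, y)" by (cases z)
    have "0 < \<Phi> z"
      using \<open>z \<in> F\<close> pos' by (auto simp: F_def)
    then have p: "om (norm (x - y)) < S x - S y"
      by (simp add: \<Phi>_def z)
    then have "\<epsilon> * norm (x - y) < S x - S y"
      using om[of "norm (x - y)"] by simp
    moreover have "S x - S y \<le> 2 * B"
      using B'[of x] B'[of y] by linarith
    ultimately have d: "norm (x - y) \<le> 2 * B / \<epsilon>"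
      using \<open>0 < \<epsilon>\<close> by (simp add: pos_le_divide_eq mult.commute)
    have "0 \<le> \<epsilon> * norm (x - y)"
      using \<open>0 < \<epsilon>\<close> by simp
    then have "S x \<noteq> 0 \<or> S y \<noteq> 0"
      using p om[of "norm (x - y)"] by auto
    then have "x \<in> K \<or> y \<in> K"
      using K(2) by blast
    moreover have "norm x \<le> norm y + norm (x - y)" "norm y \<le> norm x + norm (x - y)"
      by norm+
    moreover have "0 \<le> 2 * B / \<epsilon>"
      using B(2) \<open>0 < \<epsilon>\<close> by simp
    ultimately have "norm x \<le> \<rho>" "norm y \<le> \<rho>"
      using b[of x] b[of y] d by (auto simp: \<rho>_def)
    then show "z \<in> cball 0 \<rho> \<times> cball 0 \<rho>"
      by (simp add: z)
  qed
  then have "bounded F"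
    by (rule bounded_subset[OF bounded_Times[OF bounded_cball bounded_cball]])
  moreover have "closed F"
    unfolding F_def by (intro closed_Collect_le cont continuous_on_const)
  ultimately have "compact F"
    by (simp add: compact_eq_bounded_closed)
  moreover have "F \<noteq> {}"
    by (auto simp: F_def)
  ultimately have "\<exists>z0\<in>F. \<forall>z\<in>F. \<Phi> z \<le> \<Phi> z0"
    by (rule continuous_attains_sup[OF _ _ cont])
  then obtain z0 where z0: "z0 \<in> F" "\<forall>z\<in>F. \<Phi> z \<le> \<Phi> z0" ..
  have max: "\<Phi> z \<le> \<Phi> z0" for z
  proof (cases "z \<in> F")
    case True
    then show ?thesis using z0(2) by blast
  next
    case False
    then have "\<Phi> z < \<Phi> (x1, y1)" by (simp add: F_def)
    moreover have "\<Phi> (x1, y1) \<le> \<Phi> z0" using z0(1) by (simp add: F_def)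
    ultimately show ?thesis by linarith
  qed
  have "0 < \<Phi> z0"
    using z0(1) pos' by (auto simp: F_def)
  then show thesis
    using that[of "fst z0" "snd z0"] max[of "(_, _)"] by (simp add: \<Phi>_def)
qed

text \<open>At a maximum of the penalised difference, \<open>S\<close> has the same gradient at both points, and the
  second order conditions are those of the processes moving in parallel directions orthogonal
  to \<open>x0 - y0\<close> and in opposite directions along it.\<close>

locale penalised_maximum =
  fixes S :: "'a::euclidean_space \<Rightarrow> real" and om om' om'' :: "real \<Rightarrow> real" and x0 y0 :: 'a
  assumes C2: "C2 S"
    and om': "\<And>s. (om has_real_derivative om' s) (at s)"
    and om'': "\<And>s. (om' has_real_derivative om'' s) (at s)"
    and max: "\<And>x y. S x - S y - om (norm (x - y)) \<le> S x0 - S y0 - om (norm (x0 - y0))"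
    and distinct: "x0 \<noteq> y0"
begin

definition "r = norm (x0 - y0)"
definition "e = (x0 - y0) /\<^sub>R r"

lemma r_pos: "0 < r"
  using distinct by (simp add: r_def)

lemma diff_eq: "x0 - y0 = r *\<^sub>R e"
  using r_pos by (simp add: e_def)

lemma norm_e: "norm e = 1"
  using r_pos by (simp add: e_def r_def)

lemma has_derivative_penalty:
  "((\<lambda>s. om (norm (x0 - y0 + s *\<^sub>R v))) has_real_derivative om' r * (e \<bullet> v)) (at 0)"
proof -
  have "(norm has_derivative (\<lambda>h. h \<bullet> sgn (x0 - y0))) (at (x0 - y0 + 0 *\<^sub>R v))"
    using has_derivative_norm[of "x0 - y0"] distinct by simp
  then have "((\<lambda>s. norm (x0 - y0 + s *\<^sub>R v)) has_derivative
      (\<lambda>s. (s *\<^sub>R v) \<bullet> sgn (x0 - y0))) (at 0)"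
    by (rule has_derivative_compose[of "\<lambda>s. x0 - y0 + s *\<^sub>R v" "\<lambda>s. s *\<^sub>R v" 0 UNIV norm, rotated])
      (auto intro!: derivative_eq_intros)
  moreover have "(\<lambda>s. (s *\<^sub>R v) \<bullet> sgn (x0 - y0)) = (*) (e \<bullet> v)"
    by (simp add: fun_eq_iff sgn_div_norm e_def r_def inner_commute)
  ultimately have "((\<lambda>s. norm (x0 - y0 + s *\<^sub>R v)) has_real_derivative e \<bullet> v) (at 0)"
    by (simp add: has_field_derivative_def)
  then show ?thesis
    using DERIV_chain2[of om "om' r" "\<lambda>s. norm (x0 - y0 + s *\<^sub>R v)" 0 "e \<bullet> v" UNIV] om'[of r]
    by (simp add: r_def)
qed

lemma gradient_left: "dir_deriv v S x0 = om' r * (e \<bullet> v)"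
proof -
  have "((\<lambda>s. S (x0 + s *\<^sub>R v) - S y0 - om (norm (x0 - y0 + s *\<^sub>R v)))
      has_real_derivative dir_deriv v S x0 - 0 - om' r * (e \<bullet> v)) (at 0)"
    using has_real_derivative_along_line[of S x0 0 v] C2D(1)[OF C2]
    by (intro DERIV_diff DERIV_const has_derivative_penalty) simp
  then have "dir_deriv v S x0 - 0 - om' r * (e \<bullet> v) = 0"
  proof (rule DERIV_local_max[OF _ zero_less_one], intro allI impI)
    fix s
    have "S (x0 + s *\<^sub>R v) - S y0 - om (norm ((x0 + s *\<^sub>R v) - y0))
        \<le> S x0 - S y0 - om (norm (x0 - y0))" by (rule max)
    moreover have "(x0 + s *\<^sub>R v) - y0 = x0 - y0 + s *\<^sub>R v" by simp
    ultimately show "S (x0 + s *\<^sub>R v) - S y0 - om (norm (x0 - y0 + s *\<^sub>R v))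
        \<le> S (x0 + 0 *\<^sub>R v) - S y0 - om (norm (x0 - y0 + 0 *\<^sub>R v))" by simp
  qed
  then show ?thesis by simp
qed

lemma gradient_right: "dir_deriv v S y0 = om' r * (e \<bullet> v)"
proof -
  have "((\<lambda>s. S x0 - S (y0 + s *\<^sub>R v) - om (norm (x0 - y0 + s *\<^sub>R (- v))))
      has_real_derivative 0 - dir_deriv v S y0 - om' r * (e \<bullet> (- v))) (at 0)"
    using has_real_derivative_along_line[of S y0 0 v] C2D(1)[OF C2]
    by (intro DERIV_diff DERIV_const has_derivative_penalty) simp
  then have "0 - dir_deriv v S y0 - om' r * (e \<bullet> (- v)) = 0"
  proof (rule DERIV_local_max[OF _ zero_less_one], intro allI impI)
    fix s
    have "S x0 - S (y0 + s *\<^sub>R v) - om (norm (x0 - (y0 + s *\<^sub>R v)))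
        \<le> S x0 - S y0 - om (norm (x0 - y0))" by (rule max)
    moreover have "x0 - (y0 + s *\<^sub>R v) = x0 - y0 + s *\<^sub>R (- v)" by simp
    ultimately show "S x0 - S (y0 + s *\<^sub>R v) - om (norm (x0 - y0 + s *\<^sub>R (- v)))
        \<le> S x0 - S (y0 + 0 *\<^sub>R v) - om (norm (x0 - y0 + 0 *\<^sub>R (- v)))" by simp
  qed
  then show ?thesis by simp
qed

lemma hessian:
  assumes uv: "u - v = c *\<^sub>R e"
  shows "dir_deriv u (dir_deriv u S) x0 - dir_deriv v (dir_deriv v S) y0 \<le> om'' r * c\<^sup>2"
proof -
  define f where "f s = S (x0 + s *\<^sub>R u) - S (y0 + s *\<^sub>R v) - om (r + s * c)" for s
  define f' where "f' s = dir_deriv u S (x0 + s *\<^sub>R u) - dir_deriv v S (y0 + s *\<^sub>R v)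
      - om' (r + s * c) * c" for s
  define D where "D = dir_deriv u (dir_deriv u S) x0 - dir_deriv v (dir_deriv v S) y0
      - om'' r * c * c"
  have lin: "((\<lambda>s. r + s * c) has_real_derivative c) (at s)" for s
    by (auto intro!: derivative_eq_intros)
  have f': "(f has_real_derivative f' s) (at s)" for s
    unfolding f_def f'_def
    by (intro DERIV_diff has_real_derivative_along_line C2D[OF C2] DERIV_chain2[OF om' lin])
  have "((\<lambda>s. om' (r + s * c) * c) has_real_derivative om'' r * c * c) (at 0)"
    using DERIV_chain2[OF om''[of "r + 0 * c"] lin] by (intro DERIV_cmult_right) simp
  then have f'': "(f' has_real_derivative D) (at 0)"
    unfolding f'_def D_def
    using has_real_derivative_along_line[of "dir_deriv u S" x0 0 u]
      has_real_derivative_along_line[of "dir_deriv v S" y0 0 v] C2D(2)[OF C2]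
    by (intro DERIV_diff) simp_all
  define d where "d = r / (\<bar>c\<bar> + 1)"
  have "0 < d"
    using r_pos by (simp add: d_def)
  have "f s \<le> f 0" if "\<bar>s\<bar> < d" for s
  proof -
    have "\<bar>s * c\<bar> \<le> \<bar>s\<bar> * (\<bar>c\<bar> + 1)"
      by (simp add: abs_mult algebra_simps)
    also have "\<dots> < r"
      using that by (simp add: d_def pos_less_divide_eq)
    finally have "0 \<le> r + s * c" by linarith
    have "(x0 + s *\<^sub>R u) - (y0 + s *\<^sub>R v) = (x0 - y0) + s *\<^sub>R (u - v)"
      by (simp add: algebra_simps)
    also have "\<dots> = (r + s * c) *\<^sub>R e"
      unfolding uv diff_eq by (simp add: algebra_simps)
    finally have "norm ((x0 + s *\<^sub>R u) - (y0 + s *\<^sub>R v)) = r + s * c"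
      using \<open>0 \<le> r + s * c\<close> norm_e by simp
    then show ?thesis
      using max[of "x0 + s *\<^sub>R u" "y0 + s *\<^sub>R v"] by (simp add: f_def r_def)
  qed
  then have "D \<le> 0"
    by (rule second_derivative_at_local_max(2)[OF \<open>0 < d\<close> _ f' f''])
  then show ?thesis
    by (simp add: D_def power2_eq_square mult.assoc)
qed

text \<open>Reflecting the second frame along \<open>e\<close> makes the trace of the second order conditions as
  strong as possible.\<close>

lemma laplacian_diff: "laplacian S x0 - laplacian S y0 \<le> 4 * om'' r"
proof -
  let ?Q = "root_reflection e"
  have Q: "b - ?Q b = (2 * (e \<bullet> b)) *\<^sub>R e" for b
    by (simp add: root_reflection_eq norm_e)
  have "laplacian S x0 - laplacian S y0
      = (\<Sum>b\<in>Basis. dir_deriv b (dir_deriv b S) x0 - dir_deriv (?Q b) (dir_deriv (?Q b) S) y0)"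
    using laplacian_orthogonal_frame[OF C2 orthogonal_transformation_root_reflection, of e y0]
    by (simp add: sum_subtractf laplacian_def)
  also have "\<dots> \<le> (\<Sum>b\<in>Basis. om'' r * (2 * (e \<bullet> b))\<^sup>2)"
    by (intro sum_mono hessian Q)
  also have "\<dots> = 4 * om'' r * (\<Sum>b\<in>Basis. (e \<bullet> b) * (e \<bullet> b))"
    by (simp add: sum_distrib_left power2_eq_square algebra_simps)
  also have "(\<Sum>b\<in>Basis. (e \<bullet> b) * (e \<bullet> b)) = 1"
    using norm_e by (simp add: euclidean_inner[symmetric] norm_eq_1)
  finally show ?thesis by simp
qed

end

text \<open>At a maximum the two points lie strictly on the same side of the wall of \<open>\<alpha>\<close> or both on it. In
  the first case the sign comes from the monotonicity of \<open>coth\<close>, in the second from the second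
  order condition for moving both points in the direction \<open>\<alpha>\<close>.\<close>

lemma (in penalised_maximum) drift_contribution:
  assumes inv: "\<And>x. S (root_reflection \<alpha> x) = S x" and "\<alpha> \<noteq> 0" and z: "\<alpha> \<bullet> z \<noteq> 0"
    and mono: "\<And>s t. 0 \<le> s \<Longrightarrow> s < t \<Longrightarrow> om s < om t" and "0 < om' r"
  obtains l where "l \<le> 0"
    "((\<lambda>s. coth ((\<alpha> \<bullet> (x0 + s *\<^sub>R z)) / 2) * dir_deriv \<alpha> S (x0 + s *\<^sub>R z)
         - coth ((\<alpha> \<bullet> (y0 + s *\<^sub>R z)) / 2) * dir_deriv \<alpha> S (y0 + s *\<^sub>R z)) \<longlongrightarrow> l) (at_right 0)"
proof -
  let ?a = "\<alpha> \<bullet> x0" and ?b = "\<alpha> \<bullet> y0"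
  have ab: "?a - ?b = r * (e \<bullet> \<alpha>)"
    using arg_cong[OF diff_eq, of "\<lambda>v. \<alpha> \<bullet> v"] by (simp add: inner_diff_right inner_commute)
  \<comment> \<open>Otherwise reflecting \<open>y0\<close> would bring the points closer at no cost.\<close>
  have same_side: "0 \<le> ?a * ?b"
  proof (rule ccontr)
    assume "\<not> 0 \<le> ?a * ?b"
    then have "4 * ?a * ?b / (norm \<alpha>)\<^sup>2 < 0"
      using \<open>\<alpha> \<noteq> 0\<close> by (simp add: divide_neg_pos)
    then have "(norm (x0 - root_reflection \<alpha> y0))\<^sup>2 < (norm (x0 - y0))\<^sup>2"
      using norm_diff_root_reflection[OF \<open>\<alpha> \<noteq> 0\<close>, of x0 y0] by simp
    then have "om (norm (x0 - root_reflection \<alpha> y0)) < om (norm (x0 - y0))"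
      by (intro mono) (auto intro: power_less_imp_less_base)
    then show False
      using max[of x0 "root_reflection \<alpha> y0"] inv[of y0] by simp
  qed
  \<comment> \<open>At both points the gradient is a positive multiple of \<open>e\<close>, and on the wall it is tangent.\<close>
  have wall: "?a = 0 \<longleftrightarrow> ?b = 0"
  proof -
    have "?a = 0 \<or> ?b = 0 \<Longrightarrow> e \<bullet> \<alpha> = 0"
      using normal_derivative_on_wall[OF C2 inv \<open>\<alpha> \<noteq> 0\<close>, of x0]
        normal_derivative_on_wall[OF C2 inv \<open>\<alpha> \<noteq> 0\<close>, of y0]
        gradient_left[of \<alpha>] gradient_right[of \<alpha>] \<open>0 < om' r\<close> by auto
    then show ?thesis using ab by auto
  qed
  show thesis
  proof (cases "?a = 0")
    case True
    then have b0: "?b = 0" using wall by simp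
    show thesis
    proof (rule that[OF _ tendsto_diff[OF tendsto_singular_drift[OF C2 inv \<open>\<alpha> \<noteq> 0\<close> True z]
            tendsto_singular_drift[OF C2 inv \<open>\<alpha> \<noteq> 0\<close> b0 z]]])
      have "dir_deriv \<alpha> (dir_deriv \<alpha> S) x0 - dir_deriv \<alpha> (dir_deriv \<alpha> S) y0 \<le> 0"
        using hessian[of \<alpha> \<alpha> 0] by simp
      then show "2 / (norm \<alpha>)\<^sup>2 * dir_deriv \<alpha> (dir_deriv \<alpha> S) x0
          - 2 / (norm \<alpha>)\<^sup>2 * dir_deriv \<alpha> (dir_deriv \<alpha> S) y0 \<le> 0"
        by (simp add: divide_right_mono)
    qed
  next
    case False
    then have "0 < ?a * ?b"
      using same_side wall by (auto simp: less_le)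
    have lim: "((\<lambda>s. coth ((\<alpha> \<bullet> (p + s *\<^sub>R z)) / 2) * dir_deriv \<alpha> S (p + s *\<^sub>R z))
        \<longlongrightarrow> coth ((\<alpha> \<bullet> p) / 2) * dir_deriv \<alpha> S p) (at_right 0)" if "\<alpha> \<bullet> p \<noteq> 0" for p
    proof (intro tendsto_mult tendsto_coth)
      have "((\<lambda>s. p + s *\<^sub>R z) \<longlongrightarrow> p + 0 *\<^sub>R z) (at_right 0)"
        by (intro tendsto_intros)
      then have *: "((\<lambda>s. p + s *\<^sub>R z) \<longlongrightarrow> p) (at_right 0)" by simp
      then show "((\<lambda>s. (\<alpha> \<bullet> (p + s *\<^sub>R z)) / 2) \<longlongrightarrow> (\<alpha> \<bullet> p) / 2) (at_right 0)"
        by (intro tendsto_intros) auto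
      have "isCont (dir_deriv \<alpha> S) p"
        using C2D(2)[OF C2] differentiable_imp_continuous_within by blast
      then show "((\<lambda>s. dir_deriv \<alpha> S (p + s *\<^sub>R z)) \<longlongrightarrow> dir_deriv \<alpha> S p) (at_right 0)"
        using * by (rule isCont_tendsto_compose)
    qed (use that in simp)
    show thesis
    proof (rule that[OF _ tendsto_diff[OF lim lim]])
      have "(coth (?a / 2) - coth (?b / 2)) * (?a / 2 - ?b / 2) \<le> 0"
        using \<open>0 < ?a * ?b\<close> by (intro coth_diff_times_diff_nonpos) simp
      then have "(coth (?a / 2) - coth (?b / 2)) * (e \<bullet> \<alpha>) * (r / 2) \<le> 0"
        using ab by (simp add: diff_divide_distrib[symmetric] algebra_simps)
      then have "(coth (?a / 2) - coth (?b / 2)) * (e \<bullet> \<alpha>) \<le> 0"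
        using r_pos by (simp add: mult_le_0_iff)
      then have "om' r * ((coth (?a / 2) - coth (?b / 2)) * (e \<bullet> \<alpha>)) \<le> 0"
        using \<open>0 < om' r\<close> by (simp add: mult_le_0_iff)
      then show "coth (?a / 2) * dir_deriv \<alpha> S x0 - coth (?b / 2) * dir_deriv \<alpha> S y0 \<le> 0"
        by (simp add: gradient_left gradient_right algebra_simps)
    qed (use False wall in auto)
  qed
qed

text \<open>The distance of two mirrored Brownian motions has generator \<open>2 \<omega>''\<close>, and
  \<open>\<omega>(r) = (2M/\<mu>)(1 - exp(-r \<surd>(\<mu>/2)))\<close> solves \<open>\<mu>\<omega> - 2\<omega>'' = 2M\<close> with \<open>\<omega>(0) = 0\<close>. A small linear
  term makes it coercive and strictly increasing. At a maximum of \<open>S x - S y - \<omega> |x - y|\<close> the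
  difference of the two equations for \<open>S\<close> contradicts the equation for \<open>\<omega>\<close>.\<close>

theorem reflection_coupling_estimate:
  fixes S :: "'a::euclidean_space \<Rightarrow> real"
  assumes root: "integral_root_system R" and pos: "positive_roots R Rp"
    and k: "\<And>\<alpha>. \<alpha> \<in> Rp \<Longrightarrow> 0 \<le> k \<alpha>"
    and C2: "C2 S" and inv: "\<And>\<alpha> x. \<alpha> \<in> R \<Longrightarrow> S (root_reflection \<alpha> x) = S x"
    and K: "compact K" "\<And>x. x \<notin> K \<Longrightarrow> S x = 0"
    and "0 < \<mu>"
    and M: "\<And>x. x \<in> regular_points R \<Longrightarrow> \<bar>\<mu> * S x - radial_formula Rp k S x / 2\<bar> \<le> M"
  shows "S x - S y \<le> 2 * M / \<mu> * (1 - exp (- sqrt (\<mu> / 2) * norm (x - y)))"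
proof -
  obtain z where z: "z \<in> regular_points R"
    using pos by (auto simp: positive_roots_def)
  have "finite R" and nz: "\<And>\<alpha>. \<alpha> \<in> R \<Longrightarrow> \<alpha> \<noteq> 0"
    using root by (auto simp: integral_root_system_def)
  have sub: "Rp \<subseteq> R"
    using pos by (rule positive_roots_subset)
  have "0 \<le> M"
    using M[OF z] by linarith
  define A where "A = 2 * M / \<mu>"
  define c where "c = sqrt (\<mu> / 2)"
  have "0 \<le> A" "0 < c" "c * c = \<mu> / 2" "\<mu> * A = 2 * M"
    using \<open>0 \<le> M\<close> \<open>0 < \<mu>\<close> by (auto simp: A_def c_def)
  have eps: "S x1 - S y1 \<le> A * (1 - exp (- c * norm (x1 - y1))) + \<epsilon> * norm (x1 - y1)"
    if "0 < \<epsilon>" for x1 y1 \<epsilon>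
  proof (rule ccontr)
    define om where "om s = A * (1 - exp (- c * s)) + \<epsilon> * s" for s
    define om' where "om' s = A * c * exp (- c * s) + \<epsilon>" for s
    define om'' where "om'' s = - A * c * c * exp (- c * s)" for s
    have om': "(om has_real_derivative om' s) (at s)" for s
      unfolding om_def om'_def by (auto intro!: derivative_eq_intros simp: algebra_simps)
    have om'': "(om' has_real_derivative om'' s) (at s)" for s
      unfolding om'_def om''_def by (auto intro!: derivative_eq_intros simp: algebra_simps)
    have pos': "0 < om' s" for s
      using \<open>0 \<le> A\<close> \<open>0 < c\<close> \<open>0 < \<epsilon>\<close> by (simp add: om'_def add_nonneg_pos)
    have mono: "om s < om t" if "s < t" for s t
      by (rule DERIV_pos_imp_increasing[OF that]) (rule exI, rule conjI, rule om', rule pos')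
    have cont: "continuous_on UNIV om"
      unfolding om_def by (intro continuous_intros)
    have lower: "\<epsilon> * s \<le> om s" if "0 \<le> s" for s
      using that \<open>0 \<le> A\<close> \<open>0 < c\<close> by (simp add: om_def)
    assume "\<not> S x1 - S y1 \<le> A * (1 - exp (- c * norm (x1 - y1))) + \<epsilon> * norm (x1 - y1)"
    then have large1: "om (norm (x1 - y1)) < S x1 - S y1"
      by (simp add: om_def)
    have contS: "continuous_on UNIV S"
      using C2D(1)[OF C2] by (simp add: continuous_at_imp_continuous_on differentiable_imp_continuous_within)
    obtain x0 y0 where max: "\<And>x y. S x - S y - om (norm (x - y)) \<le> S x0 - S y0 - om (norm (x0 - y0))"
      and large: "om (norm (x0 - y0)) < S x0 - S y0"
      by (rule penalised_difference_attains_max[OF contS K cont \<open>0 < \<epsilon>\<close> lower large1]) blast+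
    have "x0 \<noteq> y0"
      using large by (auto simp: om_def)
    interpret penalised_maximum S om om' om'' x0 y0
      using C2 om' om'' max \<open>x0 \<noteq> y0\<close> by (rule penalised_maximum.intro)
    \<comment> \<open>The equation for \<open>S\<close> is available off the walls only, so the maximum is approached
      along the regular direction \<open>z\<close>, the same at both points.\<close>
    let ?X = "\<lambda>s. x0 + s *\<^sub>R z" and ?Y = "\<lambda>s. y0 + s *\<^sub>R z"
    let ?q = "\<lambda>\<alpha> s. coth ((\<alpha> \<bullet> ?X s) / 2) * dir_deriv \<alpha> S (?X s)
         - coth ((\<alpha> \<bullet> ?Y s) / 2) * dir_deriv \<alpha> S (?Y s)"
    have "\<forall>\<alpha>\<in>Rp. \<exists>l. l \<le> 0 \<and> (?q \<alpha> \<longlongrightarrow> l) (at_right 0)"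
    proof
      fix \<alpha> assume that: "\<alpha> \<in> Rp"
      have "\<alpha> \<in> R" "\<alpha> \<bullet> z \<noteq> 0"
        using that sub z by (auto simp: regular_points_def)
      obtain l where "l \<le> 0" "(?q \<alpha> \<longlongrightarrow> l) (at_right 0)"
        by (rule drift_contribution[OF inv[OF \<open>\<alpha> \<in> R\<close>] nz[OF \<open>\<alpha> \<in> R\<close>] \<open>\<alpha> \<bullet> z \<noteq> 0\<close> mono pos'])
      then show "\<exists>l. l \<le> 0 \<and> (?q \<alpha> \<longlongrightarrow> l) (at_right 0)"
        by (intro exI conjI)
    qed
    from bchoice[OF this] obtain l where
      "\<forall>\<alpha>\<in>Rp. l \<alpha> \<le> 0 \<and> (?q \<alpha> \<longlongrightarrow> l \<alpha>) (at_right 0)"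
      by (elim exE)
    note l = this[THEN bspec, THEN conjunct1] this[THEN bspec, THEN conjunct2]
    define L where "L = (laplacian S x0 - laplacian S y0) + (\<Sum>\<alpha>\<in>Rp. k \<alpha> * l \<alpha>)"
    have line: "((\<lambda>s. p + s *\<^sub>R z) \<longlongrightarrow> p) (at_right 0)" for p
    proof -
      have "((\<lambda>s. p + s *\<^sub>R z) \<longlongrightarrow> p + 0 *\<^sub>R z) (at_right 0)"
        by (intro tendsto_intros)
      then show ?thesis by simp
    qed
    have lap: "((\<lambda>s. laplacian S (p + s *\<^sub>R z)) \<longlongrightarrow> laplacian S p) (at_right 0)" for p
    proof (rule isCont_tendsto_compose[OF _ line])
      show "isCont (laplacian S) p"
        unfolding laplacian_def using C2D(3)[OF C2]
        by (intro continuous_intros) (simp add: continuous_on_eq_continuous_at)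
    qed
    have Slim: "((\<lambda>s. S (p + s *\<^sub>R z)) \<longlongrightarrow> S p) (at_right 0)" for p
      using C2D(1)[OF C2] by (intro isCont_tendsto_compose[OF _ line]) (simp add: differentiable_imp_continuous_within)
    have radial: "radial_formula Rp k S (?X s) - radial_formula Rp k S (?Y s)
        = (laplacian S (?X s) - laplacian S (?Y s)) + (\<Sum>\<alpha>\<in>Rp. k \<alpha> * ?q \<alpha> s)" for s
      by (simp add: radial_formula_def right_diff_distrib sum_subtractf mult.assoc)
    have "\<mu> * (S x0 - S y0) \<le> L / 2 + 2 * M"
    proof (rule tendsto_le[OF trivial_limit_at_right_real])
      show "((\<lambda>s. \<mu> * (S (?X s) - S (?Y s))) \<longlongrightarrow> \<mu> * (S x0 - S y0)) (at_right 0)"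
        by (intro tendsto_intros Slim)
      show "((\<lambda>s. (radial_formula Rp k S (?X s) - radial_formula Rp k S (?Y s)) / 2 + 2 * M)
          \<longlongrightarrow> L / 2 + 2 * M) (at_right 0)"
        unfolding radial L_def by (intro tendsto_intros lap l) auto
      show "\<forall>\<^sub>F s in at_right 0. \<mu> * (S (?X s) - S (?Y s))
          \<le> (radial_formula Rp k S (?X s) - radial_formula Rp k S (?Y s)) / 2 + 2 * M"
        using eventually_regular_along_ray[OF \<open>finite R\<close> z, of x0]
          eventually_regular_along_ray[OF \<open>finite R\<close> z, of y0]
      proof eventually_elim
        case (elim s)
        have "\<mu> * S (?X s) - radial_formula Rp k S (?X s) / 2 \<le> M"
          using M[OF elim(1)] by (rule abs_le_D1)
        moreover have "- (\<mu> * S (?Y s) - radial_formula Rp k S (?Y s) / 2) \<le> M"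
          using M[OF elim(2)] by (rule abs_le_D2)
        ultimately show ?case
          by (simp add: right_diff_distrib diff_divide_distrib)
      qed
    qed
    moreover have "L \<le> 4 * om'' r + 0"
      unfolding L_def using k l(1)
      by (intro add_mono laplacian_diff sum_nonpos mult_nonneg_nonpos)
    ultimately have "\<mu> * (S x0 - S y0) \<le> 2 * om'' r + 2 * M"
      by linarith
    moreover have "\<mu> * om r < \<mu> * (S x0 - S y0)"
      using large \<open>0 < \<mu>\<close> by (simp add: r_def)
    moreover have "\<mu> * om r - 2 * om'' r = 2 * M + \<mu> * \<epsilon> * r"
    proof -
      have "\<mu> * (A * (1 - E) + \<epsilon> * s) - 2 * (- A * c * c * E)
        = \<mu> * A + \<mu> * \<epsilon> * s - A * E * (\<mu> - 2 * (c * c))" for E s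
        by (simp add: algebra_simps)
      from this[of "exp (- c * r)" r] show ?thesis
        unfolding om_def om''_def
        using \<open>c * c = \<mu> / 2\<close> \<open>\<mu> * A = 2 * M\<close> by simp
    qed
    moreover have "0 < \<mu> * \<epsilon> * r"
      using \<open>0 < \<mu>\<close> \<open>0 < \<epsilon>\<close> r_pos by simp
    ultimately show False by linarith
  qed
  have "((\<lambda>\<epsilon>. A * (1 - exp (- c * norm (x - y))) + \<epsilon> * norm (x - y))
      \<longlongrightarrow> A * (1 - exp (- c * norm (x - y))) + 0 * norm (x - y)) (at_right 0)"
    by (intro tendsto_intros)
  moreover have "\<forall>\<^sub>F \<epsilon> in at_right 0.
      S x - S y \<le> A * (1 - exp (- c * norm (x - y))) + \<epsilon> * norm (x - y)"
    by (rule eventually_mono[OF eventually_at_right_less[of 0]]) (rule eps)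
  ultimately have "S x - S y \<le> A * (1 - exp (- c * norm (x - y))) + 0 * norm (x - y)"
    by (rule tendsto_lowerbound) simp
  then show ?thesis
    by (simp add: A_def c_def)
qed

section \<open>Smooth cutoff functions\<close>

lemma Ck_Suc_imp_Ck: "Ck (Suc m) f \<Longrightarrow> Ck m f"
proof (induction m arbitrary: f)
  case 0
  then show ?case
    by (auto intro!: continuous_at_imp_continuous_on differentiable_imp_continuous_within)
next
  case (Suc m)
  then show ?case by (metis Ck.simps(2))
qed

lemma Ck_add:
  assumes "Ck m f" and "Ck m g"
  shows "Ck m (\<lambda>x. f x + g x)"
  using assms
proof (induction m arbitrary: f g)
  case 0
  then show ?case by (auto intro: continuous_intros)
next
  case (Suc m)
  have "dir_deriv v (\<lambda>x. f x + g x) = (\<lambda>x. dir_deriv v f x + dir_deriv v g x)" for v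
    using Suc.prems by (intro ext dir_deriv_eq has_derivative_add has_derivative_dir_deriv) auto
  then show ?case
    using Suc by auto
qed

lemma Ck_mult:
  assumes "Ck m f" and "Ck m g"
  shows "Ck m (\<lambda>x. f x * g x)"
  using assms
proof (induction m arbitrary: f g)
  case 0
  then show ?case by (auto intro: continuous_intros)
next
  case (Suc m)
  have "dir_deriv v (\<lambda>x. f x * g x) = (\<lambda>x. f x * dir_deriv v g x + dir_deriv v f x * g x)" for v
    using Suc.prems by (intro ext dir_deriv_eq has_derivative_mult has_derivative_dir_deriv) auto
  moreover have "Ck m (\<lambda>x. f x * dir_deriv v g x + dir_deriv v f x * g x)" for v
    using Suc.prems by (intro Ck_add Suc.IH) (auto intro: Ck_Suc_imp_Ck)
  ultimately show ?case
    using Suc.prems by (auto intro: differentiable_mult)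
qed

lemma Ck_const: "Ck m (\<lambda>x. c)"
proof (induction m arbitrary: c)
  case (Suc m)
  have "dir_deriv v (\<lambda>x. c) = (\<lambda>x. 0)" for v :: 'a
    by (intro ext dir_deriv_eq) (auto intro!: derivative_eq_intros)
  then show ?case using Suc by simp
qed simp

lemma Ck_inner: "Ck m (\<lambda>x. x \<bullet> v)"
proof (cases m)
  case 0
  then show ?thesis by (auto intro: continuous_intros)
next
  case (Suc m')
  have "dir_deriv u (\<lambda>x. x \<bullet> v) = (\<lambda>x. u \<bullet> v)" for u
    by (intro ext dir_deriv_eq) (auto intro!: derivative_eq_intros)
  moreover have "(\<lambda>x. x \<bullet> v) differentiable (at x)" for x
    by (rule differentiableI) (auto intro!: derivative_eq_intros)
  ultimately show ?thesis
    using Suc by (simp add: Ck_const)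
qed

lemma Cc_infinity_C2:
  assumes "f \<in> Cc_infinity"
  shows "C2 f"
proof -
  have "Ck (Suc (Suc 0)) f"
    using assms by (simp only: Cc_infinity_def mem_Collect_eq)
  then show ?thesis
    by (auto simp: C2_def)
qed

text \<open>Extended by zero to the left, the functions \<open>p(1/t) exp(-1/t)\<close> with a polynomial \<open>p\<close> form a
  class closed under differentiation, so that smoothness of all orders follows by induction on a
  single statement. The derivative comes from the substitution \<open>y = 1/t\<close>.\<close>

definition flat :: "real poly \<Rightarrow> real \<Rightarrow> real" where
  "flat p t = (if 0 < t then poly p (1 / t) * exp (- (1 / t)) else 0)"

definition flat_deriv :: "real poly \<Rightarrow> real poly" where
  "flat_deriv p = [:0, 0, 1:] * (p - pderiv p)"

lemma tendsto_poly_times_exp_minus: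
  fixes p :: "real poly"
  shows "((\<lambda>y. poly p y * exp (- y)) \<longlongrightarrow> 0) at_top"
proof -
  have "((\<lambda>y. \<Sum>i\<le>degree p. coeff p i * (y ^ i / exp y)) \<longlongrightarrow> (\<Sum>i\<le>degree p. coeff p i * 0)) at_top"
    by (intro tendsto_sum tendsto_mult tendsto_const tendsto_power_div_exp_0)
  moreover have "poly p y * exp (- y) = (\<Sum>i\<le>degree p. coeff p i * (y ^ i / exp y))" for y
    by (simp add: poly_altdef sum_distrib_right exp_minus divide_inverse mult.assoc)
  ultimately show ?thesis by simp
qed

lemma flat_has_derivative: "(flat p has_real_derivative flat (flat_deriv p) t) (at t)"
proof -
  consider "t < 0" | "t = 0" | "0 < t" by linarith
  then show ?thesis
  proof cases
    case 1
    have "((\<lambda>_. 0) has_real_derivative 0) (at t)" by simp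
    then have "(flat p has_real_derivative 0) (at t)"
      by (rule has_field_derivative_transform_within_open[of _ _ _ "{..<0}"])
        (use 1 in \<open>auto simp: flat_def\<close>)
    then show ?thesis using 1 by (simp add: flat_def)
  next
    case 2
    have "((\<lambda>h. flat p h / h) \<longlongrightarrow> 0) (at_left 0)"
      by (rule tendsto_eventually) (auto simp: eventually_at_filter flat_def)
    moreover have "((\<lambda>h. flat p h / h) \<longlongrightarrow> 0) (at_right 0)"
    proof -
      have "((\<lambda>h. poly (pCons 0 p) (inverse h) * exp (- inverse h)) \<longlongrightarrow> 0) (at_right 0)"
        using tendsto_poly_times_exp_minus filterlim_inverse_at_top_right
        by (rule filterlim_compose)
      moreover have "\<forall>\<^sub>F h in at_right 0.
          poly (pCons 0 p) (inverse h) * exp (- inverse h) = flat p h / h"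
        by (auto simp: eventually_at_filter flat_def field_simps)
      ultimately show ?thesis by (rule Lim_transform_eventually)
    qed
    ultimately have "((\<lambda>h. flat p h / h) \<longlongrightarrow> 0) (at 0)"
      by (simp add: filterlim_split_at)
    then show ?thesis
      using 2 by (simp add: has_field_derivative_iff flat_def)
  next
    case 3
    have "((\<lambda>t. poly p (1 / t) * exp (- (1 / t))) has_real_derivative
        flat (flat_deriv p) t) (at t)"
      using 3
      by (auto intro!: derivative_eq_intros DERIV_chain2[OF poly_DERIV]
          simp: flat_def flat_deriv_def power2_eq_square divide_simps)
        (simp add: algebra_simps)
    then show ?thesis
      by (rule has_field_derivative_transform_within_open[of _ _ _ "{0<..}"])
        (use 3 in \<open>auto simp: flat_def\<close>)
  qed
qed

lemma continuous_flat: "continuous_on A (flat p)"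
  using flat_has_derivative DERIV_isCont by (metis continuous_at_imp_continuous_on)

lemma flat_bounded:
  obtains B where "0 \<le> B" "\<And>t. t \<le> 1 \<Longrightarrow> \<bar>flat p t\<bar> \<le> B"
proof -
  have "compact (flat p ` {0..1})"
    by (intro compact_continuous_image continuous_flat) simp
  then obtain B where B: "B > 0" "\<And>y. y \<in> flat p ` {0..1} \<Longrightarrow> norm y \<le> B"
    using compact_imp_bounded bounded_pos by metis
  have "\<bar>flat p t\<bar> \<le> B" if "t \<le> 1" for t
  proof (cases "0 \<le> t")
    case True
    then show ?thesis using that B(2)[of "flat p t"] by auto
  next
    case False
    then show ?thesis using B(1) by (simp add: flat_def)
  qed
  then show thesis using that[of B] B(1) by simp
qed

definition cutoff :: "real poly \<Rightarrow> real \<Rightarrow> 'a::euclidean_space \<Rightarrow> real" where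
  "cutoff p N x = flat p (1 - (x \<bullet> x) / N)"

lemma cutoff_has_derivative:
  "(cutoff p N has_derivative
     (\<lambda>v. cutoff (flat_deriv p) N x * (- 2 / N * (x \<bullet> v)))) (at x)"
proof -
  have "((\<lambda>x. 1 - inverse N * (x \<bullet> x)) has_derivative (\<lambda>v. - (inverse N * (2 * (x \<bullet> v))))) (at x)"
    by (auto intro!: derivative_eq_intros simp: inner_commute)
  then have "((\<lambda>x. 1 - (x \<bullet> x) / N) has_derivative (\<lambda>v. - 2 / N * (x \<bullet> v))) (at x)"
    by (simp add: divide_inverse mult_ac)
  then have "((\<lambda>x. flat p (1 - (x \<bullet> x) / N)) has_derivative
      (\<lambda>v. flat (flat_deriv p) (1 - (x \<bullet> x) / N) * (- 2 / N * (x \<bullet> v)))) (at x)"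
    using flat_has_derivative
    by (intro has_derivative_compose[of "\<lambda>x. 1 - (x \<bullet> x) / N" _ x UNIV "flat p"])
      (auto simp: has_field_derivative_def)
  then show ?thesis
    by (simp add: cutoff_def[abs_def])
qed

lemma dir_deriv_cutoff:
  "dir_deriv v (cutoff p N) = (\<lambda>x. cutoff (flat_deriv p) N x * (- 2 / N * (x \<bullet> v)))"
  by (intro ext dir_deriv_eq cutoff_has_derivative)

lemma Ck_cutoff: "Ck m (cutoff p N :: 'a::euclidean_space \<Rightarrow> real)"
proof (induction m arbitrary: p)
  case 0
  then show ?case
    unfolding cutoff_def
    by (auto intro!: continuous_intros continuous_on_compose2[OF continuous_flat[of UNIV]]
        simp: divide_inverse)
next
  case (Suc m)
  have "cutoff p N differentiable (at x)" for x :: 'a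
    using cutoff_has_derivative by (rule differentiableI)
  moreover have "Ck m (dir_deriv v (cutoff p N))" for v :: 'a
    unfolding dir_deriv_cutoff by (intro Ck_mult Suc Ck_const Ck_inner)
  ultimately show ?case by simp
qed

lemma laplacian_cutoff:
  "laplacian (cutoff p N) x
    = cutoff (flat_deriv (flat_deriv p)) N x * (4 / N\<^sup>2 * (x \<bullet> x))
      - 2 / N * cutoff (flat_deriv p) N x * DIM('a)" for x :: "'a::euclidean_space"
proof -
  have "dir_deriv b (dir_deriv b (cutoff p N)) x
      = cutoff (flat_deriv (flat_deriv p)) N x * (4 / N\<^sup>2 * ((x \<bullet> b) * (x \<bullet> b)))
        - 2 / N * cutoff (flat_deriv p) N x" if "b \<in> Basis" for b :: 'a
  proof -
    have "dir_deriv b (dir_deriv b (cutoff p N)) x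
        = cutoff (flat_deriv p) N x * (- 2 / N * (b \<bullet> b))
          + cutoff (flat_deriv (flat_deriv p)) N x * (- 2 / N * (x \<bullet> b)) * (- 2 / N * (x \<bullet> b))"
    proof -
      have "((\<lambda>x. - 2 / N * (x \<bullet> b)) has_derivative (\<lambda>v. - 2 / N * (v \<bullet> b))) (at x)"
        by (intro has_derivative_mult_right has_derivative_inner_left has_derivative_ident)
      from dir_deriv_eq[OF has_derivative_mult[OF cutoff_has_derivative this]] show ?thesis
        unfolding dir_deriv_cutoff .
    qed
    then show ?thesis
      using that by (simp add: power2_eq_square algebra_simps)
  qed
  then have "laplacian (cutoff p N) x = (\<Sum>b\<in>Basis.
      cutoff (flat_deriv (flat_deriv p)) N x * (4 / N\<^sup>2 * ((x \<bullet> b) * (x \<bullet> b)))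
        - 2 / N * cutoff (flat_deriv p) N x)"
    by (simp add: laplacian_def)
  also have "\<dots> = cutoff (flat_deriv (flat_deriv p)) N x * (4 / N\<^sup>2 * (\<Sum>b\<in>Basis. (x \<bullet> b) * (x \<bullet> b)))
      - 2 / N * cutoff (flat_deriv p) N x * DIM('a)"
    by (simp add: sum_subtractf sum_distrib_left)
  finally show ?thesis
    by (simp add: euclidean_inner[symmetric])
qed

text \<open>The continuous extension of \<open>s coth(s/2)\<close>.\<close>

definition xcoth :: "real \<Rightarrow> real" where
  "xcoth s = (if s = 0 then 2 else s * coth (s / 2))"

lemma isCont_xcoth: "isCont xcoth s"
proof (cases "s = 0")
  case True
  have "filterlim (\<lambda>s::real. s / 2) (at 0) (at 0)"
    by (intro filterlim_atI tendsto_eq_intros) (auto simp: eventually_at_filter)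
  from tendsto_mult_left[OF filterlim_compose[OF tendsto_times_coth this], of 2]
  have "((\<lambda>s. s * coth (s / 2)) \<longlongrightarrow> 2) (at 0)" by simp
  then have "(xcoth \<longlongrightarrow> 2) (at 0)"
    by (rule Lim_transform_eventually) (auto simp: eventually_at_filter xcoth_def)
  then show ?thesis using True by (simp add: isCont_def xcoth_def)
next
  case False
  have "((\<lambda>s. s * coth (s / 2)) \<longlongrightarrow> s * coth (s / 2)) (at s)"
    using False by (intro tendsto_intros tendsto_coth) auto
  moreover have "\<forall>\<^sub>F t in at s. t * coth (t / 2) = xcoth t"
    using False by (auto simp: eventually_at xcoth_def dist_real_def intro!: exI[of _ "\<bar>s\<bar>"])
  ultimately have "(xcoth \<longlongrightarrow> s * coth (s / 2)) (at s)"
    by (rule Lim_transform_eventually)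
  then show ?thesis using False by (simp add: isCont_def xcoth_def)
qed

lemma abs_xcoth_le: "\<bar>xcoth s\<bar> \<le> \<bar>s\<bar> + 2"
proof -
  have pos: "\<bar>xcoth t\<bar> \<le> t + 2" if "0 < t" for t
  proof -
    define u where "u = t / 2"
    have "0 < u" using that by (simp add: u_def)
    have "u * exp (- u) \<le> u * 1"
      using \<open>0 < u\<close> by (intro mult_left_mono) auto
    also have "u \<le> sinh u"
      using real_le_x_sinh[of u] \<open>0 < u\<close> by (simp add: sinh_field_def exp_minus)
    finally have "u * (cosh u - sinh u) \<le> sinh u"
      by (simp add: cosh_minus_sinh)
    then have "u * cosh u \<le> (u + 1) * sinh u"
      by (simp add: algebra_simps)
    then have "u * coth u \<le> u + 1"
      using \<open>0 < u\<close> by (simp add: coth_def pos_divide_le_eq)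
    moreover have "0 \<le> u * coth u"
      using \<open>0 < u\<close> by (simp add: coth_def)
    ultimately show ?thesis
      using that by (simp add: xcoth_def u_def)
  qed
  have even: "xcoth (- s) = xcoth s"
    by (simp add: xcoth_def coth_minus)
  consider "s < 0" | "s = 0" | "0 < s" by linarith
  then show ?thesis
  proof cases
    case 1
    then show ?thesis using pos[of "- s"] even by simp
  next
    case 2
    then show ?thesis by (simp add: xcoth_def)
  next
    case 3
    then show ?thesis using pos[of s] by simp
  qed
qed

text \<open>The value of the Heckman--Opdam Laplacian on the cutoff with \<open>p = 1\<close>: by radial symmetry the
  gradient is a multiple of \<open>x\<close>, which cancels the poles of \<open>coth\<close> on the walls.\<close>

definition cutoff_HO :: "'a::euclidean_space set \<Rightarrow> ('a \<Rightarrow> real) \<Rightarrow> real \<Rightarrow> 'a \<Rightarrow> real" where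
  "cutoff_HO Rp k N x = cutoff (flat_deriv (flat_deriv 1)) N x * (4 / N\<^sup>2 * (x \<bullet> x))
      - 2 / N * cutoff (flat_deriv 1) N x * (DIM('a) + (\<Sum>\<alpha>\<in>Rp. k \<alpha> * xcoth (\<alpha> \<bullet> x)))"

lemma continuous_cutoff_HO: "isCont (cutoff_HO Rp k N) x"
proof -
  have "isCont (cutoff p N) x" for p
    using cutoff_has_derivative has_derivative_continuous by blast
  then show ?thesis
    unfolding cutoff_HO_def
    by (intro continuous_intros isCont_o2[OF _ isCont_xcoth]) auto
qed

lemma HO_formula_cutoff:
  assumes "x \<in> regular_points R" and "Rp \<subseteq> R"
  shows "HO_formula Rp k (cutoff 1 N) x = cutoff_HO Rp k N x"
proof -
  have "cutoff 1 N x - cutoff 1 N (root_reflection \<alpha> x) = 0" for \<alpha>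
    by (simp add: cutoff_def power2_norm_eq_inner[symmetric] norm_root_reflection)
  moreover have "k \<alpha> * coth ((\<alpha> \<bullet> x) / 2) * dir_deriv \<alpha> (cutoff 1 N) x
      = - 2 / N * cutoff (flat_deriv 1) N x * (k \<alpha> * xcoth (\<alpha> \<bullet> x))" if "\<alpha> \<in> Rp" for \<alpha>
    using that assms
    by (auto simp: dir_deriv_cutoff xcoth_def regular_points_def inner_commute)
  then have "(\<Sum>\<alpha>\<in>Rp. k \<alpha> * coth ((\<alpha> \<bullet> x) / 2) * dir_deriv \<alpha> (cutoff 1 N) x)
      = - 2 / N * cutoff (flat_deriv 1) N x * (\<Sum>\<alpha>\<in>Rp. k \<alpha> * xcoth (\<alpha> \<bullet> x))"
    unfolding sum_distrib_left by (intro sum.cong refl)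
  ultimately show ?thesis
    unfolding HO_formula_def laplacian_cutoff cutoff_HO_def
    by (simp add: algebra_simps)
qed

lemma islimpt_regular_points:
  assumes root: "integral_root_system R" and z: "z \<in> regular_points R"
    and x: "x \<notin> regular_points R"
  shows "x islimpt regular_points R"
  unfolding islimpt_approachable
proof (intro allI impI)
  fix \<epsilon> :: real assume "0 < \<epsilon>"
  have "finite R"
    using root by (simp add: integral_root_system_def)
  have "z \<noteq> 0"
    using x z by (auto simp: regular_points_def)
  have "\<forall>\<^sub>F s in at_right 0. s < \<epsilon> / norm z"
    using \<open>0 < \<epsilon>\<close> \<open>z \<noteq> 0\<close> by (intro order_tendstoD(2)[OF tendsto_ident_at]) simp
  with eventually_regular_along_ray[OF \<open>finite R\<close> z, of x] eventually_at_right_less[of 0]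
  have "\<forall>\<^sub>F s in at_right 0. x + s *\<^sub>R z \<in> regular_points R \<and> 0 < s \<and> s < \<epsilon> / norm z"
    by eventually_elim simp
  then obtain s where s: "x + s *\<^sub>R z \<in> regular_points R" "0 < s" "s < \<epsilon> / norm z"
    using eventually_happens[of _ "at_right (0::real)"] trivial_limit_at_right_real by blast
  then show "\<exists>x'\<in>regular_points R. x' \<noteq> x \<and> dist x' x < \<epsilon>"
    using \<open>z \<noteq> 0\<close> by (intro bexI[of _ "x + s *\<^sub>R z"]) (auto simp: dist_norm pos_less_divide_eq)
qed

text \<open>On the walls the operator is a limit along regular points, which accumulate there.\<close>

lemma HO_laplacian_cutoff:
  assumes root: "integral_root_system R" and pos: "positive_roots R Rp"
  shows "HO_laplacian R Rp k (cutoff 1 N) = cutoff_HO Rp k N"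
proof
  fix x :: 'a
  have sub: "Rp \<subseteq> R"
    using pos by (rule positive_roots_subset)
  obtain z where z: "z \<in> regular_points R"
    using pos by (auto simp: positive_roots_def)
  show "HO_laplacian R Rp k (cutoff 1 N) x = cutoff_HO Rp k N x"
  proof (cases "x \<in> regular_points R")
    case True
    then show ?thesis by (simp add: HO_laplacian_def HO_formula_cutoff[OF _ sub])
  next
    case False
    have "(cutoff_HO Rp k N \<longlongrightarrow> cutoff_HO Rp k N x) (at x within regular_points R)"
      using continuous_at_imp_continuous_at_within[OF continuous_cutoff_HO]
      by (simp add: continuous_within)
    moreover have "\<forall>\<^sub>F y in at x within regular_points R.
        cutoff_HO Rp k N y = HO_formula Rp k (cutoff 1 N) y"
      by (auto simp: eventually_at_filter HO_formula_cutoff[OF _ sub])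
    ultimately have "(HO_formula Rp k (cutoff 1 N) \<longlongrightarrow> cutoff_HO Rp k N x)
        (at x within regular_points R)"
      by (rule Lim_transform_eventually)
    then show ?thesis
      using False islimpt_regular_points[OF root z False]
      by (simp add: HO_laplacian_def tendsto_Lim trivial_limit_within)
  qed
qed

lemma cutoff_outside:
  assumes "n \<le> norm x" and "0 < n"
  shows "cutoff p (n\<^sup>2) x = 0"
proof -
  have "1 \<le> (x \<bullet> x) / n\<^sup>2"
    using power_mono[OF assms(1), of 2] assms(2)
    by (simp add: power2_norm_eq_inner le_divide_eq)
  then show ?thesis by (simp add: cutoff_def flat_def)
qed

lemma compact_support_C0:
  assumes "continuous_on UNIV f" and "\<And>x. n \<le> norm x \<Longrightarrow> f x = 0"
  shows "f \<in> C0"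
  unfolding C0_def
  using assms by (auto intro!: tendsto_eventually exI[of _ n] simp: eventually_at_infinity)

lemma cutoff_Cc_infinity:
  assumes "0 < n"
  shows "cutoff p (n\<^sup>2) \<in> Cc_infinity"
proof -
  have "{x. cutoff p (n\<^sup>2) x \<noteq> 0} \<subseteq> cball 0 n"
  proof
    fix x assume "x \<in> {x. cutoff p (n\<^sup>2) x \<noteq> 0}"
    then have "\<not> n \<le> norm x"
      using cutoff_outside[OF _ assms] by blast
    then show "x \<in> cball 0 n" by simp
  qed
  then have "bounded {x. cutoff p (n\<^sup>2) x \<noteq> 0}"
    using bounded_cball bounded_subset by blast
  then show ?thesis
    by (simp add: Cc_infinity_def Ck_cutoff)
qed

text \<open>The drift grows linearly, so the Heckman--Opdam Laplacian of a cutoff at scale \<open>n\<close> is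
  \<open>O(1/n)\<close>.\<close>

lemma cutoff_HO_bound:
  fixes Rp :: "'a::euclidean_space set"
  obtains A where "0 \<le> A" "\<And>n x. 1 \<le> n \<Longrightarrow> \<bar>cutoff_HO Rp k (n\<^sup>2) x\<bar> \<le> A / n"
proof -
  obtain B1 where B1: "0 \<le> B1" "\<And>t. t \<le> 1 \<Longrightarrow> \<bar>flat (flat_deriv 1) t\<bar> \<le> B1"
    using flat_bounded by metis
  obtain B2 where B2: "0 \<le> B2" "\<And>t. t \<le> 1 \<Longrightarrow> \<bar>flat (flat_deriv (flat_deriv 1)) t\<bar> \<le> B2"
    using flat_bounded by metis
  define K where "K = DIM('a) + (\<Sum>\<alpha>\<in>Rp. \<bar>k \<alpha>\<bar> * (norm \<alpha> + 2))"
  have "0 \<le> K"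
    unfolding K_def by (intro add_nonneg_nonneg sum_nonneg) auto
  define A where "A = 4 * B2 + 2 * B1 * K"
  have "0 \<le> A"
    using B1(1) B2(1) \<open>0 \<le> K\<close> by (simp add: A_def)
  have "\<bar>cutoff_HO Rp k (n\<^sup>2) x\<bar> \<le> A / n" if "1 \<le> n" for n x
  proof (cases "norm x < n")
    case False
    then have "cutoff_HO Rp k (n\<^sup>2) x = 0"
      using that by (simp add: cutoff_HO_def cutoff_outside)
    then show ?thesis using \<open>0 \<le> A\<close> that by simp
  next
    case True
    have n2: "n \<le> n\<^sup>2" "0 < n\<^sup>2"
      using that by (auto simp: power2_eq_square)
    have arg: "1 - (x \<bullet> x) / n\<^sup>2 \<le> 1"
      by simp
    have xx: "x \<bullet> x \<le> n\<^sup>2"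
      using True by (simp add: power2_norm_eq_inner[symmetric] power_mono)
    have "4 / (n\<^sup>2)\<^sup>2 * (x \<bullet> x) \<le> 4 / (n\<^sup>2)\<^sup>2 * n\<^sup>2"
      by (intro mult_left_mono xx) auto
    also have "\<dots> = 4 / n\<^sup>2"
      using n2 by (simp add: power2_eq_square)
    also have "\<dots> \<le> 4 / n"
      using n2 that by (intro divide_left_mono) auto
    finally have "\<bar>cutoff (flat_deriv (flat_deriv 1)) (n\<^sup>2) x * (4 / (n\<^sup>2)\<^sup>2 * (x \<bullet> x))\<bar> \<le> B2 * (4 / n)"
      unfolding abs_mult cutoff_def by (intro mult_mono B2 arg) auto
    moreover have "\<bar>DIM('a) + (\<Sum>\<alpha>\<in>Rp. k \<alpha> * xcoth (\<alpha> \<bullet> x))\<bar> \<le> K * n"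
    proof -
      have "\<bar>k \<alpha> * xcoth (\<alpha> \<bullet> x)\<bar> \<le> \<bar>k \<alpha>\<bar> * (norm \<alpha> + 2) * n" for \<alpha>
      proof -
        have "\<bar>\<alpha> \<bullet> x\<bar> \<le> norm \<alpha> * n"
          using Cauchy_Schwarz_ineq2[of \<alpha> x] True
          by (meson less_imp_le mult_left_mono norm_ge_zero order_trans)
        then have "\<bar>xcoth (\<alpha> \<bullet> x)\<bar> \<le> (norm \<alpha> + 2) * n"
          using abs_xcoth_le[of "\<alpha> \<bullet> x"] that by (simp add: algebra_simps)
        then show ?thesis
          by (simp add: abs_mult mult_left_mono mult.assoc)
      qed
      then have "\<bar>\<Sum>\<alpha>\<in>Rp. k \<alpha> * xcoth (\<alpha> \<bullet> x)\<bar> \<le> (\<Sum>\<alpha>\<in>Rp. \<bar>k \<alpha>\<bar> * (norm \<alpha> + 2) * n)"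
        by (intro order_trans[OF sum_abs] sum_mono)
      moreover have "real DIM('a) * 1 \<le> DIM('a) * n"
        by (intro mult_left_mono that) simp
      moreover have "\<bar>DIM('a) + (\<Sum>\<alpha>\<in>Rp. k \<alpha> * xcoth (\<alpha> \<bullet> x))\<bar>
          \<le> real DIM('a) + \<bar>\<Sum>\<alpha>\<in>Rp. k \<alpha> * xcoth (\<alpha> \<bullet> x)\<bar>"
        using abs_triangle_ineq[of "real DIM('a)"] by simp
      ultimately show ?thesis
        unfolding K_def sum_distrib_right distrib_right by linarith
    qed
    then have "\<bar>2 / n\<^sup>2 * cutoff (flat_deriv 1) (n\<^sup>2) x * (DIM('a) + (\<Sum>\<alpha>\<in>Rp. k \<alpha> * xcoth (\<alpha> \<bullet> x)))\<bar>
        \<le> 2 / n\<^sup>2 * B1 * (K * n)"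
      unfolding abs_mult cutoff_def
      by (intro mult_mono B1 arg) (use B1(1) in auto)
    moreover have "2 / n\<^sup>2 * B1 * (K * n) = 2 * B1 * K / n"
      using that by (simp add: power2_eq_square)
    ultimately have "\<bar>cutoff_HO Rp k (n\<^sup>2) x\<bar> \<le> B2 * (4 / n) + 2 * B1 * K / n"
      unfolding cutoff_HO_def by linarith
    then show ?thesis
      by (simp add: A_def add_divide_distrib mult.commute)
  qed
  with \<open>0 \<le> A\<close> show thesis using that by blast
qed

section \<open>Feller semigroups\<close>

lemma C0_bounded:
  assumes "f \<in> C0"
  obtains B where "0 \<le> B" "\<And>x. \<bar>f x\<bar> \<le> B"
proof -
  have "\<forall>\<^sub>F x in at_infinity. dist (f x) 0 < 1"
    using assms by (intro tendstoD) (auto simp: C0_def)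
  then obtain b where b: "\<And>x. b \<le> norm x \<Longrightarrow> \<bar>f x\<bar> < 1"
    by (auto simp: eventually_at_infinity)
  have "compact (f ` cball 0 b)"
    using assms by (intro compact_continuous_image) (auto simp: C0_def intro: continuous_on_subset)
  then obtain B where B: "B > 0" "\<And>y. y \<in> f ` cball 0 b \<Longrightarrow> norm y \<le> B"
    using compact_imp_bounded bounded_pos by metis
  have "\<bar>f x\<bar> \<le> max B 1" for x
  proof (cases "b \<le> norm x")
    case True
    then show ?thesis using b[of x] by simp
  next
    case False
    then have "f x \<in> f ` cball 0 b" by simp
    then show ?thesis using B(2) by fastforce
  qed
  then show thesis using that[of "max B 1"] B(1) by simp
qed

lemma C0_measurable: "f \<in> C0 \<Longrightarrow> f \<in> borel_measurable borel"
  by (simp add: C0_def borel_measurable_continuous_onI)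

locale feller =
  fixes T :: "real \<Rightarrow> ('a::euclidean_space \<Rightarrow> real) \<Rightarrow> ('a \<Rightarrow> real)"
  assumes feller: "feller_semigroup T"
begin

lemma T_C0: "0 \<le> t \<Longrightarrow> f \<in> C0 \<Longrightarrow> T t f \<in> C0"
  and T_linear: "0 \<le> t \<Longrightarrow> f \<in> C0 \<Longrightarrow> g \<in> C0
    \<Longrightarrow> T t (\<lambda>x. a * f x + b * g x) = (\<lambda>x. a * T t f x + b * T t g x)"
  and T_contraction: "0 \<le> t \<Longrightarrow> f \<in> C0 \<Longrightarrow> (\<And>x. \<bar>f x\<bar> \<le> c) \<Longrightarrow> \<bar>T t f x\<bar> \<le> c"
  and T_0: "f \<in> C0 \<Longrightarrow> T 0 f = f"
  and T_add: "0 \<le> s \<Longrightarrow> 0 \<le> t \<Longrightarrow> f \<in> C0 \<Longrightarrow> T (s + t) f = T s (T t f)"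
  and T_strongly_continuous: "f \<in> C0 \<Longrightarrow> uniform_limit UNIV (\<lambda>t. T t f) f (at_right 0)"
  using feller unfolding feller_semigroup_def by simp_all

lemma T_diff_bound:
  assumes "0 \<le> t" "f \<in> C0" "g \<in> C0" "\<And>x. \<bar>f x - g x\<bar> \<le> c"
  shows "\<bar>T t f x - T t g x\<bar> \<le> c"
proof -
  have fg: "(\<lambda>x. 1 * f x + (- 1) * g x) \<in> C0"
    using assms(2,3) unfolding C0_def
    by (auto intro!: continuous_intros tendsto_eq_intros)
  have "\<bar>T t (\<lambda>x. 1 * f x + (- 1) * g x) x\<bar> \<le> c"
    using assms by (intro T_contraction fg) auto
  then show ?thesis
    by (simp add: T_linear[OF assms(1-3), of 1 "- 1", simplified])
qed

text \<open>By the semigroup property and contractivity, continuity at time \<open>0\<close> is uniform in time.\<close>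

lemma T_increment:
  assumes "f \<in> C0" and "0 < d" and d: "\<And>r x. 0 < r \<Longrightarrow> r < d \<Longrightarrow> \<bar>T r f x - f x\<bar> \<le> c"
    and "0 \<le> s" "0 \<le> t" "\<bar>s - t\<bar> < d" "0 \<le> c"
  shows "\<bar>T s f x - T t f x\<bar> \<le> c"
proof -
  have main: "\<bar>T q f x - T p f x\<bar> \<le> c" if "0 \<le> p" "p < q" "q - p < d" for p q
  proof -
    have "T q f = T p (T (q - p) f)"
      using T_add[of p "q - p" f] that assms(1) by simp
    then show ?thesis
      using T_diff_bound[of p "T (q - p) f" f c x] T_C0 assms(1) d[of "q - p"] that by simp
  qed
  show ?thesis
  proof (cases s t rule: linorder_cases)
    case less
    then show ?thesis using main[of s t] assms by (simp add: abs_minus_commute)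
  next
    case equal
    then show ?thesis using assms by simp
  next
    case greater
    then show ?thesis using main[of t s] assms by simp
  qed
qed

lemma T_equicontinuous:
  assumes "f \<in> C0" and "0 < \<epsilon>"
  obtains d where "0 < d"
    "\<And>s t x. 0 \<le> s \<Longrightarrow> 0 \<le> t \<Longrightarrow> \<bar>s - t\<bar> < d \<Longrightarrow> \<bar>T s f x - T t f x\<bar> \<le> \<epsilon>"
proof -
  have "\<forall>\<^sub>F t in at_right 0. \<forall>x\<in>UNIV. dist (T t f x) (f x) < \<epsilon>"
    using T_strongly_continuous[OF assms(1)] assms(2) by (rule uniform_limitD)
  then obtain d where d: "0 < d" "\<And>r x. 0 < r \<Longrightarrow> r < d \<Longrightarrow> \<bar>T r f x - f x\<bar> < \<epsilon>"
    unfolding eventually_at_right_field by (auto simp: dist_real_def)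
  show thesis
    by (rule that[OF d(1)], rule T_increment[OF assms(1) d(1)])
      (use d(2) assms(2) in \<open>auto intro: less_imp_le\<close>)
qed

text \<open>Over a short step the increment is nearly the step length times \<open>g\<close>; contractivity lets the
  bounds of many short steps add up.\<close>

lemma T_generator_bound:
  assumes fg: "(f, g) \<in> generator T" and B: "\<And>x. \<bar>g x\<bar> \<le> B" and "0 \<le> t"
  shows "\<bar>T t f x - f x\<bar> \<le> t * B"
proof (cases "t = 0")
  case True
  then show ?thesis
    using fg T_0[of f] by (simp add: generator_def)
next
  case False
  have f: "f \<in> C0"
    using fg by (simp add: generator_def)
  have lim: "uniform_limit UNIV (\<lambda>t x. (T t f x - f x) / t) g (at_right 0)"
    using fg by (simp add: generator_def)
  have "\<bar>T t f x - f x\<bar> \<le> t * (B + \<epsilon>)" if "0 < \<epsilon>" for \<epsilon>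
  proof -
    have "\<forall>\<^sub>F s in at_right 0. \<forall>x\<in>UNIV. dist ((T s f x - f x) / s) (g x) < \<epsilon>"
      using lim that by (rule uniform_limitD)
    then obtain d where d: "0 < d"
      "\<And>s x. 0 < s \<Longrightarrow> s < d \<Longrightarrow> \<bar>(T s f x - f x) / s - g x\<bar> < \<epsilon>"
      unfolding eventually_at_right_field by (auto simp: dist_real_def)
    obtain n :: nat where n: "t / d < n"
      using reals_Archimedean2 by blast
    have "0 < t" using \<open>0 \<le> t\<close> False by simp
    then have "0 < n" using n d(1) by (metis divide_pos_pos less_trans of_nat_0_less_iff)
    define s where "s = t / n"
    have s: "0 < s" "s < d" "n * s = t"
      using \<open>0 < t\<close> \<open>0 < n\<close> n d(1) by (auto simp: s_def field_simps)
    have step: "\<bar>T s f y - f y\<bar> \<le> s * (B + \<epsilon>)" for y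
    proof -
      have "\<bar>(T s f y - f y) / s\<bar> \<le> B + \<epsilon>"
        using d(2)[OF s(1,2), of y] B[of y] by linarith
      then show ?thesis
        using s(1) by (simp add: abs_divide pos_divide_le_eq mult.commute)
    qed
    have "\<bar>T (j * s) f x - f x\<bar> \<le> j * (s * (B + \<epsilon>))" for j :: nat
    proof (induction j)
      case 0
      then show ?case by (simp add: T_0 f)
    next
      case (Suc j)
      have "T (Suc j * s) f = T (j * s) (T s f)"
        using T_add[of "j * s" s f] s(1) f by (simp add: algebra_simps)
      then have "\<bar>T (Suc j * s) f x - T (j * s) f x\<bar> \<le> s * (B + \<epsilon>)"
        using T_diff_bound[of "j * s" "T s f" f] T_C0 f step s(1) by simp
      then have "\<bar>T (Suc j * s) f x - f x\<bar> \<le> s * (B + \<epsilon>) + j * (s * (B + \<epsilon>))"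
        using Suc by linarith
      then show ?case by (simp add: algebra_simps)
    qed
    from this[of n] show ?thesis
      using s(3) by (metis mult.assoc)
  qed
  then have "\<forall>\<^sub>F \<epsilon> in at_right 0. \<bar>T t f x - f x\<bar> \<le> t * (B + \<epsilon>)"
    by (intro eventually_mono[OF eventually_at_right_less[of 0]])
  moreover have "((\<lambda>\<epsilon>. t * (B + \<epsilon>)) \<longlongrightarrow> t * (B + 0)) (at_right 0)"
    by (intro tendsto_intros)
  ultimately have "\<bar>T t f x - f x\<bar> \<le> t * (B + 0)"
    by (intro tendsto_lowerbound) auto
  then show ?thesis by simp
qed

text \<open>Times are clipped at \<open>0\<close>, because nothing is known about \<open>T s\<close> for negative \<open>s\<close> and continuity
  on the whole line is convenient for measurability.\<close>

lemma T_jointly_continuous: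
  assumes "f \<in> C0"
  shows "continuous_on UNIV (\<lambda>(s, x). T (max 0 s) f x)"
proof -
  have "continuous (at z) (\<lambda>(s, x). T (max 0 s) f x)" for z :: "real \<times> 'a"
  proof -
    obtain s0 x0 where z: "z = (s0, x0)" by (cases z)
    show ?thesis
      unfolding continuous_at tendsto_iff
    proof (intro allI impI)
      fix \<epsilon> :: real assume "0 < \<epsilon>"
      then have "0 < \<epsilon> / 2" by simp
      then obtain d where d: "0 < d"
        "\<And>s t x. 0 \<le> s \<Longrightarrow> 0 \<le> t \<Longrightarrow> \<bar>s - t\<bar> < d \<Longrightarrow> \<bar>T s f x - T t f x\<bar> \<le> \<epsilon> / 2"
        using T_equicontinuous[OF assms] by metis
      have "isCont (T (max 0 s0) f) x0"
        using T_C0[OF _ assms, of "max 0 s0"]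
        by (simp add: C0_def continuous_on_eq_continuous_at)
      then have "((\<lambda>y. T (max 0 s0) f (snd y)) \<longlongrightarrow> T (max 0 s0) f x0) (at z)"
        by (rule isCont_tendsto_compose) (auto intro!: tendsto_eq_intros simp: z)
      then have "\<forall>\<^sub>F y in at z. dist (T (max 0 s0) f (snd y)) (T (max 0 s0) f x0) < \<epsilon> / 2"
        using \<open>0 < \<epsilon> / 2\<close> by (rule tendstoD)
      moreover have "((\<lambda>y. fst y) \<longlongrightarrow> s0) (at z)"
        by (auto intro!: tendsto_eq_intros simp: z)
      then have "\<forall>\<^sub>F y in at z. dist (fst y) s0 < d"
        using d(1) by (rule tendstoD)
      ultimately show "\<forall>\<^sub>F y in at z. dist (case y of (s, x) \<Rightarrow> T (max 0 s) f x)
          (case z of (s, x) \<Rightarrow> T (max 0 s) f x) < \<epsilon>"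
      proof eventually_elim
        case (elim y)
        have "\<bar>max 0 (fst y) - max 0 s0\<bar> < d"
          using elim(2) by (auto simp: dist_real_def max_def)
        then have "\<bar>T (max 0 (fst y)) f (snd y) - T (max 0 s0) f (snd y)\<bar> \<le> \<epsilon> / 2"
          by (intro d(2)) auto
        then show ?case
          using elim(1) unfolding z dist_real_def split_beta fst_conv snd_conv by linarith
      qed
    qed
  qed
  then show ?thesis
    by (simp add: continuous_at_imp_continuous_on)
qed

lemma T_continuous_in_time:
  assumes "f \<in> C0"
  shows "continuous_on UNIV (\<lambda>s. T (max 0 s) f x)"
proof -
  have "continuous_on UNIV (\<lambda>s. (s, x))"
    by (intro continuous_intros)
  from continuous_on_compose2[OF T_jointly_continuous[OF assms] this] show ?thesis
    by simp
qed

lemma T_continuous_on_nonneg: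
  assumes "f \<in> C0" and "A \<subseteq> {0..}"
  shows "continuous_on A (\<lambda>s. T s f x)"
  by (rule continuous_on_eq[OF continuous_on_subset[OF T_continuous_in_time[OF assms(1)]]])
    (use assms(2) in \<open>auto simp: max_def subset_iff\<close>)

text \<open>Sampling finitely many times, by equicontinuity, shows that decay at infinity is uniform
  over bounded time intervals.\<close>

lemma T_vanishes_uniformly:
  assumes f: "f \<in> C0" and "0 < \<epsilon>" and "0 < N"
  shows "\<forall>\<^sub>F x in at_infinity. \<forall>s\<in>{0..N}. \<bar>T s f x\<bar> \<le> \<epsilon>"
proof -
  have "0 < \<epsilon> / 2" using \<open>0 < \<epsilon>\<close> by simp
  then obtain d where d: "0 < d"
    "\<And>s t x. 0 \<le> s \<Longrightarrow> 0 \<le> t \<Longrightarrow> \<bar>s - t\<bar> < d \<Longrightarrow> \<bar>T s f x - T t f x\<bar> \<le> \<epsilon> / 2"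
    using T_equicontinuous[OF f] by metis
  define c where "c = d / 2"
  have c: "0 < c" "c < d" using d(1) by (auto simp: c_def)
  define n where "n = nat \<lfloor>N / c\<rfloor>"
  have "\<forall>\<^sub>F x in at_infinity. \<forall>i\<in>{..n}. \<bar>T (i * c) f x\<bar> < \<epsilon> / 2"
  proof (subst eventually_ball_finite_distrib, simp, intro ballI)
    fix i assume "i \<in> {..n}"
    have "T (i * c) f \<in> C0"
      using c(1) by (intro T_C0 f) simp
    then have "(T (i * c) f \<longlongrightarrow> 0) at_infinity"
      by (simp add: C0_def)
    then show "\<forall>\<^sub>F x in at_infinity. \<bar>T (i * c) f x\<bar> < \<epsilon> / 2"
      using tendstoD[OF _ \<open>0 < \<epsilon> / 2\<close>] by (fastforce simp: dist_real_def)
  qed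
  then show ?thesis
  proof eventually_elim
    case (elim x)
    show ?case
    proof
      fix s assume s: "s \<in> {0..N}"
      define i where "i = nat \<lfloor>s / c\<rfloor>"
      have "\<lfloor>s / c\<rfloor> \<le> \<lfloor>N / c\<rfloor>"
        using s c(1) by (intro floor_mono divide_right_mono) auto
      then have "i \<le> n" by (simp add: i_def n_def nat_mono)
      have "real i = of_int \<lfloor>s / c\<rfloor>"
        using s c(1) by (simp add: i_def)
      then have "real i \<le> s / c" "s / c < real i + 1"
        by linarith+
      then have "i * c \<le> s" "s < i * c + c"
        using c(1) by (auto simp: field_simps)
      then have "\<bar>T s f x - T (i * c) f x\<bar> \<le> \<epsilon> / 2"
        using s c by (intro d(2)) auto
      moreover have "\<bar>T (i * c) f x\<bar> < \<epsilon> / 2"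
        using elim \<open>i \<le> n\<close> by simp
      ultimately show "\<bar>T s f x\<bar> \<le> \<epsilon>"
        by linarith
    qed
  qed
qed

end

locale feller_kernel = feller T for T :: "real \<Rightarrow> ('a::euclidean_space \<Rightarrow> real) \<Rightarrow> ('a \<Rightarrow> real)" +
  fixes P :: "real \<Rightarrow> 'a \<Rightarrow> 'a measure"
  assumes kernel: "transition_kernel T P"
begin

lemma P_subprob: "0 \<le> t \<Longrightarrow> P t x \<in> space (subprob_algebra borel)"
  using kernel unfolding transition_kernel_def
  by (metis UNIV_I measurable_space space_borel)

lemma sets_P: "0 \<le> t \<Longrightarrow> sets (P t x) = sets borel"
  using P_subprob by (simp add: space_subprob_algebra)

lemma subprob_space_P: "0 \<le> t \<Longrightarrow> subprob_space (P t x)"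
  using P_subprob by (simp add: space_subprob_algebra)

lemma finite_measure_P: "0 \<le> t \<Longrightarrow> finite_measure (P t x)"
  using subprob_space_P by (simp add: subprob_space_def)

lemma T_eq_integral: "0 \<le> t \<Longrightarrow> f \<in> C0 \<Longrightarrow> T t f x = (\<integral>y. f y \<partial>(P t x))"
  using kernel by (simp add: transition_kernel_def)

definition time_integral :: "real \<Rightarrow> ('a \<Rightarrow> real) \<Rightarrow> 'a \<Rightarrow> real" where
  "time_integral N f x = integral {0..N} (\<lambda>s. T s f x)"

lemma T_integrable_on:
  assumes "f \<in> C0" "0 \<le> a"
  shows "(\<lambda>s. T s f x) integrable_on {a..b}"
  using assms by (intro integrable_continuous_interval T_continuous_on_nonneg) auto

lemma time_integral_C0:
  assumes f: "f \<in> C0" and "0 < N"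
  shows "time_integral N f \<in> C0"
  unfolding C0_def
proof (intro CollectI conjI)
  have "continuous_on (UNIV \<times> cbox 0 N) (\<lambda>(x, s). T (max 0 s) f x)"
  proof -
    have "continuous_on (UNIV \<times> cbox 0 N) (\<lambda>z :: 'a \<times> real. (snd z, fst z))"
      by (intro continuous_intros)
    from continuous_on_compose2[OF T_jointly_continuous[OF f] this] show ?thesis
      by (simp add: split_beta)
  qed
  then have "continuous_on UNIV (\<lambda>x. integral (cbox 0 N) (\<lambda>s. T (max 0 s) f x))"
    by (rule integral_continuous_on_param)
  moreover have "integral (cbox 0 N) (\<lambda>s. T (max 0 s) f x) = time_integral N f x" for x
    unfolding time_integral_def by (auto intro!: integral_cong simp: max_def)
  ultimately show "continuous_on UNIV (time_integral N f)" by simp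
  show "(time_integral N f \<longlongrightarrow> 0) at_infinity"
    unfolding tendsto_iff
  proof (intro allI impI)
    fix \<epsilon> :: real assume "0 < \<epsilon>"
    define \<eta> where "\<eta> = \<epsilon> / (2 * N)"
    have "0 < \<eta>" "\<eta> * N < \<epsilon>"
      using \<open>0 < \<epsilon>\<close> \<open>0 < N\<close> by (auto simp: \<eta>_def)
    from T_vanishes_uniformly[OF f this(1) \<open>0 < N\<close>]
    show "\<forall>\<^sub>F x in at_infinity. dist (time_integral N f x) 0 < \<epsilon>"
    proof eventually_elim
      case (elim x)
      have "norm (integral {0..N} (\<lambda>s. T s f x)) \<le> \<eta> * (N - 0)"
        using elim \<open>0 < N\<close> by (intro integral_bound T_continuous_on_nonneg f) auto
      then show ?case
        using \<open>\<eta> * N < \<epsilon>\<close> by (simp add: time_integral_def)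
    qed
  qed
qed

lemma time_integral_eq_lebesgue:
  assumes "f \<in> C0"
  shows "time_integral N f x = (\<integral>s. indicator {0..N} s *\<^sub>R T (max 0 s) f x \<partial>lborel)"
proof -
  have "set_integrable lborel {0..N} (\<lambda>s. T (max 0 s) f x)"
    by (intro borel_integrable_atLeastAtMost' continuous_on_subset[OF T_continuous_in_time[OF assms]])
      simp
  from set_borel_integral_eq_integral(2)[OF this]
  have "(\<integral>s. indicator {0..N} s *\<^sub>R T (max 0 s) f x \<partial>lborel)
      = integral {0..N} (\<lambda>s. T (max 0 s) f x)"
    by (simp add: set_lebesgue_integral_def)
  then show ?thesis
    unfolding time_integral_def by (auto intro!: integral_cong simp: max_def)
qed

text \<open>The operator passes under the time integral by Fubini's theorem for the kernel.\<close>

lemma T_time_integral: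
  assumes f: "f \<in> C0" and "0 < N" and "0 \<le> h"
  shows "T h (time_integral N f) x = integral {0..N} (\<lambda>s. T (h + s) f x)"
proof -
  interpret Ph: finite_measure "P h x"
    using \<open>0 \<le> h\<close> by (rule finite_measure_P)
  interpret pair_sigma_finite lborel "P h x" ..
  obtain B where B: "0 \<le> B" "\<And>x. \<bar>f x\<bar> \<le> B"
    using C0_bounded[OF f] by metis
  have sets: "sets (lborel \<Otimes>\<^sub>M P h x) = sets (borel :: (real \<times> 'a) measure)"
    using sets_P[OF \<open>0 \<le> h\<close>] by (simp add: borel_prod[symmetric] cong: sets_pair_measure_cong)
  have meas: "(\<lambda>(s, y). T (max 0 s) f y) \<in> borel_measurable (lborel \<Otimes>\<^sub>M P h x)"
    using borel_measurable_continuous_onI[OF T_jointly_continuous[OF f]]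
    by (simp add: measurable_cong_sets[OF sets refl])
  have "{0..N} \<times> UNIV \<in> sets (lborel \<Otimes>\<^sub>M P h x)"
    using sets_P[OF \<open>0 \<le> h\<close>] by (intro pair_measureI) auto
  moreover have "emeasure (lborel \<Otimes>\<^sub>M P h x) ({0..N} \<times> UNIV) < \<infinity>"
  proof -
    have "emeasure (lborel \<Otimes>\<^sub>M P h x) ({0..N} \<times> UNIV)
        = emeasure lborel {0..N} * emeasure (P h x) UNIV"
      using sets_P[OF \<open>0 \<le> h\<close>] by (intro Ph.emeasure_pair_measure_Times) auto
    then show ?thesis
      using \<open>0 < N\<close> Ph.emeasure_finite[of UNIV]
      by (simp add: less_top[symmetric] ennreal_mult_eq_top_iff)
  qed
  ultimately have int: "integrable (lborel \<Otimes>\<^sub>M P h x)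
      (\<lambda>z. indicator ({0..N} \<times> UNIV) z *\<^sub>R (case z of (s, y) \<Rightarrow> T (max 0 s) f y))"
    using T_contraction[OF _ f B(2)]
    by (intro integrableI_bounded_set_indicator[where B = B] meas) (auto split: prod.split)
  then have int': "integrable (lborel \<Otimes>\<^sub>M P h x)
      (\<lambda>(s, y). indicator {0..N} s *\<^sub>R T (max 0 s) f y)"
    by (rule Bochner_Integration.integrable_cong[THEN iffD1, rotated -1])
      (auto simp: indicator_def split: prod.split)
  have "T h (time_integral N f) x = (\<integral>y. time_integral N f y \<partial>(P h x))"
    using \<open>0 \<le> h\<close> by (intro T_eq_integral time_integral_C0 assms)
  also have "\<dots> = (\<integral>y. (\<integral>s. indicator {0..N} s *\<^sub>R T (max 0 s) f y \<partial>lborel) \<partial>(P h x))"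
    by (simp only: time_integral_eq_lebesgue[OF f])
  also have "\<dots> = (\<integral>s. (\<integral>y. indicator {0..N} s *\<^sub>R T (max 0 s) f y \<partial>(P h x)) \<partial>lborel)"
    using Fubini_integral[OF int'] by simp
  also have "\<dots> = (\<integral>s. indicator {0..N} s *\<^sub>R T (max 0 s) (T h f) x \<partial>lborel)"
  proof (intro Bochner_Integration.integral_cong refl)
    fix s
    have "(\<integral>y. T (max 0 s) f y \<partial>(P h x)) = T h (T (max 0 s) f) x"
      using \<open>0 \<le> h\<close> by (intro T_eq_integral[symmetric] T_C0 f) auto
    also have "\<dots> = T (max 0 s) (T h f) x"
      using T_add[of h "max 0 s" f] T_add[of "max 0 s" h f] \<open>0 \<le> h\<close> f by (simp add: add.commute)
    finally show "(\<integral>y. indicator {0..N} s *\<^sub>R T (max 0 s) f y \<partial>(P h x))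
        = indicator {0..N} s *\<^sub>R T (max 0 s) (T h f) x" by simp
  qed
  also have "\<dots> = time_integral N (T h f) x"
    using time_integral_eq_lebesgue[OF T_C0[OF \<open>0 \<le> h\<close> f]] by simp
  also have "\<dots> = integral {0..N} (\<lambda>s. T (h + s) f x)"
    unfolding time_integral_def
    using T_add[of _ h f] \<open>0 \<le> h\<close> f by (auto intro!: integral_cong simp: add.commute)
  finally show ?thesis .
qed

lemma short_time_average:
  assumes f: "f \<in> C0" and "0 \<le> a" "0 < h"
    and d: "\<And>s. a \<le> s \<Longrightarrow> s \<le> a + h \<Longrightarrow> \<bar>T s f x - T a f x\<bar> \<le> \<epsilon>"
  shows "\<bar>integral {a..a + h} (\<lambda>s. T s f x) - h * T a f x\<bar> \<le> \<epsilon> * h"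
proof -
  have "integral {a..a + h} (\<lambda>s. T s f x - T a f x)
      = integral {a..a + h} (\<lambda>s. T s f x) - h * T a f x"
    using \<open>0 < h\<close>
    by (subst Henstock_Kurzweil_Integration.integral_diff[OF T_integrable_on[OF f \<open>0 \<le> a\<close>]]) auto
  moreover have "norm (integral {a..a + h} (\<lambda>s. T s f x - T a f x)) \<le> \<epsilon> * (a + h - a)"
    using assms by (intro integral_bound continuous_intros T_continuous_on_nonneg) auto
  ultimately show ?thesis by simp
qed

text \<open>Translating the window of integration by \<open>h\<close> changes the integral only near its two ends, and
  there the integrand is nearly \<open>T N f\<close> and \<open>f\<close>.\<close>

theorem time_integral_generator:
  assumes f: "f \<in> C0" and "0 < N"
  shows "(time_integral N f, \<lambda>x. T N f x - f x) \<in> generator T"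
proof -
  have TN: "T N f \<in> C0"
    using \<open>0 < N\<close> by (intro T_C0 f) simp
  have "(\<lambda>x. T N f x - f x) \<in> C0"
    using TN f unfolding C0_def by (auto intro!: continuous_intros tendsto_eq_intros)
  moreover have "uniform_limit UNIV
      (\<lambda>h x. (T h (time_integral N f) x - time_integral N f x) / h) (\<lambda>x. T N f x - f x) (at_right 0)"
  proof (rule uniform_limitI)
    fix \<epsilon> :: real assume "0 < \<epsilon>"
    then have "0 < \<epsilon> / 3" by simp
    then obtain d where d: "0 < d"
      "\<And>s t x. 0 \<le> s \<Longrightarrow> 0 \<le> t \<Longrightarrow> \<bar>s - t\<bar> < d \<Longrightarrow> \<bar>T s f x - T t f x\<bar> \<le> \<epsilon> / 3"
      using T_equicontinuous[OF f] by metis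
    have "dist ((T h (time_integral N f) x - time_integral N f x) / h) (T N f x - f x) < \<epsilon>"
      if h: "0 < h" "h < d" for h x
    proof -
      let ?I = "\<lambda>a b. integral {a..b} (\<lambda>s. T s f x)"
      have shift: "integral {0..N} (\<lambda>s. T (h + s) f x) = ?I h (N + h)"
        using integral_shift_Icc_real[of 0 N "\<lambda>s. T s f x" h] by (simp add: o_def)
      have "?I 0 h + ?I h (N + h) = ?I 0 (N + h)"
        using h \<open>0 < N\<close> by (intro Henstock_Kurzweil_Integration.integral_combine T_integrable_on f) auto
      moreover have "?I 0 N + ?I N (N + h) = ?I 0 (N + h)"
        using h \<open>0 < N\<close> by (intro Henstock_Kurzweil_Integration.integral_combine T_integrable_on f) auto
      ultimately have increment: "T h (time_integral N f) x - time_integral N f x = ?I N (N + h) - ?I 0 (0 + h)"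
        using T_time_integral[OF f \<open>0 < N\<close>, of h x] h shift by (simp add: time_integral_def)
      have "\<bar>?I N (N + h) - h * T N f x\<bar> \<le> \<epsilon> / 3 * h"
        using h \<open>0 < N\<close> by (intro short_time_average f d(2)) auto
      moreover have "\<bar>?I 0 (0 + h) - h * T 0 f x\<bar> \<le> \<epsilon> / 3 * h"
        using h by (intro short_time_average f d(2)) auto
      moreover have "\<bar>a - b\<bar> \<le> \<epsilon> * (2 / 3) * h"
        if "\<bar>a\<bar> \<le> \<epsilon> / 3 * h" "\<bar>b\<bar> \<le> \<epsilon> / 3 * h" for a b
        using that abs_triangle_ineq4[of a b] by simp
      ultimately have "\<bar>?I N (N + h) - h * T N f x - (?I 0 (0 + h) - h * T 0 f x)\<bar>
          \<le> \<epsilon> * (2 / 3) * h"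
        by blast
      also have "?I N (N + h) - h * T N f x - (?I 0 (0 + h) - h * T 0 f x)
          = (T h (time_integral N f) x - time_integral N f x) - h * (T N f x - f x)"
        unfolding increment T_0[OF f] right_diff_distrib by simp
      finally have "\<bar>(T h (time_integral N f) x - time_integral N f x) - h * (T N f x - f x)\<bar>
          \<le> \<epsilon> * (2 / 3) * h" .
      moreover have "(T h (time_integral N f) x - time_integral N f x) / h - (T N f x - f x)
          = ((T h (time_integral N f) x - time_integral N f x) - h * (T N f x - f x)) / h"
        using h by (simp add: field_simps)
      ultimately have "\<bar>(T h (time_integral N f) x - time_integral N f x) / h - (T N f x - f x)\<bar>
          \<le> \<epsilon> * (2 / 3)"
        using h by (simp add: abs_divide pos_divide_le_eq)
      then show ?thesis
        using \<open>0 < \<epsilon>\<close> by (simp add: dist_real_def)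
    qed
    then show "\<forall>\<^sub>F h in at_right 0. \<forall>x\<in>UNIV.
        dist ((T h (time_integral N f) x - time_integral N f x) / h) (T N f x - f x) < \<epsilon>"
      using d(1) by (auto simp: eventually_at_right_field intro!: exI[of _ d])
  qed
  ultimately show ?thesis
    using time_integral_C0[OF f \<open>0 < N\<close>] by (simp add: generator_def)
qed

end

section \<open>Approximation by functions vanishing at infinity\<close>

lemma C0_scaleR_add:
  assumes "f \<in> C0" and "g \<in> C0"
  shows "(\<lambda>x. a * f x + b * g x) \<in> C0"
  using assms unfolding C0_def by (auto intro!: continuous_intros tendsto_eq_intros)

lemma C0_approximates_box:
  fixes a b :: "'a::euclidean_space"
  obtains g :: "nat \<Rightarrow> 'a \<Rightarrow> real" where "\<And>n. g n \<in> C0" "\<And>n x. 0 \<le> g n x \<and> g n x \<le> 1"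
    "\<And>x. (\<lambda>n. g n x) \<longlonglongrightarrow> indicator (box a b) x"
proof -
  define g where "g n x = min 1 (real n * infdist x (- box a b))" for n x
  obtain r where r: "box a b \<subseteq> ball 0 r"
    using bounded_subset_ballD[OF bounded_box, of a b 0] by auto
  have ne: "- box a b \<noteq> {}"
    using bounded_box[of a b] not_bounded_UNIV by (metis Compl_UNIV_eq double_compl)
  have outside: "g n x = 0" if "x \<notin> box a b" for n x
    using that by (simp add: g_def)
  have "g n \<in> C0" for n
  proof (rule compact_support_C0[of _ r])
    show "continuous_on UNIV (g n)"
      unfolding g_def by (intro continuous_intros)
    show "g n x = 0" if "r \<le> norm x" for x
      using that r by (intro outside) auto
  qed
  moreover have "0 \<le> g n x \<and> g n x \<le> 1" for n x
    by (simp add: g_def infdist_nonneg)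
  moreover have "(\<lambda>n. g n x) \<longlonglongrightarrow> indicator (box a b) x" for x
  proof (cases "x \<in> box a b")
    case True
    have "infdist x (- box a b) \<noteq> 0"
      using in_closed_iff_infdist_zero[of "- box a b" x] ne True
      by (simp add: open_box closed_Compl)
    then have "0 < infdist x (- box a b)"
      using infdist_nonneg[of x "- box a b"] by simp
    then obtain m :: nat where m: "1 / infdist x (- box a b) < m"
      using reals_Archimedean2 by blast
    have "\<forall>\<^sub>F n in sequentially. g n x = 1"
      using eventually_ge_at_top[of m]
    proof eventually_elim
      case (elim n)
      have "1 < m * infdist x (- box a b)"
        using m \<open>0 < infdist x (- box a b)\<close> by (simp add: pos_divide_less_eq)
      also have "\<dots> \<le> n * infdist x (- box a b)"
        using elim \<open>0 < infdist x (- box a b)\<close> by (intro mult_right_mono) auto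
      finally show ?case by (simp add: g_def)
    qed
    then show ?thesis
      using True by (simp add: tendsto_eventually)
  next
    case False
    then show ?thesis by (simp add: outside)
  qed
  ultimately show thesis using that by blast
qed

lemma C0_approximates_one:
  obtains g :: "nat \<Rightarrow> 'a::euclidean_space \<Rightarrow> real" where "\<And>n. g n \<in> C0"
    "\<And>n x. 0 \<le> g n x \<and> g n x \<le> 1" "\<And>x. (\<lambda>n. g n x) \<longlonglongrightarrow> 1"
proof -
  define g where "g n x = max 0 (min 1 (real n - norm x))" for n and x :: 'a
  have "g n \<in> C0" for n
    by (rule compact_support_C0[of _ "real n"]) (auto simp: g_def intro!: continuous_intros)
  moreover have "(\<lambda>n. g n x) \<longlonglongrightarrow> 1" for x
  proof -
    obtain m :: nat where "norm x + 1 < m"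
      using reals_Archimedean2 by blast
    then have "\<forall>\<^sub>F n in sequentially. g n x = 1"
      by (intro eventually_mono[OF eventually_ge_at_top[of m]]) (auto simp: g_def)
    then show ?thesis by (simp add: tendsto_eventually)
  qed
  moreover have "0 \<le> g n x \<and> g n x \<le> 1" for n x
    by (simp add: g_def)
  ultimately show thesis using that by blast
qed

text \<open>The approximation must hold in finitely many measures simultaneously, one for each point of
  two Weyl orbits.\<close>

locale finite_measure_family =
  fixes I :: "'i set" and \<mu> :: "'i \<Rightarrow> 'a::euclidean_space measure"
  assumes finite_I: "finite I"
    and fin: "\<And>i. i \<in> I \<Longrightarrow> finite_measure (\<mu> i)"
    and sets_mu: "\<And>i. i \<in> I \<Longrightarrow> sets (\<mu> i) = sets borel"
begin

lemma borel_measurable_mu: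
  assumes "i \<in> I" and "f \<in> borel_measurable borel"
  shows "f \<in> borel_measurable (\<mu> i)"
  by (subst measurable_cong_sets[OF sets_mu[OF assms(1)] refl]) (rule assms(2))

lemma integrable_mu:
  fixes f :: "'a \<Rightarrow> real"
  assumes "i \<in> I" and "f \<in> borel_measurable borel" and "\<And>x. \<bar>f x\<bar> \<le> B"
  shows "integrable (\<mu> i) f"
  by (rule finite_measure.integrable_const_bound[OF fin[OF assms(1)], of f B])
    (use assms(3) borel_measurable_mu[OF assms(1,2)] in auto)

definition L1_approximable :: "('a \<Rightarrow> real) \<Rightarrow> bool" where
  "L1_approximable h \<longleftrightarrow> (\<forall>\<epsilon>>0. \<exists>f\<in>C0. \<forall>i\<in>I. (\<integral>x. \<bar>h x - f x\<bar> \<partial>(\<mu> i)) < \<epsilon>)"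

lemma integral_abs_diff_triangle:
  fixes u v w :: "'a \<Rightarrow> real"
  assumes "i \<in> I"
    and "u \<in> borel_measurable borel" "\<And>x. \<bar>u x\<bar> \<le> A"
    and "v \<in> borel_measurable borel" "\<And>x. \<bar>v x\<bar> \<le> B"
    and "w \<in> borel_measurable borel" "\<And>x. \<bar>w x\<bar> \<le> C"
  shows "(\<integral>x. \<bar>u x - w x\<bar> \<partial>(\<mu> i)) \<le> (\<integral>x. \<bar>u x - v x\<bar> \<partial>(\<mu> i)) + (\<integral>x. \<bar>v x - w x\<bar> \<partial>(\<mu> i))"
proof -
  have int: "integrable (\<mu> i) u" "integrable (\<mu> i) v" "integrable (\<mu> i) w"
    using integrable_mu[OF assms(1-3)] integrable_mu[OF assms(1,4,5)] integrable_mu[OF assms(1,6,7)]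
    by this+
  have "(\<integral>x. \<bar>u x - w x\<bar> \<partial>(\<mu> i)) \<le> (\<integral>x. \<bar>u x - v x\<bar> + \<bar>v x - w x\<bar> \<partial>(\<mu> i))"
    using int by (intro Bochner_Integration.integral_mono) auto
  also have "\<dots> = (\<integral>x. \<bar>u x - v x\<bar> \<partial>(\<mu> i)) + (\<integral>x. \<bar>v x - w x\<bar> \<partial>(\<mu> i))"
    using int by (intro Bochner_Integration.integral_add) auto
  finally show ?thesis .
qed

lemma C0_bounded_measurable:
  assumes "f \<in> C0"
  obtains B where "f \<in> borel_measurable borel" "\<And>x. \<bar>f x\<bar> \<le> B"
proof -
  obtain B where B: "0 \<le> B" "\<And>x. \<bar>f x\<bar> \<le> B"
    by (rule C0_bounded[OF assms], rule that, assumption+)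
  show thesis
    by (rule that[OF C0_measurable[OF assms] B(2)])
qed

lemma L1_approximable_limit:
  assumes lim: "\<And>x. (\<lambda>n. u n x) \<longlonglongrightarrow> h x"
    and u: "\<And>n. u n \<in> borel_measurable borel" "\<And>n x. \<bar>u n x\<bar> \<le> C"
    and approx: "\<And>n. L1_approximable (u n)"
  shows "L1_approximable h"
  unfolding L1_approximable_def
proof (intro allI impI)
  fix \<epsilon> :: real assume "0 < \<epsilon>"
  then have "0 < \<epsilon> / 2" by simp
  have h: "h \<in> borel_measurable borel"
    using borel_measurable_LIMSEQ_real[of borel u h] lim u(1) by auto
  have hC: "\<bar>h x\<bar> \<le> C" for x
    by (rule LIMSEQ_le_const2[OF tendsto_rabs[OF lim]]) (use u(2) in auto)
  have "(\<lambda>n. \<integral>x. \<bar>h x - u n x\<bar> \<partial>(\<mu> i)) \<longlonglongrightarrow> (\<integral>x. 0 \<partial>(\<mu> i))" if "i \<in> I" for i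
  proof (rule integral_dominated_convergence[where w = "\<lambda>_. 2 * C"])
    show "(\<lambda>_. 0) \<in> borel_measurable (\<mu> i)" by simp
    show "(\<lambda>x. \<bar>h x - u n x\<bar>) \<in> borel_measurable (\<mu> i)" for n
      using h u(1)[of n] by (intro borel_measurable_mu[OF that]) auto
    show "integrable (\<mu> i) (\<lambda>_. 2 * C)"
      by (rule integrable_mu[OF that, of _ "\<bar>2 * C\<bar>"]) auto
    show "AE x in \<mu> i. (\<lambda>n. \<bar>h x - u n x\<bar>) \<longlonglongrightarrow> 0"
      by (intro AE_I2 tendsto_rabs_zero) (auto intro!: tendsto_eq_intros lim)
    show "AE x in \<mu> i. norm \<bar>h x - u n x\<bar> \<le> 2 * C" for n
    proof (rule AE_I2)
      fix x show "norm \<bar>h x - u n x\<bar> \<le> 2 * C"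
        using hC[of x] u(2)[of n x] by simp
    qed
  qed
  from order_tendstoD(2)[OF this, of _ "\<epsilon> / 2"]
  have "\<forall>\<^sub>F n in sequentially. (\<integral>x. \<bar>h x - u n x\<bar> \<partial>(\<mu> i)) < \<epsilon> / 2" if "i \<in> I" for i
    using that \<open>0 < \<epsilon> / 2\<close> by simp
  then have "\<forall>\<^sub>F n in sequentially. \<forall>i\<in>I. (\<integral>x. \<bar>h x - u n x\<bar> \<partial>(\<mu> i)) < \<epsilon> / 2"
    by (intro eventually_ball_finite[OF finite_I] ballI)
  then obtain n where n: "\<And>i. i \<in> I \<Longrightarrow> (\<integral>x. \<bar>h x - u n x\<bar> \<partial>(\<mu> i)) < \<epsilon> / 2"
    by (auto simp: eventually_sequentially)
  obtain f where f: "f \<in> C0" "\<And>i. i \<in> I \<Longrightarrow> (\<integral>x. \<bar>u n x - f x\<bar> \<partial>(\<mu> i)) < \<epsilon> / 2"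
    using approx[of n] \<open>0 < \<epsilon> / 2\<close> unfolding L1_approximable_def by blast
  obtain B where B: "f \<in> borel_measurable borel" "\<And>x. \<bar>f x\<bar> \<le> B"
    by (rule C0_bounded_measurable[OF f(1)], rule that, assumption+)
  have "(\<integral>x. \<bar>h x - f x\<bar> \<partial>(\<mu> i)) < \<epsilon>" if "i \<in> I" for i
    using integral_abs_diff_triangle[OF that h hC u B, of n] n[OF that] f(2)[OF that] by linarith
  then show "\<exists>f\<in>C0. \<forall>i\<in>I. (\<integral>x. \<bar>h x - f x\<bar> \<partial>(\<mu> i)) < \<epsilon>"
    using f(1) by blast
qed

lemma L1_approximable_C0: "f \<in> C0 \<Longrightarrow> L1_approximable f"
  unfolding L1_approximable_def by (auto intro!: bexI[of _ f])

lemma L1_approximable_C0_limit: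
  assumes "\<And>n. g n \<in> C0" and "\<And>n x. 0 \<le> g n x \<and> g n x \<le> 1"
    and "\<And>x. (\<lambda>n. g n x) \<longlonglongrightarrow> h x"
  shows "L1_approximable h"
  by (rule L1_approximable_limit[where u = g and C = 1])
    (use assms in \<open>auto simp: C0_measurable L1_approximable_C0\<close>)

lemma L1_approximable_scale_add:
  assumes u: "L1_approximable u" "u \<in> borel_measurable borel" "\<And>x. \<bar>u x\<bar> \<le> A"
    and v: "L1_approximable v" "v \<in> borel_measurable borel" "\<And>x. \<bar>v x\<bar> \<le> B"
  shows "L1_approximable (\<lambda>x. a * u x + b * v x)"
  unfolding L1_approximable_def
proof (intro allI impI)
  fix \<epsilon> :: real assume "0 < \<epsilon>"
  define \<delta> where "\<delta> = \<epsilon> / (\<bar>a\<bar> + \<bar>b\<bar> + 1)"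
  have "0 < \<delta>" and \<delta>: "(\<bar>a\<bar> + \<bar>b\<bar> + 1) * \<delta> = \<epsilon>"
    using \<open>0 < \<epsilon>\<close> by (auto simp: \<delta>_def)
  obtain f where f: "f \<in> C0" "\<And>i. i \<in> I \<Longrightarrow> (\<integral>x. \<bar>u x - f x\<bar> \<partial>(\<mu> i)) < \<delta>"
    using u(1) \<open>0 < \<delta>\<close> unfolding L1_approximable_def by blast
  obtain g where g: "g \<in> C0" "\<And>i. i \<in> I \<Longrightarrow> (\<integral>x. \<bar>v x - g x\<bar> \<partial>(\<mu> i)) < \<delta>"
    using v(1) \<open>0 < \<delta>\<close> unfolding L1_approximable_def by blast
  obtain F where F: "f \<in> borel_measurable borel" "\<And>x. \<bar>f x\<bar> \<le> F"
    by (rule C0_bounded_measurable[OF f(1)], rule that, assumption+)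
  obtain G where G: "g \<in> borel_measurable borel" "\<And>x. \<bar>g x\<bar> \<le> G"
    by (rule C0_bounded_measurable[OF g(1)], rule that, assumption+)
  have "(\<integral>x. \<bar>(a * u x + b * v x) - (a * f x + b * g x)\<bar> \<partial>(\<mu> i)) < \<epsilon>" if i: "i \<in> I" for i
  proof -
    have int: "integrable (\<mu> i) u" "integrable (\<mu> i) v" "integrable (\<mu> i) f" "integrable (\<mu> i) g"
      using integrable_mu[OF i u(2,3)] integrable_mu[OF i v(2,3)] integrable_mu[OF i F]
        integrable_mu[OF i G] by blast+
    have "(\<integral>x. \<bar>(a * u x + b * v x) - (a * f x + b * g x)\<bar> \<partial>(\<mu> i))
        \<le> (\<integral>x. \<bar>a\<bar> * \<bar>u x - f x\<bar> + \<bar>b\<bar> * \<bar>v x - g x\<bar> \<partial>(\<mu> i))"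
    proof (rule Bochner_Integration.integral_mono)
      fix x
      have "(a * u x + b * v x) - (a * f x + b * g x) = a * (u x - f x) + b * (v x - g x)"
        by (simp add: algebra_simps)
      then show "\<bar>(a * u x + b * v x) - (a * f x + b * g x)\<bar>
          \<le> \<bar>a\<bar> * \<bar>u x - f x\<bar> + \<bar>b\<bar> * \<bar>v x - g x\<bar>"
        by (simp only: abs_mult[symmetric] abs_triangle_ineq)
    qed (use int in auto)
    also have "\<dots> = \<bar>a\<bar> * (\<integral>x. \<bar>u x - f x\<bar> \<partial>(\<mu> i)) + \<bar>b\<bar> * (\<integral>x. \<bar>v x - g x\<bar> \<partial>(\<mu> i))"
      using int by simp
    also have "\<dots> \<le> \<bar>a\<bar> * \<delta> + \<bar>b\<bar> * \<delta>"
      using f(2)[OF i] g(2)[OF i] by (intro add_mono mult_left_mono) auto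
    also have "\<dots> < \<epsilon>"
      using \<delta> \<open>0 < \<delta>\<close> by (simp add: algebra_simps)
    finally show ?thesis .
  qed
  then have "\<forall>i\<in>I. (\<integral>x. \<bar>(a * u x + b * v x) - (a * f x + b * g x)\<bar> \<partial>(\<mu> i)) < \<epsilon>"
    by (rule ballI)
  then show "\<exists>f\<in>C0. \<forall>i\<in>I. (\<integral>x. \<bar>(a * u x + b * v x) - f x\<bar> \<partial>(\<mu> i)) < \<epsilon>"
    by (rule bexI[where x = "\<lambda>x. a * f x + b * g x"]) (rule C0_scaleR_add[OF f(1) g(1)])
qed

lemma L1_approximable_one: "L1_approximable (\<lambda>x. 1)"
proof -
  obtain g :: "nat \<Rightarrow> 'a \<Rightarrow> real" where g: "\<And>n. g n \<in> C0" "\<And>n x. 0 \<le> g n x \<and> g n x \<le> 1"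
    "\<And>x. (\<lambda>n. g n x) \<longlonglongrightarrow> 1"
    by (rule C0_approximates_one, rule that, assumption+)
  then show ?thesis
    by (rule L1_approximable_C0_limit)
qed

lemma L1_approximable_indicator:
  assumes "A \<in> sets borel"
  shows "L1_approximable (indicator A)"
proof -
  have bound: "\<bar>indicator X x :: real\<bar> \<le> 1" for X and x :: 'a
    by (simp add: indicator_def)
  have zero: "L1_approximable (\<lambda>x. 0)"
    by (intro L1_approximable_C0) (simp add: C0_def)
  have sets_borel: "sets (borel :: 'a measure) = sigma_sets UNIV (range (\<lambda>(a, b). box a b))"
    by (subst borel_eq_box) (rule sets_measure_of, simp)
  have "Int_stable (range (\<lambda>(a, b). box a b :: 'a set))"
    by (auto simp: Int_stable_def box_Int_box)
  moreover have "range (\<lambda>(a, b). box a b :: 'a set) \<subseteq> Pow UNIV"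
    by simp
  moreover have "A \<in> sigma_sets UNIV (range (\<lambda>(a, b). box a b :: 'a set))"
    using assms unfolding sets_borel .
  ultimately show ?thesis
  proof (induction rule: sigma_sets_induct_disjoint)
    case (basic A)
    then obtain a b where A: "A = box a b" by auto
    obtain g :: "nat \<Rightarrow> 'a \<Rightarrow> real" where g: "\<And>n. g n \<in> C0" "\<And>n x. 0 \<le> g n x \<and> g n x \<le> 1"
      "\<And>x. (\<lambda>n. g n x) \<longlonglongrightarrow> indicator (box a b) x"
      by (rule C0_approximates_box[of a b], rule that, assumption+)
    then show ?case
      unfolding A by (rule L1_approximable_C0_limit)
  next
    case empty
    show ?case using zero by simp
  next
    case (compl A)
    have "A \<in> sets borel"
      using compl(1) unfolding sets_borel .
    then have "L1_approximable (\<lambda>x. 1 * 1 + (- 1) * indicator A x)"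
      using L1_approximable_scale_add[OF L1_approximable_one _ _ compl(2) _ bound, of 1 1 "- 1"]
      by simp
    moreover have "(\<lambda>x. 1 * 1 + (- 1) * indicator A x) = (indicator (UNIV - A) :: 'a \<Rightarrow> real)"
      by (rule ext) (simp add: indicator_def)
    ultimately show ?case by simp
  next
    case (union A)
    have meas: "A i \<in> sets borel" for i
      using union(2) unfolding sets_borel by blast
    have partial: "L1_approximable (indicator (\<Union>i<n. A i))" for n
    proof (induction n)
      case 0
      show ?case using zero by simp
    next
      case (Suc n)
      have "L1_approximable (\<lambda>x. 1 * indicator (\<Union>i<n. A i) x + 1 * indicator (A n) x)"
        using meas
        by (intro L1_approximable_scale_add[OF Suc _ bound union(3) _ bound]) auto
      moreover have "x \<notin> A n" if "x \<in> A i" "i < n" for x i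
      proof -
        have "A i \<inter> A n = {}"
          using union(1) that(2) by (simp add: disjoint_family_on_def)
        then show ?thesis using that(1) by blast
      qed
      then have "(\<lambda>x. 1 * indicator (\<Union>i<n. A i) x + 1 * indicator (A n) x)
          = (indicator (\<Union>i<Suc n. A i) :: 'a \<Rightarrow> real)"
        by (intro ext) (auto simp: indicator_def less_Suc_eq)
      ultimately show ?case by simp
    qed
    show ?case
    proof (rule L1_approximable_limit[OF _ _ _ partial, where C = 1])
      show "(\<lambda>n. indicator (\<Union>i<n. A i) x :: real) \<longlonglongrightarrow> indicator (\<Union>i. A i) x" for x
        by (rule LIMSEQ_indicator_UN)
      show "indicator (\<Union>i<n. A i) \<in> borel_measurable borel" for n
        using meas by auto
      show "\<bar>indicator (\<Union>i<n. A i) x :: real\<bar> \<le> 1" for n x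
        by (simp add: indicator_def)
    qed
  qed
qed

text \<open>Linear combinations and bounded pointwise limits of approximable functions are approximable,
  so a monotone class argument leads from indicators to all bounded Borel functions.\<close>

lemma L1_approximable_nonneg:
  assumes "h \<in> borel_measurable borel" and "\<And>x. 0 \<le> h x" and "\<And>x. h x \<le> B"
  shows "L1_approximable h"
proof -
  have "(\<exists>B. \<forall>x. h x \<le> B) \<longrightarrow> L1_approximable h"
    using assms(1,2)
  proof (induction rule: borel_measurable_induct_real)
    case (set A)
    then show ?case using L1_approximable_indicator by blast
  next
    case (mult u c)
    show ?case
    proof (cases "c = 0")
      case True
      then show ?thesis by (auto intro: L1_approximable_C0 simp: C0_def)
    next
      case False
      show ?thesis
      proof
        assume "\<exists>B. \<forall>x. c * u x \<le> B"
        then obtain B where B: "\<And>x. c * u x \<le> B" by blast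
        have u: "u x \<le> B / c" "0 \<le> u x" for x
          using B[of x] mult.hyps(1) mult.hyps(3)[of x] False by (auto simp: pos_le_divide_eq mult.commute)
        then have "L1_approximable u"
          using mult by blast
        with mult u have "L1_approximable (\<lambda>x. c * u x + 0 * u x)"
          by (intro L1_approximable_scale_add[where A = "B / c" and B = "B / c"]) (auto simp: abs_le_iff)
        then show "L1_approximable (\<lambda>x. c * u x)" by simp
      qed
    qed
  next
    case (add u v)
    show ?case
    proof
      assume "\<exists>B. \<forall>x. v x + u x \<le> B"
      then obtain B where B: "\<And>x. v x + u x \<le> B" by blast
      have uv: "u x \<le> B" "v x \<le> B" "0 \<le> u x" "0 \<le> v x" for x
        using B[of x] add.hyps(2)[of x] add.hyps(4)[of x] by auto
      then have "L1_approximable u" "L1_approximable v"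
        using add by blast+
      with add uv have "L1_approximable (\<lambda>x. 1 * v x + 1 * u x)"
        by (intro L1_approximable_scale_add[where A = B and B = B]) (auto simp: abs_le_iff)
      then show "L1_approximable (\<lambda>x. v x + u x)" by simp
    qed
  next
    case (seq U)
    show ?case
    proof
      assume "\<exists>B. \<forall>x. h x \<le> B"
      then obtain B where B: "\<And>x. h x \<le> B" by blast
      have lim: "(\<lambda>n. U n x) \<longlonglongrightarrow> h x" for x
        using seq.hyps(4) by simp
      have le: "U n x \<le> B" for n x
      proof -
        have "U n x \<le> h x"
        using incseq_le[OF _ lim, of x n] seq.hyps(3) by (simp add: incseq_def le_fun_def)
        then show ?thesis using B[of x] by simp
      qed
      have bd: "\<bar>U n x\<bar> \<le> B" for n x
        using seq.hyps(2)[of n x] le[of n x] by simp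
      then show "L1_approximable h"
        using seq.IH le
        by (intro L1_approximable_limit[OF lim seq.hyps(1) bd]) blast
    qed
  qed
  then show ?thesis using assms(3) by blast
qed

text \<open>Clipping at \<open>\<plusminus>B\<close> does not move an approximation away from \<open>h\<close>.\<close>

lemma bounded_measurable_L1_approximation:
  assumes h: "h \<in> borel_measurable borel" and B: "\<And>x. \<bar>h x\<bar> \<le> B" and "0 < \<epsilon>"
  obtains f where "f \<in> C0" "\<And>x. \<bar>f x\<bar> \<le> B" "\<And>i. i \<in> I \<Longrightarrow> (\<integral>x. \<bar>h x - f x\<bar> \<partial>(\<mu> i)) < \<epsilon>"
proof -
  have "0 \<le> B"
    using B[of undefined] by linarith
  have hB: "0 \<le> h x + B" "h x + B \<le> 2 * B" for x
    using B[of x] by auto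
  have "L1_approximable (\<lambda>x. h x + B)"
    using h hB by (intro L1_approximable_nonneg[where B = "2 * B"]) auto
  then have "L1_approximable (\<lambda>x. 1 * (h x + B) + (- B) * 1)"
    using h hB by (intro L1_approximable_scale_add[where A = "2 * B" and B = 1] L1_approximable_one) auto
  then have "L1_approximable h" by simp
  then obtain g where g: "g \<in> C0" "\<And>i. i \<in> I \<Longrightarrow> (\<integral>x. \<bar>h x - g x\<bar> \<partial>(\<mu> i)) < \<epsilon>"
    using \<open>0 < \<epsilon>\<close> unfolding L1_approximable_def by blast
  obtain G where G: "g \<in> borel_measurable borel" "\<And>x. \<bar>g x\<bar> \<le> G"
    by (rule C0_bounded_measurable[OF g(1)], rule that, assumption+)
  define f where "f x = max (- B) (min B (g x))" for x
  have f: "f \<in> C0"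
  proof -
    have "continuous_on UNIV f" "((\<lambda>x. max (- B) (min B (g x))) \<longlongrightarrow> max (- B) (min B 0)) at_infinity"
      using g(1) unfolding C0_def f_def by (auto intro!: continuous_intros tendsto_intros)
    then show ?thesis using \<open>0 \<le> B\<close> by (simp add: C0_def f_def[abs_def])
  qed
  have fB: "\<bar>f x\<bar> \<le> B" for x
    using \<open>0 \<le> B\<close> unfolding f_def by linarith
  have "(\<integral>x. \<bar>h x - f x\<bar> \<partial>(\<mu> i)) < \<epsilon>" if i: "i \<in> I" for i
  proof -
    have int: "integrable (\<mu> i) h" "integrable (\<mu> i) f" "integrable (\<mu> i) g"
      using integrable_mu[OF i h B] integrable_mu[OF i C0_measurable[OF \<open>f \<in> C0\<close>] fB]
        integrable_mu[OF i G] .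
    have closer: "\<bar>h x - f x\<bar> \<le> \<bar>h x - g x\<bar>" for x
      using B[of x] unfolding f_def by linarith
    have "(\<integral>x. \<bar>h x - f x\<bar> \<partial>(\<mu> i)) \<le> (\<integral>x. \<bar>h x - g x\<bar> \<partial>(\<mu> i))"
      using int by (intro Bochner_Integration.integral_mono closer) auto
    then show ?thesis using g(2)[OF i] by linarith
  qed
  with f fB show thesis by (rule that)
qed

end

section \<open>The Heckman--Opdam semigroup\<close>

locale HO_semigroup = feller_kernel T P
  for T :: "real \<Rightarrow> ('a::euclidean_space \<Rightarrow> real) \<Rightarrow> ('a \<Rightarrow> real)" and P :: "real \<Rightarrow> 'a \<Rightarrow> 'a measure" +
  fixes R Rp :: "'a set" and k :: "'a \<Rightarrow> real"
  assumes root_system: "integral_root_system R"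
    and positive: "positive_roots R Rp"
    and multiplicity: "multiplicity_function R k"
    and k_nonneg: "\<And>\<alpha>. \<alpha> \<in> R \<Longrightarrow> 0 \<le> k \<alpha>"
    and generator: "generator T = graph_closure (half_HO_graph R Rp k)"
begin

lemma cutoff_in_generator:
  assumes "0 < n"
  shows "(cutoff 1 (n\<^sup>2), \<lambda>x. cutoff_HO Rp k (n\<^sup>2) x / 2) \<in> generator T"
proof -
  have HO: "(\<lambda>x. cutoff_HO Rp k (n\<^sup>2) x / 2) = (\<lambda>x. HO_laplacian R Rp k (cutoff 1 (n\<^sup>2)) x / 2)"
    by (simp add: HO_laplacian_cutoff[OF root_system positive])
  have graph: "(cutoff 1 (n\<^sup>2), \<lambda>x. cutoff_HO Rp k (n\<^sup>2) x / 2) \<in> half_HO_graph R Rp k"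
    unfolding half_HO_graph_def HO using cutoff_Cc_infinity[OF assms] by blast
  have "cutoff 1 (n\<^sup>2) \<in> C0"
  proof (rule compact_support_C0[of _ n])
    show "continuous_on UNIV (cutoff 1 (n\<^sup>2))"
      using Ck_cutoff[of 0] by simp
  qed (use assms cutoff_outside in blast)
  moreover have "(\<lambda>x. cutoff_HO Rp k (n\<^sup>2) x / 2) \<in> C0"
  proof (rule compact_support_C0[of _ n])
    show "continuous_on UNIV (\<lambda>x. cutoff_HO Rp k (n\<^sup>2) x / 2)"
      using continuous_cutoff_HO
      by (intro continuous_on_divide continuous_on_const continuous_at_imp_continuous_on) auto
    show "cutoff_HO Rp k (n\<^sup>2) x / 2 = 0" if "n \<le> norm x" for x
      using cutoff_outside[OF that assms] by (simp add: cutoff_HO_def)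
  qed
  moreover have "\<exists>\<phi> \<psi>. (\<forall>m::nat. (\<phi> m, \<psi> m) \<in> half_HO_graph R Rp k)
      \<and> uniform_limit UNIV \<phi> (cutoff 1 (n\<^sup>2)) sequentially
      \<and> uniform_limit UNIV \<psi> (\<lambda>x. cutoff_HO Rp k (n\<^sup>2) x / 2) sequentially"
    by (rule exI[of _ "\<lambda>_. cutoff 1 (n\<^sup>2)"],
        rule exI[of _ "\<lambda>_ x. cutoff_HO Rp k (n\<^sup>2) x / 2"])
      (intro conjI allI graph uniform_limit_const)
  ultimately show ?thesis
    unfolding generator graph_closure_def by simp
qed

text \<open>The cutoffs tend to a constant boundedly while their images under the generator tend to
  zero uniformly, so the semigroup loses no mass.\<close>

theorem conservative:
  assumes "0 \<le> t"
  shows "measure (P t x) UNIV = 1"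
proof -
  interpret Pt: finite_measure "P t x"
    using assms by (rule finite_measure_P)
  define \<phi> :: "nat \<Rightarrow> 'a \<Rightarrow> real" where "\<phi> n = cutoff 1 ((real (Suc n))\<^sup>2)" for n
  obtain A where A: "0 \<le> A" "\<And>n x. 1 \<le> n \<Longrightarrow> \<bar>cutoff_HO Rp k (n\<^sup>2) x\<bar> \<le> A / n"
    by (rule cutoff_HO_bound[of Rp k], rule that, assumption+)
  obtain B where B: "0 \<le> B" "\<And>t. t \<le> 1 \<Longrightarrow> \<bar>flat 1 t\<bar> \<le> B"
    by (rule flat_bounded[of 1], rule that, assumption+)
  have gen: "(\<phi> n, \<lambda>x. cutoff_HO Rp k ((real (Suc n))\<^sup>2) x / 2) \<in> generator T" for n
    unfolding \<phi>_def by (rule cutoff_in_generator) simp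
  then have C0: "\<phi> n \<in> C0" for n
    by (simp add: generator_def)
  have lim: "(\<lambda>n. \<phi> n y) \<longlonglongrightarrow> flat 1 1" for y
  proof -
    have "(\<lambda>n. 1 / real (Suc n)) \<longlonglongrightarrow> 0"
      by (rule LIMSEQ_Suc[OF lim_1_over_n])
    then have "(\<lambda>n. 1 - (y \<bullet> y) * (1 / real (Suc n))\<^sup>2) \<longlonglongrightarrow> 1 - (y \<bullet> y) * 0\<^sup>2"
      by (intro tendsto_intros)
    then have "(\<lambda>n. 1 - (y \<bullet> y) / (real (Suc n))\<^sup>2) \<longlonglongrightarrow> 1"
      by (simp add: power_divide)
    then show ?thesis
      unfolding \<phi>_def cutoff_def
      using flat_has_derivative DERIV_isCont by (intro isCont_tendsto_compose[of _ "flat 1"]) blast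
  qed
  have "(\<lambda>n. T t (\<phi> n) x - \<phi> n x) \<longlonglongrightarrow> 0"
  proof (rule tendsto_rabs_zero_cancel, rule tendsto_sandwich)
    show "\<forall>\<^sub>F n in sequentially. 0 \<le> \<bar>T t (\<phi> n) x - \<phi> n x\<bar>" by simp
    have "\<bar>cutoff_HO Rp k ((real (Suc n))\<^sup>2) y / 2\<bar> \<le> A / 2 * (1 / real (Suc n))" for n y
      using A(2)[of "real (Suc n)" y] by (simp del: of_nat_Suc)
    then have "\<bar>T t (\<phi> n) x - \<phi> n x\<bar> \<le> t * (A / 2 * (1 / real (Suc n)))" for n
      by (rule T_generator_bound[OF gen _ assms])
    then show "\<forall>\<^sub>F n in sequentially. \<bar>T t (\<phi> n) x - \<phi> n x\<bar> \<le> t * (A / 2 * (1 / real (Suc n)))"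
      by (intro always_eventually allI)
    have "(\<lambda>n. t * (A / 2 * (1 / real (Suc n)))) \<longlonglongrightarrow> t * (A / 2 * 0)"
      by (intro tendsto_mult tendsto_const LIMSEQ_Suc[OF lim_1_over_n])
    then show "(\<lambda>n. t * (A / 2 * (1 / real (Suc n)))) \<longlonglongrightarrow> 0" by simp
  qed simp
  from tendsto_add[OF this lim[of x]] have "(\<lambda>n. T t (\<phi> n) x) \<longlonglongrightarrow> flat 1 1"
    by simp
  moreover have "(\<lambda>n. \<integral>y. \<phi> n y \<partial>(P t x)) \<longlonglongrightarrow> (\<integral>y. flat 1 1 \<partial>(P t x))"
  proof (rule integral_dominated_convergence[where w = "\<lambda>_. B"])
    show "\<phi> n \<in> borel_measurable (P t x)" for n
      by (subst measurable_cong_sets[OF sets_P[OF assms] refl]) (rule C0_measurable[OF C0])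
    show "AE y in P t x. norm (\<phi> n y) \<le> B" for n
      unfolding \<phi>_def cutoff_def by (intro AE_I2) (simp add: B(2))
  qed (use lim in auto)
  then have "(\<lambda>n. T t (\<phi> n) x) \<longlonglongrightarrow> flat 1 1 * measure (P t x) UNIV"
    using sets_eq_imp_space_eq[OF sets_P[OF assms]] by (simp add: T_eq_integral[OF assms C0] mult.commute)
  ultimately have "flat 1 1 = flat 1 1 * measure (P t x) UNIV"
    by (rule LIMSEQ_unique)
  then show ?thesis
    by (simp add: flat_def)
qed

lemma orbit_sum_mono_diff:
  fixes c :: real
  assumes "\<And>x. \<bar>f x - g x\<bar> \<le> c"
  shows "\<bar>orbit_sum R f x - orbit_sum R g x\<bar> \<le> card (weyl_group R) * c"
proof -
  have "\<bar>orbit_sum R f x - orbit_sum R g x\<bar> \<le> (\<Sum>w\<in>weyl_group R. \<bar>f (w x) - g (w x)\<bar>)"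
    unfolding orbit_sum_def sum_subtractf[symmetric] by (rule sum_abs)
  also have "\<dots> \<le> (\<Sum>w\<in>weyl_group R. c)"
    by (intro sum_mono assms)
  finally show ?thesis by simp
qed

text \<open>A test function is in general not invariant, but its orbit sum is, and both sides of its
  equation at \<open>w z\<close> may be summed over \<open>w\<close>; this costs the order of the group as a factor.\<close>

lemma orbit_sum_test_function:
  fixes M :: real
  assumes \<phi>: "\<phi> \<in> Cc_infinity" and "0 < \<mu>"
    and M: "\<And>x. \<bar>\<mu> * \<phi> x - HO_laplacian R Rp k \<phi> x / 2\<bar> \<le> M"
  shows "orbit_sum R \<phi> x - orbit_sum R \<phi> y
    \<le> 2 * (card (weyl_group R) * M) / \<mu> * (1 - exp (- sqrt (\<mu> / 2) * norm (x - y)))"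
proof -
  have fin: "finite (weyl_group R)"
    using root_system by (rule finite_weyl_group)
  have "C2 \<phi>"
    using \<phi> by (rule Cc_infinity_C2)
  have "bounded (closure {z. \<phi> z \<noteq> 0})"
    using \<phi> by (simp add: Cc_infinity_def compact_imp_bounded)
  from bounded_subset[OF this closure_subset]
  obtain b where b: "\<And>z. \<phi> z \<noteq> 0 \<Longrightarrow> norm z \<le> b"
    unfolding bounded_iff by blast
  show ?thesis
  proof (rule reflection_coupling_estimate[OF root_system positive, where K = "cball 0 b"])
    show "C2 (orbit_sum R \<phi>)"
      using \<open>C2 \<phi>\<close> fin by (rule orbit_sum_derivs(3))
    show "0 \<le> k \<alpha>" if "\<alpha> \<in> Rp" for \<alpha>
      using that k_nonneg positive_roots_subset[OF positive] by blast
    show "orbit_sum R \<phi> (root_reflection \<alpha> z) = orbit_sum R \<phi> z" if "\<alpha> \<in> R" for \<alpha> z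
      using that by (rule orbit_sum_reflection)
    show "compact (cball (0::'a) b)" by simp
    show "orbit_sum R \<phi> z = 0" if "z \<notin> cball 0 b" for z
      unfolding orbit_sum_def
    proof (intro sum.neutral ballI)
      fix w assume "w \<in> weyl_group R"
      then have "norm (w z) = norm z"
        by (simp add: orthogonal_transformation_norm orthogonal_transformation_weyl_group)
      then show "\<phi> (w z) = 0"
        using that b[of "w z"] by auto
    qed
    show "0 < \<mu>" by fact
    show "\<bar>\<mu> * orbit_sum R \<phi> z - radial_formula Rp k (orbit_sum R \<phi>) z / 2\<bar> \<le> card (weyl_group R) * M"
      if z: "z \<in> regular_points R" for z
    proof -
      have "radial_formula Rp k (orbit_sum R \<phi>) z = (\<Sum>w\<in>weyl_group R. HO_laplacian R Rp k \<phi> (w z))"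
        unfolding sum_HO_formula_orbit[OF root_system positive multiplicity \<open>C2 \<phi>\<close>, symmetric]
        using regular_points_weyl_group[OF root_system _ z] by (intro sum.cong) (auto simp: HO_laplacian_def)
      then have "\<mu> * orbit_sum R \<phi> z - radial_formula Rp k (orbit_sum R \<phi>) z / 2
          = (\<Sum>w\<in>weyl_group R. \<mu> * \<phi> (w z) - HO_laplacian R Rp k \<phi> (w z) / 2)"
        by (simp add: orbit_sum_def sum_subtractf sum_distrib_left sum_divide_distrib)
      also have "\<bar>\<dots>\<bar> \<le> (\<Sum>w\<in>weyl_group R. M)"
        by (intro order_trans[OF sum_abs] sum_mono M)
      finally show ?thesis by simp
    qed
  qed
qed

text \<open>With the parameter \<open>\<mu> = 1/N\<close> the function \<open>\<mu> u - (T N f - f)\<close>, where \<open>u\<close> is the time integral,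
  is bounded by \<open>3 B\<close> independently of \<open>N\<close>.\<close>

theorem orbit_time_integral_estimate:
  assumes f: "f \<in> C0" and B: "\<And>x. \<bar>f x\<bar> \<le> B" and "0 < N"
  shows "orbit_sum R (time_integral N f) x - orbit_sum R (time_integral N f) y
    \<le> 6 * N * card (weyl_group R) * B * (1 - exp (- sqrt (1 / (2 * N)) * norm (x - y)))"
proof -
  let ?u = "time_integral N f" and ?g = "\<lambda>x. T N f x - f x"
  let ?E = "1 - exp (- sqrt (1 / (2 * N)) * norm (x - y))" and ?w = "real (card (weyl_group R))"
  obtain \<phi> \<psi> where gr: "\<And>m. (\<phi> m, \<psi> m) \<in> half_HO_graph R Rp k"
    and \<phi>: "uniform_limit UNIV \<phi> ?u sequentially" and \<psi>: "uniform_limit UNIV \<psi> ?g sequentially"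
    using time_integral_generator[OF f \<open>0 < N\<close>] unfolding generator graph_closure_def by auto
  have TB: "\<bar>T s f z\<bar> \<le> B" if "0 \<le> s" for s z
    using T_contraction[OF that f B] .
  have uB: "\<bar>1 / N * ?u z\<bar> \<le> B" for z
  proof -
    have "norm (integral {0..N} (\<lambda>s. T s f z)) \<le> B * (N - 0)"
      using \<open>0 < N\<close> TB by (intro integral_bound T_continuous_on_nonneg f) auto
    then show ?thesis
      using \<open>0 < N\<close> by (simp add: time_integral_def abs_mult pos_divide_le_eq)
  qed
  have gB: "\<bar>?g z\<bar> \<le> 2 * B" for z
    using TB[of N z] B[of z] \<open>0 < N\<close> by simp
  have eps: "orbit_sum R ?u x - orbit_sum R ?u y
      \<le> 2 * (?w * (3 * B + \<epsilon> / N + \<epsilon>)) * N * ?E + 2 * (?w * \<epsilon>)" if "0 < \<epsilon>" for \<epsilon>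
  proof -
    have "\<forall>\<^sub>F m in sequentially. (\<forall>z\<in>UNIV. dist (\<phi> m z) (?u z) < \<epsilon>) \<and> (\<forall>z\<in>UNIV. dist (\<psi> m z) (?g z) < \<epsilon>)"
      using uniform_limitD[OF \<phi> that] uniform_limitD[OF \<psi> that] by (rule eventually_conj)
    then obtain m where m: "\<And>z. \<bar>\<phi> m z - ?u z\<bar> < \<epsilon>" "\<And>z. \<bar>\<psi> m z - ?g z\<bar> < \<epsilon>"
      by (auto simp: eventually_sequentially dist_real_def)
    have \<phi>m: "\<phi> m \<in> Cc_infinity" "\<And>z. \<psi> m z = HO_laplacian R Rp k (\<phi> m) z / 2"
      using gr[of m] by (auto simp: half_HO_graph_def)
    have "\<bar>1 / N * \<phi> m z - HO_laplacian R Rp k (\<phi> m) z / 2\<bar> \<le> 3 * B + \<epsilon> / N + \<epsilon>" for z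
    proof -
      have "\<bar>1 / N * \<phi> m z - 1 / N * ?u z\<bar> = 1 / N * \<bar>\<phi> m z - ?u z\<bar>"
        using \<open>0 < N\<close> by (simp add: right_diff_distrib[symmetric] abs_mult diff_divide_distrib[symmetric])
      also have "\<dots> \<le> 1 / N * \<epsilon>"
        using \<open>0 < N\<close> m(1)[of z] by (intro mult_left_mono) auto
      finally have "\<bar>1 / N * \<phi> m z - 1 / N * ?u z\<bar> \<le> \<epsilon> / N" by simp
      moreover have "\<bar>a - q\<bar> \<le> 3 * B + \<delta> + \<epsilon>"
        if "\<bar>a - b\<bar> \<le> \<delta>" "\<bar>b\<bar> \<le> B" "\<bar>q - g\<bar> < \<epsilon>" "\<bar>g\<bar> \<le> 2 * B" for a b g q \<delta>
        using that by linarith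
      ultimately show ?thesis
        using uB[of z] gB[of z] m(2)[of z] unfolding \<phi>m(2) by blast
    qed
    from orbit_sum_test_function[OF \<phi>m(1) _ this, of x y]
    have "orbit_sum R (\<phi> m) x - orbit_sum R (\<phi> m) y \<le> 2 * (?w * (3 * B + \<epsilon> / N + \<epsilon>)) * N * ?E"
      using \<open>0 < N\<close> by (simp add: mult.commute[of 2 N])
    moreover have "\<bar>orbit_sum R (\<phi> m) z - orbit_sum R ?u z\<bar> \<le> ?w * \<epsilon>" for z
      using m(1) by (intro orbit_sum_mono_diff less_imp_le)
    from this[of x] this[of y]
    have "orbit_sum R ?u x - orbit_sum R ?u y \<le> orbit_sum R (\<phi> m) x - orbit_sum R (\<phi> m) y + 2 * (?w * \<epsilon>)"
      by simp
    ultimately show ?thesis by linarith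
  qed
  have "((\<lambda>\<epsilon>. 2 * (?w * (3 * B + \<epsilon> / N + \<epsilon>)) * N * ?E + 2 * (?w * \<epsilon>))
      \<longlongrightarrow> 2 * (?w * (3 * B + 0 / N + 0)) * N * ?E + 2 * (?w * 0)) (at_right 0)"
    using \<open>0 < N\<close> by (intro tendsto_intros) auto
  moreover have "\<forall>\<^sub>F \<epsilon> in at_right 0. orbit_sum R ?u x - orbit_sum R ?u y
      \<le> 2 * (?w * (3 * B + \<epsilon> / N + \<epsilon>)) * N * ?E + 2 * (?w * \<epsilon>)"
    by (rule eventually_mono[OF eventually_at_right_less[of 0]]) (rule eps)
  ultimately have "orbit_sum R ?u x - orbit_sum R ?u y
      \<le> 2 * (?w * (3 * B + 0 / N + 0)) * N * ?E + 2 * (?w * 0)"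
    by (rule tendsto_lowerbound) simp
  then show ?thesis by (simp add: algebra_simps)
qed

end

section \<open>Time averages of the transition kernel\<close>

context feller_kernel
begin

text \<open>The mass of a box is a limit of integrals of \<open>C0\<close> functions, which depend continuously on
  time.\<close>

lemma P_measurable_in_time: "(\<lambda>s. P (max 0 s) x) \<in> borel \<rightarrow>\<^sub>M subprob_algebra borel"
proof (rule measurable_subprob_algebra_generated)
  show "sets (borel :: 'a measure) = sigma_sets UNIV (range (\<lambda>(a, b). box a b))"
    by (subst borel_eq_box) (rule sets_measure_of, simp)
  show "Int_stable (range (\<lambda>(a, b). box a b :: 'a set))"
    by (auto simp: Int_stable_def box_Int_box)
  have bounded_limit: "(\<lambda>s. emeasure (P (max 0 s) x) A) \<in> borel_measurable borel"
    if A: "A \<in> sets borel" and g: "\<And>n. g n \<in> C0" "\<And>n y. 0 \<le> g n y \<and> g n y \<le> 1"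
      "\<And>y. (\<lambda>n. g n y) \<longlonglongrightarrow> indicator A y" for A and g :: "nat \<Rightarrow> 'a \<Rightarrow> real"
  proof -
    have "(\<lambda>n. T (max 0 s) (g n) x) \<longlonglongrightarrow> measure (P (max 0 s) x) A" for s
    proof -
      interpret Ps: finite_measure "P (max 0 s) x" by (rule finite_measure_P) simp
      have sets: "sets (P (max 0 s) x) = sets borel" by (rule sets_P) simp
      have "(\<lambda>n. \<integral>y. g n y \<partial>(P (max 0 s) x)) \<longlonglongrightarrow> (\<integral>y. indicator A y \<partial>(P (max 0 s) x))"
      proof (rule integral_dominated_convergence[where w = "\<lambda>_. 1"])
        show "g n \<in> borel_measurable (P (max 0 s) x)" for n
          by (subst measurable_cong_sets[OF sets refl]) (rule C0_measurable[OF g(1)])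
        show "indicator A \<in> borel_measurable (P (max 0 s) x)"
          by (subst measurable_cong_sets[OF sets refl]) (rule borel_measurable_indicator[OF A])
      qed (use g in auto)
      then show ?thesis
        using A sets sets_eq_imp_space_eq[OF sets] by (simp add: T_eq_integral[OF _ g(1)])
    qed
    then have "(\<lambda>s. measure (P (max 0 s) x) A) \<in> borel_measurable borel"
      by (rule borel_measurable_LIMSEQ_real)
        (intro borel_measurable_continuous_onI T_continuous_in_time g(1))
    then have "(\<lambda>s. ennreal (measure (P (max 0 s) x) A)) \<in> borel_measurable borel" by simp
    moreover have "ennreal (measure (P (max 0 s) x) A) = emeasure (P (max 0 s) x) A" for s
      using finite_measure.emeasure_eq_measure[OF finite_measure_P[of "max 0 s"]] by simp
    ultimately show ?thesis by simp
  qed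
  show "(\<lambda>s. emeasure (P (max 0 s) x) A) \<in> borel_measurable borel"
    if box: "A \<in> range (\<lambda>(a, b). box a b)" for A
  proof -
    obtain a b where A: "A = box a b" using box by auto
    obtain g :: "nat \<Rightarrow> 'a \<Rightarrow> real" where g: "\<And>n. g n \<in> C0" "\<And>n x. 0 \<le> g n x \<and> g n x \<le> 1"
      "\<And>x. (\<lambda>n. g n x) \<longlonglongrightarrow> indicator (box a b) x"
      by (rule C0_approximates_box[of a b], rule that, assumption+)
    show ?thesis
      unfolding A by (rule bounded_limit[OF _ g]) (simp add: open_box)
  qed
  obtain g :: "nat \<Rightarrow> 'a \<Rightarrow> real" where g: "\<And>n. g n \<in> C0" "\<And>n x. 0 \<le> g n x \<and> g n x \<le> 1"
    "\<And>x. (\<lambda>n. g n x) \<longlonglongrightarrow> 1"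
    by (rule C0_approximates_one, rule that, assumption+)
  show "(\<lambda>s. emeasure (P (max 0 s) x) UNIV) \<in> borel_measurable borel"
    by (rule bounded_limit[of _ g]) (use g in auto)
qed (simp_all add: subprob_space_P sets_P)

definition time_average :: "real \<Rightarrow> 'a \<Rightarrow> 'a measure" where
  "time_average N x = uniform_measure lborel {0..N} \<bind> (\<lambda>s. P (max 0 s) x)"

context
  fixes N :: real
  assumes N: "0 < N"
begin

lemma prob_space_uniform: "prob_space (uniform_measure lborel {0..N})"
  using N by (intro prob_space_uniform_measure) auto

lemma P_measurable_uniform:
  "(\<lambda>s. P (max 0 s) x) \<in> uniform_measure lborel {0..N} \<rightarrow>\<^sub>M subprob_algebra borel"
  using P_measurable_in_time[of x] by (simp add: measurable_cong_sets[of "uniform_measure lborel {0..N}" borel])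

lemma sets_time_average: "sets (time_average N x) = sets borel"
  unfolding time_average_def by (rule sets_bind) (auto simp: sets_P)

lemma finite_measure_time_average: "finite_measure (time_average N x)"
proof -
  have "subprob_space (time_average N x)"
    unfolding time_average_def
    by (rule subprob_space_bind[OF prob_space_imp_subprob_space[OF prob_space_uniform] P_measurable_uniform])
  then show ?thesis by (simp add: subprob_space_def)
qed

lemma integral_time_average:
  fixes h :: "'a \<Rightarrow> real"
  assumes h: "h \<in> borel_measurable borel" and B: "\<And>x. \<bar>h x\<bar> \<le> B"
  shows "(\<integral>y. h y \<partial>(time_average N x)) = (\<integral>s. (\<integral>y. h y \<partial>(P (max 0 s) x)) \<partial>(uniform_measure lborel {0..N}))"
  unfolding time_average_def
proof (rule integral_bind[OF h _ P_measurable_uniform])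
  show "finite_measure (uniform_measure lborel {0..N})"
    using prob_space_uniform by (simp add: prob_space_def)
  show "\<And>x. x \<in> space borel \<Longrightarrow> \<bar>h x\<bar> \<le> B"
    using B by simp
  show "AE s in uniform_measure lborel {0..N}. emeasure (P (max 0 s) x) (space (P (max 0 s) x)) \<le> ennreal 1"
    using subprob_space.emeasure_space_le_1[OF subprob_space_P] by (intro AE_I2) simp
qed

lemma integral_time_average_C0:
  assumes f: "f \<in> C0"
  shows "(\<integral>y. f y \<partial>(time_average N x)) = 1 / N * time_integral N f x"
proof -
  obtain B where B: "0 \<le> B" "\<And>x. \<bar>f x\<bar> \<le> B"
    by (rule C0_bounded[OF f], rule that, assumption+)
  have dens: "uniform_measure lborel {0..N} = density lborel (\<lambda>s. ennreal (1 / N * indicator {0..N} s))"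
    unfolding uniform_measure_def using N
    by (intro density_cong AE_I2) (auto simp: indicator_def divide_ennreal ennreal_1[symmetric] simp del: ennreal_1)
  have "(\<integral>y. f y \<partial>(time_average N x)) = (\<integral>s. T (max 0 s) f x \<partial>(uniform_measure lborel {0..N}))"
    unfolding integral_time_average[OF C0_measurable[OF f] B(2)]
    by (simp add: T_eq_integral[OF _ f])
  also have "\<dots> = (\<integral>s. (1 / N * indicator {0..N} s) *\<^sub>R T (max 0 s) f x \<partial>lborel)"
    unfolding dens using N borel_measurable_continuous_onI[OF T_continuous_in_time[OF f]]
    by (intro integral_density) auto
  also have "\<dots> = (\<integral>s. 1 / N * (indicator {0..N} s *\<^sub>R T (max 0 s) f x) \<partial>lborel)"
    by simp
  also have "\<dots> = 1 / N * time_integral N f x"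
    unfolding time_integral_eq_lebesgue[OF f] by (rule integral_mult_right_zero)
  finally show ?thesis .
qed

lemma integral_time_average_harmonic:
  fixes h :: "'a \<Rightarrow> real"
  assumes h: "h \<in> borel_measurable borel" and B: "\<And>x. \<bar>h x\<bar> \<le> B"
    and harmonic: "\<And>t. 0 < t \<Longrightarrow> (\<integral>y. h y \<partial>(P t x)) = h x"
  shows "(\<integral>y. h y \<partial>(time_average N x)) = h x"
proof -
  interpret U: prob_space "uniform_measure lborel {0..N}"
    by (rule prob_space_uniform)
  have "AE s in uniform_measure lborel {0..N}. (\<integral>y. h y \<partial>(P (max 0 s) x)) = h x"
  proof (rule AE_uniform_measureI)
    \<comment> \<open>Harmonicity concerns positive times; the instant \<open>0\<close> is negligible.\<close>
    have "AE s in lborel. s \<noteq> (0::real)"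
      by (rule AE_lborel_singleton)
    then show "AE s in lborel. s \<in> {0..N} \<longrightarrow> (\<integral>y. h y \<partial>(P (max 0 s) x)) = h x"
      by eventually_elim (auto intro: harmonic)
  qed simp
  moreover have "(\<lambda>s. \<integral>y. h y \<partial>(P (max 0 s) x)) \<in> borel_measurable (uniform_measure lborel {0..N})"
    by (rule measurable_compose[OF P_measurable_uniform integral_measurable_subprob_algebra[OF h]])
  ultimately have "(\<integral>s. (\<integral>y. h y \<partial>(P (max 0 s) x)) \<partial>(uniform_measure lborel {0..N}))
      = (\<integral>s. h x \<partial>(uniform_measure lborel {0..N}))"
    by (intro integral_cong_AE) auto
  then show ?thesis
    unfolding integral_time_average[OF h B] using U.prob_space by simp
qed

end

end

section \<open>Bounded invariant harmonic functions\<close>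

context HO_semigroup
begin

text \<open>The estimate for \<open>C0\<close> functions depends on them only through a uniform bound \<open>B\<close>. It thus
  survives the approximation of \<open>h\<close> by \<open>C0\<close> functions with the same bound, in the mean with
  respect to the time averages started from the two orbits. The time average of \<open>h\<close> is \<open>h\<close>.\<close>

lemma harmonic_difference_bound:
  assumes h: "h \<in> borel_measurable borel" and B: "\<And>x. \<bar>h x\<bar> \<le> B"
    and harmonic: "\<And>t x. 0 < t \<Longrightarrow> (\<integral>y. h y \<partial>(P t x)) = h x"
    and inv: "weyl_invariant R h" and "0 < N"
  shows "h x - h y \<le> 6 * B * (1 - exp (- sqrt (1 / (2 * N)) * norm (x - y)))"
proof -
  let ?W = "weyl_group R" and ?E = "1 - exp (- sqrt (1 / (2 * N)) * norm (x - y))"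
  define c where "c = real (card ?W)"
  have fin: "finite ?W"
    using root_system by (rule finite_weyl_group)
  then have "0 < c"
    using weyl_group.one[of R] by (auto simp: c_def card_gt_0_iff)
  have orbit: "orbit_sum R h z = c * h z" for z
    using inv by (simp add: orbit_sum_def weyl_invariant_def c_def)
  interpret finite_measure_family "(\<lambda>w. w x) ` ?W \<union> (\<lambda>w. w y) ` ?W" "time_average N"
    by (intro finite_measure_family.intro finite_measure_time_average[OF \<open>0 < N\<close>]
        sets_time_average[OF \<open>0 < N\<close>]) (simp add: fin)
  have "c * (h x - h y) \<le> c * (6 * B * ?E) + 2 * (c * \<epsilon>)" if eps: "0 < \<epsilon>" for \<epsilon>
  proof -
    obtain f where f: "f \<in> C0" "\<And>z. \<bar>f z\<bar> \<le> B"
      "\<And>z. z \<in> (\<lambda>w. w x) ` ?W \<union> (\<lambda>w. w y) ` ?W \<Longrightarrow> (\<integral>u. \<bar>h u - f u\<bar> \<partial>(time_average N z)) < \<epsilon>"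
      by (rule bounded_measurable_L1_approximation[OF h B eps], rule that, assumption+)
    have close: "\<bar>h z - 1 / N * time_integral N f z\<bar> \<le> \<epsilon>"
      if z: "z \<in> (\<lambda>w. w x) ` ?W \<union> (\<lambda>w. w y) ` ?W" for z
    proof -
      have "h z - 1 / N * time_integral N f z
          = (\<integral>u. h u \<partial>(time_average N z)) - (\<integral>u. f u \<partial>(time_average N z))"
      proof -
        have "(\<integral>u. h u \<partial>(time_average N z)) = h z"
          by (rule integral_time_average_harmonic[OF \<open>0 < N\<close> h B harmonic])
        then show ?thesis
          by (simp only: integral_time_average_C0[OF \<open>0 < N\<close> f(1)])
      qed
      also have "\<dots> = (\<integral>u. h u - f u \<partial>(time_average N z))"
        using integrable_mu[OF z h B] integrable_mu[OF z C0_measurable[OF f(1)] f(2)]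
        by (rule Bochner_Integration.integral_diff[symmetric])
      also have "\<bar>\<dots>\<bar> \<le> (\<integral>u. \<bar>h u - f u\<bar> \<partial>(time_average N z))"
        by (rule integral_abs_bound)
      finally show ?thesis
        using f(3)[OF z] by linarith
    qed
    have orbit_close: "\<bar>c * h z - 1 / N * orbit_sum R (time_integral N f) z\<bar> \<le> c * \<epsilon>"
      if z: "(\<lambda>w. w z) ` ?W \<subseteq> (\<lambda>w. w x) ` ?W \<union> (\<lambda>w. w y) ` ?W" for z
    proof -
      have "c * h z - 1 / N * orbit_sum R (time_integral N f) z
          = (\<Sum>w\<in>?W. h (w z) - 1 / N * time_integral N f (w z))"
        unfolding orbit[symmetric] orbit_sum_def by (simp add: sum_subtractf sum_distrib_left sum_divide_distrib)
      also have "\<bar>\<dots>\<bar> \<le> (\<Sum>w\<in>?W. \<epsilon>)"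
        using z by (intro order_trans[OF sum_abs] sum_mono close) auto
      finally show ?thesis by (simp add: c_def)
    qed
    have "1 / N * (orbit_sum R (time_integral N f) x - orbit_sum R (time_integral N f) y)
        \<le> 1 / N * (6 * N * c * B * ?E)"
      using orbit_time_integral_estimate[OF f(1,2) \<open>0 < N\<close>, of x y] \<open>0 < N\<close>
      unfolding c_def by (intro mult_left_mono) auto
    also have "\<dots> = c * (6 * B * ?E)"
      using \<open>0 < N\<close> by simp
    finally have "1 / N * orbit_sum R (time_integral N f) x - 1 / N * orbit_sum R (time_integral N f) y
        \<le> c * (6 * B * ?E)"
      by (simp only: right_diff_distrib)
    then show ?thesis
      using orbit_close[of x] orbit_close[of y] unfolding right_diff_distrib by simp
  qed
  then have "\<forall>\<^sub>F \<epsilon> in at_right 0. c * (h x - h y) \<le> c * (6 * B * ?E) + 2 * (c * \<epsilon>)"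
    by (intro eventually_mono[OF eventually_at_right_less[of 0]])
  moreover have "((\<lambda>\<epsilon>. c * (6 * B * ?E) + 2 * (c * \<epsilon>)) \<longlongrightarrow> c * (6 * B * ?E) + 2 * (c * 0)) (at_right 0)"
    by (intro tendsto_intros)
  ultimately have "c * (h x - h y) \<le> c * (6 * B * ?E) + 2 * (c * 0)"
    by (intro tendsto_lowerbound) auto
  then show ?thesis
    using \<open>0 < c\<close> by simp
qed

theorem bounded_invariant_harmonic_constant:
  assumes "bounded_harmonic P h" and inv: "weyl_invariant R h"
  shows "h x = h y"
proof -
  have "bounded (range h)"
    using assms(1) by (simp add: bounded_harmonic_def)
  then obtain B where "\<forall>y\<in>range h. norm y \<le> B"
    unfolding bounded_iff ..
  then have B: "\<bar>h x\<bar> \<le> B" for x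
    by simp
  have h: "h \<in> borel_measurable borel" "\<And>t x. 0 < t \<Longrightarrow> (\<integral>y. h y \<partial>(P t x)) = h x"
    using assms(1) unfolding bounded_harmonic_def by simp_all
  have "h x - h y \<le> 0" for x y
  proof (rule tendsto_lowerbound)
    have "((\<lambda>N::real. inverse N) \<longlongrightarrow> 0) at_top"
      using tendsto_inverse_0_at_top[OF filterlim_ident] .
    from tendsto_mult[OF tendsto_const[of "1 / 2"] this]
    have "((\<lambda>N::real. 1 / 2 * inverse N) \<longlongrightarrow> 1 / 2 * 0) at_top" .
    then have "((\<lambda>N::real. 1 / (2 * N)) \<longlongrightarrow> 0) at_top"
      by (simp add: inverse_eq_divide)
    then have "((\<lambda>N. sqrt (1 / (2 * N))) \<longlongrightarrow> sqrt 0) at_top"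
      by (rule tendsto_real_sqrt)
    from tendsto_exp[OF tendsto_mult[OF tendsto_minus[OF this] tendsto_const[of "norm (x - y)"]]]
    have exp: "((\<lambda>N. exp (- sqrt (1 / (2 * N)) * norm (x - y)))
        \<longlongrightarrow> exp (- sqrt 0 * norm (x - y))) at_top" .
    from tendsto_mult[OF tendsto_const[of "6 * B"] tendsto_diff[OF tendsto_const[of 1] exp]]
    have "((\<lambda>N. 6 * B * (1 - exp (- sqrt (1 / (2 * N)) * norm (x - y))))
        \<longlongrightarrow> 6 * B * (1 - exp (- sqrt 0 * norm (x - y)))) at_top" .
    then show "((\<lambda>N. 6 * B * (1 - exp (- sqrt (1 / (2 * N)) * norm (x - y)))) \<longlongrightarrow> 0) at_top"
      by simp
    show "\<forall>\<^sub>F N in at_top. h x - h y \<le> 6 * B * (1 - exp (- sqrt (1 / (2 * N)) * norm (x - y)))"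
      by (rule eventually_mono[OF eventually_gt_at_top[of 0]])
        (rule harmonic_difference_bound[OF h(1) B h(2) inv])
  qed simp
  from this[of x y] this[of y x] show ?thesis by simp
qed

lemma constant_bounded_harmonic: "bounded_harmonic P (\<lambda>x. c)"
  unfolding bounded_harmonic_def
proof (intro conjI allI impI)
  fix t :: real and x assume "0 < t"
  then have "0 \<le> t" by simp
  then show "(\<integral>y. c \<partial>(P t x)) = c"
    using conservative[OF \<open>0 \<le> t\<close>, of x] sets_eq_imp_space_eq[OF sets_P[OF \<open>0 \<le> t\<close>], of x] by simp
qed simp_all

end

theorem theorem1p1:
  fixes R Rp :: "'a::euclidean_space set"
    and k :: "'a \<Rightarrow> real"
    and T :: "real \<Rightarrow> ('a \<Rightarrow> real) \<Rightarrow> ('a \<Rightarrow> real)"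
    and P :: "real \<Rightarrow> 'a \<Rightarrow> 'a measure"
  assumes root_system: "integral_root_system R"
    and positive: "positive_roots R Rp"
    and multiplicity: "multiplicity_function R k"
    and k_pos: "\<And>\<alpha>. \<alpha> \<in> R \<Longrightarrow> 0 < k \<alpha>"
    and k_ge_half: "\<And>\<alpha>. \<alpha> \<in> R \<Longrightarrow> 1 / 2 \<le> k \<alpha>"
    and feller: "feller_semigroup T"
    and generator: "generator T = graph_closure (half_HO_graph R Rp k)"
    and kernel: "transition_kernel T P"
  shows "{h. bounded_harmonic P h \<and> weyl_invariant R h} = {h. \<exists>c. h = (\<lambda>x. c)}"
proof -
  interpret HO_semigroup T P R Rp k
    by unfold_locales
      (use root_system positive multiplicity k_pos feller generator kernel in \<open>auto intro: less_imp_le\<close>)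
  show ?thesis
  proof (intro set_eqI iffI; clarify)
    fix h assume "bounded_harmonic P h" "weyl_invariant R h"
    then have "h = (\<lambda>x. h 0)"
      using bounded_invariant_harmonic_constant by blast
    then show "\<exists>c. h = (\<lambda>x. c)" by blast
  next
    fix c :: real
    show "bounded_harmonic P (\<lambda>x. c) \<and> weyl_invariant R (\<lambda>x. c)"
      using constant_bounded_harmonic by (simp add: weyl_invariant_def)
  qed
qed

end
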